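(* Let $(M^d,[g],I)$, $d\geq 3$, $d\neq4$, be a (directed) almost Einstein manifold in Riemannian signature. Then $$I^A\,\mathbf{D}_A W=0,$$ where $W$ is the $W$-tractor of $(M,[g])$ and $\mathbf{D}_A$ is the modified tractor-$D$ operator defined in the context.
   Context: Conventions. $M$ is connected, metrics are Riemannian, $[\cdots]$ on indices denotes antisymmetrisation, $(\nabla_a\nabla_b-\nabla_b\nabla_a)V^c=R_{ab}{}^c{}_dV^d$, $\mathrm{Ric}_{ab}=R_{ca}{}^c{}_b$, $\mathrm{Ric}=(d-2)P+Jg$. $C$ is the Weyl tensor, $A_{abc}=2\nabla_{[b}P_{c]a}$ (Cotton), $B_{ab}=\nabla^cA_{acb}+P^{dc}C_{dacb}$ (Bach). $\mathcal{E}[w]$ is the density bundle of weight $w$: sections are functions on the bundle of metrics in $[g]$ with $f(x,s^2g_x)=s^wf(x,g_x)$; each $g\in[g]$ trivialises it and gives it a connection. $\boldsymbol{g}$ is the conformal metric (tautological section of $S^2T^*M\otimes\mathcal{E}[2]$), used to raise/lower indices; $J=\boldsymbol{g}^{ab}P_{ab}$ and $\Delta=-\boldsymbol{g}^{ab}\nabla_a\nabla_b$. Tractors. The standard tractor bundle $\mathcal{T}$ is the rank $d+2$ bundle which, for each $g\in[g]$, is identified with $\mathcal{E}[1]\oplus T^*M[1]\oplus\mathcal{E}[-1]$, where for $\hat g=e^{2\omega}g$, $\Upsilon=d\omega$, triples transform by $(\sigma,\mu_b,\rho)\mapsto(\sigma,\mu_b+\sigma\Upsilon_b,\rho-\Upsilon^b\mu_b-\frac12\sigma\Upsilon^b\Upsilon_b)$.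 It has the tractor metric $h$, with quadratic form $\boldsymbol{g}^{-1}(\mu,\mu)+2\sigma\rho$, and the tractor connection $\nabla_a(\sigma,\mu_b,\rho)=(\nabla_a\sigma-\mu_a,\ \nabla_a\mu_b+\boldsymbol{g}_{ab}\rho+P_{ab}\sigma,\ \nabla_a\rho-P_{ab}\mu^b)$. Given $g$, write a tractor as $V^A=Y^A\sigma+Z^{Aa}\mu_a+X^A\rho$, defining $X_A,Y_A,Z_A{}^a$; tractor indices are moved with $h$. The tractor connection is coupled to the Levi-Civita connection. The $W$-tractor, a conformally invariant section of $\otimes^4\mathcal{T}$ of weight $-2$, is $$W_{ABCE}=(d-4)\big(Z_A{}^aZ_B{}^bZ_C{}^cZ_E{}^eC_{abce}-2Z_A{}^aZ_B{}^bX_{[C}Z_{E]}{}^eA_{eab}-2X_{[A}Z_{B]}{}^bZ_C{}^cZ_E{}^eA_{bce}\big)+4X_{[A}Z_{B]}{}^bX_{[C}Z_{E]}{}^eB_{eb}.$$ Operators. For a section $A$ of $\mathrm{End}\,\mathcal{T}$, $A\sharp$ is the natural tensorial action, e.g. $A\sharp T_{AB}=-A^C{}_AT_{CB}-A^C{}_BT_{AC}$. Viewing $W$ as a section of $\mathrm{End}\,\mathcal{T}\otimes\mathrm{End}\,\mathcal{T}$ (each skew pair of indices giving an $h$-skew endomorphism), $W\sharp\sharp T$ is the double action determined by $(A\otimes B)\sharp\sharp T=A\sharp(B\sharp T)$. For $d\ne4$ and $T$ a tractor section of weight $w$, $$\boldsymbol{\Box}T=(\Delta-wJ)T-\tfrac{1}{2(d-4)}W\sharp\sharp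 T,\qquad \mathbf{D}_AT=(d+2w-2)wY_AT+(d+2w-2)Z_{Aa}\nabla^aT+X_A\boldsymbol{\Box}T.$$ A (directed) almost Einstein manifold $(M,[g],I)$ is a conformal manifold with a non-zero parallel section $I$ of $\mathcal{T}$. *)

theory Defs
  imports "HOL-Analysis.Analysis"
begin

section \<open>Smooth functions on open subsets of coordinate space\<close>

definition pd :: "'n::finite \<Rightarrow> (real^'n \<Rightarrow> real) \<Rightarrow> real^'n \<Rightarrow> real" where
  "pd i f x = frechet_derivative f (at x) (axis i 1)"

primrec Ck_on :: "nat \<Rightarrow> (real^'n::finite) set \<Rightarrow> (real^'n \<Rightarrow> real) \<Rightarrow> bool" where
  "Ck_on 0 U f \<longleftrightarrow> continuous_on U f"
| "Ck_on (Suc k) U f \<longleftrightarrow> (\<forall>x\<in>U. f differentiable (at x)) \<and> (\<forall>i. Ck_on k U (pd i f))"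

definition smooth_on :: "(real^'n::finite) set \<Rightarrow> (real^'n \<Rightarrow> real) \<Rightarrow> bool" where
  "smooth_on U f \<longleftrightarrow> (\<forall>k. Ck_on k U f)"


section \<open>Manifolds, metrics, conformal structures\<close>

text \<open>
  A chart is a pair (domain, coordinate map).  The dimension \<open>d\<close> of the manifold is
  \<open>CARD('n)\<close>.  Fields on the manifold are given classically, by one set of component functions
  for each chart, defined on the coordinate image of that chart and subject to the
  transformation law on overlaps; values outside the coordinate image are irrelevant.
\<close>

type_synonym ('a, 'n) chart = "'a set \<times> ('a \<Rightarrow> real^'n)"

definition cimage :: "('a, 'n::finite) chart \<Rightarrow> (real^'n) set" where
  "cimage c = snd c ` fst c"

definition cinv :: "('a, 'n::finite) chart \<Rightarrow> real^'n \<Rightarrow> 'a" where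
  "cinv c = inv_into (fst c) (snd c)"

definition is_chart :: "'a topology \<Rightarrow> ('a, 'n::finite) chart \<Rightarrow> bool" where
  "is_chart M c \<longleftrightarrow> openin M (fst c) \<and> open (cimage c) \<and>
     homeomorphic_map (subtopology M (fst c)) (top_of_set (cimage c)) (snd c)"

definition smooth_manifold :: "'a topology \<Rightarrow> ('a, 'n::finite) chart set \<Rightarrow> bool" where
  "smooth_manifold M \<A> \<longleftrightarrow>
     Hausdorff_space M \<and> second_countable M \<and>
     (\<forall>c\<in>\<A>. is_chart M c) \<and> (\<Union>c\<in>\<A>. fst c) = topspace M \<and>
     (\<forall>c\<in>\<A>. \<forall>c'\<in>\<A>. \<forall>k. smooth_on (snd c ` (fst c \<inter> fst c')) (\<lambda>x. snd c' (cinv c x) $ k))"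

definition smooth_function :: "('a, 'n::finite) chart set \<Rightarrow> ('a \<Rightarrow> real) \<Rightarrow> bool" where
  "smooth_function \<A> f \<longleftrightarrow> (\<forall>c\<in>\<A>. smooth_on (cimage c) (\<lambda>x. f (cinv c x)))"

text \<open>\<open>jac c c' p k i\<close> is \<open>\<partial>y\<^sup>k/\<partial>x\<^sup>i\<close> at \<open>p\<close>, where \<open>x\<close>, \<open>y\<close> are the coordinates of \<open>c\<close>, \<open>c'\<close>.\<close>

definition jac ::
  "('a, 'n::finite) chart \<Rightarrow> ('a, 'n) chart \<Rightarrow> 'a \<Rightarrow> 'n \<Rightarrow> 'n \<Rightarrow> real" where
  "jac c c' p k i = pd i (\<lambda>x. snd c' (cinv c x) $ k) (snd c p)"

type_synonym 'n local_metric = "real^'n \<Rightarrow> real^'n^'n"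
type_synonym ('a, 'n) metric = "('a, 'n) chart \<Rightarrow> 'n local_metric"

definition riemannian_metric ::
  "('a, 'n::finite) chart set \<Rightarrow> ('a, 'n) metric \<Rightarrow> bool" where
  "riemannian_metric \<A> g \<longleftrightarrow>
     (\<forall>c\<in>\<A>. (\<forall>i j. smooth_on (cimage c) (\<lambda>x. g c x $ i $ j)) \<and>
        (\<forall>x\<in>cimage c. (\<forall>i j. g c x $ i $ j = g c x $ j $ i) \<and>
           (\<forall>v. v \<noteq> 0 \<longrightarrow> v \<bullet> (g c x *v v) > 0))) \<and>
     (\<forall>c\<in>\<A>. \<forall>c'\<in>\<A>. \<forall>p\<in>fst c \<inter> fst c'. \<forall>i j.
        g c (snd c p) $ i $ j =
          (\<Sum>k\<in>UNIV. \<Sum>l\<in>UNIV. jac c c' p k i * jac c c' p l j * g c' (snd c' p) $ k $ l))"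

text \<open>\<open>h = e\<^sup>2\<^sup>\<omega> g\<close> with \<open>\<omega>\<close> smooth.\<close>

definition rescaling ::
  "('a, 'n::finite) chart set \<Rightarrow> ('a \<Rightarrow> real) \<Rightarrow> ('a, 'n) metric \<Rightarrow> ('a, 'n) metric \<Rightarrow> bool" where
  "rescaling \<A> \<omega> g h \<longleftrightarrow> smooth_function \<A> \<omega> \<and>
     (\<forall>c\<in>\<A>. \<forall>x\<in>cimage c. h c x = exp (2 * \<omega> (cinv c x)) *\<^sub>R g c x)"

definition conformal_structure ::
  "('a, 'n::finite) chart set \<Rightarrow> ('a, 'n) metric set \<Rightarrow> bool" where
  "conformal_structure \<A> G \<longleftrightarrow>
     (\<exists>g. riemannian_metric \<A> g \<and>
        G = {h. riemannian_metric \<A> h \<and> (\<exists>\<omega>. rescaling \<A> \<omega> g h)})"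


section \<open>Curvature of a metric in coordinates\<close>

definition ginv :: "'n::finite local_metric \<Rightarrow> real^'n \<Rightarrow> 'n \<Rightarrow> 'n \<Rightarrow> real" where
  "ginv g x a b = matrix_inv (g x) $ a $ b"

text \<open>\<open>christoffel g x c a b\<close> is \<open>\<Gamma>\<^sup>c\<^sub>a\<^sub>b\<close>.\<close>

definition christoffel :: "'n::finite local_metric \<Rightarrow> real^'n \<Rightarrow> 'n \<Rightarrow> 'n \<Rightarrow> 'n \<Rightarrow> real" where
  "christoffel g x c a b = (\<Sum>e\<in>UNIV. ginv g x c e *
     (pd a (\<lambda>y. g y $ b $ e) x + pd b (\<lambda>y. g y $ a $ e) x - pd e (\<lambda>y. g y $ a $ b) x)) / 2"

text \<open>
  \<open>riemann g x a b c e\<close> is \<open>R\<^sub>a\<^sub>b\<^sup>c\<^sub>e\<close>, the \<open>c\<close>-component of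
  \<open>(\<nabla>\<^sub>a\<nabla>\<^sub>b - \<nabla>\<^sub>b\<nabla>\<^sub>a)V\<close> for \<open>V\<close> the coordinate vector field \<open>\<partial>\<^sub>e\<close>; \<open>riemann_low\<close> is \<open>R\<^sub>a\<^sub>b\<^sub>c\<^sub>e\<close>.
\<close>

definition riemann ::
  "'n::finite local_metric \<Rightarrow> real^'n \<Rightarrow> 'n \<Rightarrow> 'n \<Rightarrow> 'n \<Rightarrow> 'n \<Rightarrow> real" where
  "riemann g x a b c e =
     pd a (\<lambda>y. christoffel g y c b e) x - pd b (\<lambda>y. christoffel g y c a e) x +
     (\<Sum>f\<in>UNIV. christoffel g x c a f * christoffel g x f b e
               - christoffel g x c b f * christoffel g x f a e)"

definition riemann_low ::
  "'n::finite local_metric \<Rightarrow> real^'n \<Rightarrow> 'n \<Rightarrow> 'n \<Rightarrow> 'n \<Rightarrow> 'n \<Rightarrow> real" where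
  "riemann_low g x a b c e = (\<Sum>f\<in>UNIV. g x $ c $ f * riemann g x a b f e)"

definition ricci :: "'n::finite local_metric \<Rightarrow> real^'n \<Rightarrow> 'n \<Rightarrow> 'n \<Rightarrow> real" where
  "ricci g x a b = (\<Sum>c\<in>UNIV. riemann g x c a c b)"

text \<open>
  \<open>Ric = (d-2)P + Jg\<close> with \<open>J\<close> the trace of \<open>P\<close>, solved for \<open>P\<close> and \<open>J\<close>: tracing gives
  \<open>J = Sc/(2(d-1))\<close>.  Both equations are checked in the two lemmas below.
\<close>

definition Jsc :: "'n::finite local_metric \<Rightarrow> real^'n \<Rightarrow> real" where
  "Jsc g x = (\<Sum>a\<in>UNIV. \<Sum>b\<in>UNIV. ginv g x a b * ricci g x a b) / (2 * (real CARD('n) - 1))"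

definition schouten :: "'n::finite local_metric \<Rightarrow> real^'n \<Rightarrow> 'n \<Rightarrow> 'n \<Rightarrow> real" where
  "schouten g x a b = (ricci g x a b - Jsc g x * g x $ a $ b) / (real CARD('n) - 2)"

lemma ricci_schouten:
  fixes g :: "'n::finite local_metric"
  assumes "CARD('n) \<ge> 3"
  shows "ricci g x a b = (real CARD('n) - 2) * schouten g x a b + Jsc g x * g x $ a $ b"
  using assms by (simp add: schouten_def)

lemma Jsc_trace_schouten:
  fixes g :: "'n::finite local_metric"
  assumes d: "CARD('n) \<ge> 3" and inv: "invertible (g x)"
    and sym: "\<And>a b. g x $ a $ b = g x $ b $ a"
  shows "Jsc g x = (\<Sum>a\<in>UNIV. \<Sum>b\<in>UNIV. ginv g x a b * schouten g x a b)"
proof -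
  have "(\<Sum>b\<in>UNIV. ginv g x a b * g x $ a $ b) = 1" for a
  proof -
    have "matrix_inv (g x) ** g x = mat 1"
      using inv unfolding matrix_inv_def invertible_def by (metis (mono_tags, lifting) someI_ex)
    then have "(matrix_inv (g x) ** g x) $ a $ a = mat 1 $ a $ a" by simp
    then show ?thesis
      by (simp add: matrix_matrix_mult_def mat_def ginv_def sym[of a])
  qed
  then have tr: "(\<Sum>a\<in>UNIV. \<Sum>b\<in>UNIV. ginv g x a b * g x $ a $ b) = real CARD('n)" by simp
  let ?S = "\<Sum>a\<in>UNIV. \<Sum>b\<in>UNIV. ginv g x a b * ricci g x a b"
  have "(\<Sum>a\<in>UNIV. \<Sum>b\<in>UNIV. ginv g x a b * schouten g x a b) =
      (?S - Jsc g x * (\<Sum>a\<in>UNIV. \<Sum>b\<in>UNIV. ginv g x a b * g x $ a $ b)) / (real CARD('n) - 2)"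
    by (simp add: schouten_def sum_subtractf sum_distrib_left sum_divide_distrib[symmetric]
        algebra_simps)
  also have "\<dots> = Jsc g x"
  proof -
    have "?S = 2 * (real CARD('n) - 1) * Jsc g x" using d by (simp add: Jsc_def)
    then show ?thesis using d by (simp add: tr field_simps)
  qed
  finally show ?thesis by simp
qed

text \<open>The Weyl tensor: \<open>R\<^sub>a\<^sub>b\<^sub>c\<^sub>e = C\<^sub>a\<^sub>b\<^sub>c\<^sub>e + 2g\<^sub>c\<^sub>[\<^sub>aP\<^sub>b\<^sub>]\<^sub>e + 2g\<^sub>e\<^sub>[\<^sub>bP\<^sub>a\<^sub>]\<^sub>c\<close>.\<close>

definition weyl ::
  "'n::finite local_metric \<Rightarrow> real^'n \<Rightarrow> 'n \<Rightarrow> 'n \<Rightarrow> 'n \<Rightarrow> 'n \<Rightarrow> real" where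
  "weyl g x a b c e = riemann_low g x a b c e -
     (g x $ c $ a * schouten g x b e - g x $ c $ b * schouten g x a e
      + g x $ e $ b * schouten g x a c - g x $ e $ a * schouten g x b c)"

definition nabla_schouten ::
  "'n::finite local_metric \<Rightarrow> real^'n \<Rightarrow> 'n \<Rightarrow> 'n \<Rightarrow> 'n \<Rightarrow> real" where
  "nabla_schouten g x c a b = pd c (\<lambda>y. schouten g y a b) x -
     (\<Sum>f\<in>UNIV. christoffel g x f c a * schouten g x f b
               + christoffel g x f c b * schouten g x a f)"

definition cotton :: "'n::finite local_metric \<Rightarrow> real^'n \<Rightarrow> 'n \<Rightarrow> 'n \<Rightarrow> 'n \<Rightarrow> real" where
  "cotton g x a b c = nabla_schouten g x b c a - nabla_schouten g x c b a"

definition nabla_cotton ::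
  "'n::finite local_metric \<Rightarrow> real^'n \<Rightarrow> 'n \<Rightarrow> 'n \<Rightarrow> 'n \<Rightarrow> 'n \<Rightarrow> real" where
  "nabla_cotton g x e a b c = pd e (\<lambda>y. cotton g y a b c) x -
     (\<Sum>f\<in>UNIV. christoffel g x f e a * cotton g x f b c
               + christoffel g x f e b * cotton g x a f c
               + christoffel g x f e c * cotton g x a b f)"

text \<open>\<open>B\<^sub>a\<^sub>b = \<nabla>\<^sup>cA\<^sub>a\<^sub>c\<^sub>b + P\<^sup>e\<^sup>cC\<^sub>e\<^sub>a\<^sub>c\<^sub>b\<close>\<close>

definition bach :: "'n::finite local_metric \<Rightarrow> real^'n \<Rightarrow> 'n \<Rightarrow> 'n \<Rightarrow> real" where
  "bach g x a b =
     (\<Sum>c\<in>UNIV. \<Sum>e\<in>UNIV. ginv g x c e * nabla_cotton g x e a c b) +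
     (\<Sum>e\<in>UNIV. \<Sum>c\<in>UNIV. (\<Sum>i\<in>UNIV. \<Sum>j\<in>UNIV. ginv g x e i * ginv g x c j * schouten g x i j)
        * weyl g x e a c b)"


section \<open>Tractors\<close>

text \<open>
  In the scale \<open>g\<close> and a chart, a tractor \<open>V\<^sup>A = Y\<^sup>A\<sigma> + Z\<^sup>A\<^sup>a\<mu>\<^sub>a + X\<^sup>A\<rho>\<close> has the components
  \<open>V TY = \<sigma>\<close>, \<open>V (TZ a) = \<mu>\<^sub>a\<close>, \<open>V TX = \<rho>\<close>.  A tractor tensor of valence \<open>k\<close> has components
  \<open>T [A\<^sub>1,\<dots>,A\<^sub>k]\<close> with all tractor indices raised.  Every density is written in the trivialisation
  given by \<open>g\<close>: a section \<open>f\<close> of \<open>E[w]\<close> is represented by the function \<open>f(\<cdot>,g)\<close>, on which the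
  connection given by \<open>g\<close> is the ordinary derivative, and \<open>f(\<cdot>,e\<^sup>2\<^sup>\<omega>g) = e\<^sup>w\<^sup>\<omega> f(\<cdot>,g)\<close>.  In this
  trivialisation the conformal metric is \<open>g\<close> itself.
\<close>

datatype 'n tix = TY | TZ 'n | TX

instance tix :: (finite) finite
proof
  have "(UNIV :: 'a tix set) = {TY, TX} \<union> range TZ"
    by (auto intro: tix.exhaust)
  then show "finite (UNIV :: 'a tix set)"
    by (metis finite.emptyI finite.insertI finite_UnI finite_imageI finite)
qed

type_synonym 'n tractor_tensor = "real^'n \<Rightarrow> 'n tix list \<Rightarrow> real"

definition Ytr :: "'n tix \<Rightarrow> real" where
  "Ytr A = (if A = TY then 1 else 0)"

definition Ztr :: "'n tix \<Rightarrow> 'n \<Rightarrow> real" where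
  "Ztr A a = (if A = TZ a then 1 else 0)"

definition Xtr :: "'n tix \<Rightarrow> real" where
  "Xtr A = (if A = TX then 1 else 0)"

text \<open>The matrix \<open>h\<^sub>A\<^sub>B\<close>, the polarisation of \<open>g\<^sup>-\<^sup>1(\<mu>,\<mu>) + 2\<sigma>\<rho>\<close>.\<close>

fun tractor_metric :: "'n::finite local_metric \<Rightarrow> real^'n \<Rightarrow> 'n tix \<Rightarrow> 'n tix \<Rightarrow> real" where
  "tractor_metric g x TY TX = 1"
| "tractor_metric g x TX TY = 1"
| "tractor_metric g x (TZ a) (TZ b) = ginv g x a b"
| "tractor_metric g x _ _ = 0"

text \<open>\<open>\<nabla>\<^sub>aV\<^sup>A = \<partial>\<^sub>aV\<^sup>A + tractor_conn g x a V A\<close> for the tractor connection.\<close>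

fun tractor_conn ::
  "'n::finite local_metric \<Rightarrow> real^'n \<Rightarrow> 'n \<Rightarrow> ('n tix \<Rightarrow> real) \<Rightarrow> 'n tix \<Rightarrow> real" where
  "tractor_conn g x a V TY = - V (TZ a)"
| "tractor_conn g x a V (TZ b) = - (\<Sum>c\<in>UNIV. christoffel g x c a b * V (TZ c))
     + g x $ a $ b * V TX + schouten g x a b * V TY"
| "tractor_conn g x a V TX =
     - (\<Sum>b\<in>UNIV. \<Sum>c\<in>UNIV. schouten g x a b * ginv g x b c * V (TZ c))"

text \<open>Extension to tractor tensors by the Leibniz rule, one term for each index slot.\<close>

definition tractor_nabla ::
  "'n::finite local_metric \<Rightarrow> 'n \<Rightarrow> 'n tractor_tensor \<Rightarrow> 'n tractor_tensor" where
  "tractor_nabla g a T x As = pd a (\<lambda>y. T y As) x +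
     (\<Sum>k<length As. tractor_conn g x a (\<lambda>B. T x (As[k := B])) (As ! k))"

text \<open>\<open>\<nabla>\<^sub>a\<nabla>\<^sub>bT\<close>, with the tractor connection coupled to the Levi-Civita connection on the index \<open>b\<close>.\<close>

definition tractor_nabla2 ::
  "'n::finite local_metric \<Rightarrow> 'n \<Rightarrow> 'n \<Rightarrow> 'n tractor_tensor \<Rightarrow> 'n tractor_tensor" where
  "tractor_nabla2 g a b T x As = tractor_nabla g a (tractor_nabla g b T) x As -
     (\<Sum>c\<in>UNIV. christoffel g x c a b * tractor_nabla g c T x As)"

definition tractor_laplacian ::
  "'n::finite local_metric \<Rightarrow> 'n tractor_tensor \<Rightarrow> 'n tractor_tensor" where
  "tractor_laplacian g T x As =
     - (\<Sum>a\<in>UNIV. \<Sum>b\<in>UNIV. ginv g x a b * tractor_nabla2 g a b T x As)"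

text \<open>\<open>XZskew A B b\<close> is \<open>X\<^sub>[\<^sub>AZ\<^sub>B\<^sub>]\<^sup>b\<close>.\<close>

definition XZskew :: "'n tix \<Rightarrow> 'n tix \<Rightarrow> 'n \<Rightarrow> real" where
  "XZskew A B b = (Xtr A * Ztr B b - Xtr B * Ztr A b) / 2"

definition W_comp ::
  "'n::finite local_metric \<Rightarrow> real^'n \<Rightarrow> 'n tix \<Rightarrow> 'n tix \<Rightarrow> 'n tix \<Rightarrow> 'n tix \<Rightarrow> real" where
  "W_comp g x A B C E =
     (real CARD('n) - 4) *
       ((\<Sum>a\<in>UNIV. \<Sum>b\<in>UNIV. \<Sum>c\<in>UNIV. \<Sum>e\<in>UNIV.
           Ztr A a * Ztr B b * Ztr C c * Ztr E e * weyl g x a b c e)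
        - 2 * (\<Sum>a\<in>UNIV. \<Sum>b\<in>UNIV. \<Sum>e\<in>UNIV.
           Ztr A a * Ztr B b * XZskew C E e * cotton g x e a b)
        - 2 * (\<Sum>b\<in>UNIV. \<Sum>c\<in>UNIV. \<Sum>e\<in>UNIV.
           XZskew A B b * Ztr C c * Ztr E e * cotton g x b c e))
     + 4 * (\<Sum>b\<in>UNIV. \<Sum>e\<in>UNIV. XZskew A B b * XZskew C E e * bach g x e b)"

definition W_tractor :: "'n::finite local_metric \<Rightarrow> 'n tractor_tensor" where
  "W_tractor g x As = (case As of [A, B, C, E] \<Rightarrow> W_comp g x A B C E | _ \<Rightarrow> 0)"

text \<open>
  The tensorial action of an endomorphism \<open>F\<^sup>A\<^sub>B\<close>, that is
  \<open>F\<sharp>T\<^sup>A\<^sup>B\<^sup>\<dots> = F\<^sup>A\<^sub>CT\<^sup>C\<^sup>B\<^sup>\<dots> + F\<^sup>B\<^sub>CT\<^sup>A\<^sup>C\<^sup>\<dots> + \<dots>\<close>; the dual action on lower indices carries the minus sign.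
\<close>

definition sharp ::
  "('n tix \<Rightarrow> 'n tix \<Rightarrow> real) \<Rightarrow> ('n::finite tix list \<Rightarrow> real) \<Rightarrow> 'n tix list \<Rightarrow> real" where
  "sharp F T As = (\<Sum>k<length As. \<Sum>B\<in>UNIV. F (As ! k) B * T (As[k := B]))"

definition elem_end :: "'n tix \<Rightarrow> 'n tix \<Rightarrow> 'n tix \<Rightarrow> 'n tix \<Rightarrow> real" where
  "elem_end P Q A B = (if A = P \<and> B = Q then 1 else 0)"

text \<open>\<open>W\<^sup>P\<^sub>Q\<^sup>R\<^sub>S\<close>, the coefficients of \<open>W\<close> as a section of \<open>End T \<otimes> End T\<close>.\<close>

definition W_end ::
  "'n::finite local_metric \<Rightarrow> real^'n \<Rightarrow> 'n tix \<Rightarrow> 'n tix \<Rightarrow> 'n tix \<Rightarrow> 'n tix \<Rightarrow> real" where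
  "W_end g x P Q R S = (\<Sum>B\<in>UNIV. \<Sum>E\<in>UNIV.
     W_tractor g x [P, B, R, E] * tractor_metric g x B Q * tractor_metric g x E S)"

definition W_sharp_sharp ::
  "'n::finite local_metric \<Rightarrow> 'n tractor_tensor \<Rightarrow> 'n tractor_tensor" where
  "W_sharp_sharp g T x As = (\<Sum>P\<in>UNIV. \<Sum>Q\<in>UNIV. \<Sum>R\<in>UNIV. \<Sum>S\<in>UNIV.
     W_end g x P Q R S * sharp (elem_end P Q) (sharp (elem_end R S) (T x)) As)"

definition tractor_box ::
  "'n::finite local_metric \<Rightarrow> real \<Rightarrow> 'n tractor_tensor \<Rightarrow> 'n tractor_tensor" where
  "tractor_box g w T x As = tractor_laplacian g T x As - w * Jsc g x * T x As
     - 1 / (2 * (real CARD('n) - 4)) * W_sharp_sharp g T x As"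

text \<open>\<open>tractor_D g w T x A As\<close> is \<open>D\<^sup>AT\<close> for \<open>T\<close> of weight \<open>w\<close>.\<close>

definition tractor_D ::
  "'n::finite local_metric \<Rightarrow> real \<Rightarrow> 'n tractor_tensor \<Rightarrow> real^'n \<Rightarrow> 'n tix \<Rightarrow> 'n tix list \<Rightarrow> real" where
  "tractor_D g w T x A As =
     (real CARD('n) + 2 * w - 2) * w * Ytr A * T x As
     + (real CARD('n) + 2 * w - 2) * (\<Sum>a\<in>UNIV. Ztr A a * tractor_nabla g a T x As)
     + Xtr A * tractor_box g w T x As"


section \<open>Almost Einstein structures\<close>

text \<open>
  A section of the standard tractor bundle assigns to each \<open>g \<in> [g]\<close> and each chart a triple
  \<open>(\<sigma>,\<mu>\<^sub>b,\<rho>)\<close>.  The factors \<open>e\<^sup>\<omega>\<close>, \<open>e\<^sup>\<omega>\<close>, \<open>e\<^sup>-\<^sup>\<omega>\<close> in the law for \<open>e\<^sup>2\<^sup>\<omega>g\<close> come from the change of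
  trivialisation of \<open>E[1]\<close>, \<open>T\<^sup>*M[1]\<close>, \<open>E[-1]\<close>.
\<close>

definition tractor_section ::
  "('a, 'n::finite) chart set \<Rightarrow> ('a, 'n) metric set \<Rightarrow>
   (('a, 'n) metric \<Rightarrow> ('a, 'n) chart \<Rightarrow> real^'n \<Rightarrow> 'n tix \<Rightarrow> real) \<Rightarrow> bool" where
  "tractor_section \<A> G V \<longleftrightarrow>
     (\<forall>g\<in>G. \<forall>c\<in>\<A>. \<forall>A. smooth_on (cimage c) (\<lambda>x. V g c x A)) \<and>
     (\<forall>g\<in>G. \<forall>c\<in>\<A>. \<forall>c'\<in>\<A>. \<forall>p\<in>fst c \<inter> fst c'.
        V g c (snd c p) TY = V g c' (snd c' p) TY \<and>
        V g c (snd c p) TX = V g c' (snd c' p) TX \<and>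
        (\<forall>i. V g c (snd c p) (TZ i) = (\<Sum>k\<in>UNIV. jac c c' p k i * V g c' (snd c' p) (TZ k)))) \<and>
     (\<forall>g\<in>G. \<forall>h\<in>G. \<forall>\<omega>. rescaling \<A> \<omega> g h \<longrightarrow>
        (\<forall>c\<in>\<A>. \<forall>x\<in>cimage c.
           let s = exp (\<omega> (cinv c x)); \<Upsilon> = (\<lambda>b. pd b (\<lambda>y. \<omega> (cinv c y)) x);
               \<sigma> = V g c x TY; \<mu> = (\<lambda>b. V g c x (TZ b)); \<rho> = V g c x TX
           in V h c x TY = s * \<sigma> \<and>
              (\<forall>b. V h c x (TZ b) = s * (\<mu> b + \<sigma> * \<Upsilon> b)) \<and>
              V h c x TX = inverse s *
                (\<rho> - (\<Sum>a\<in>UNIV. \<Sum>b\<in>UNIV. ginv (g c) x a b * \<Upsilon> a * \<mu> b)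
                 - (\<sigma> / 2) * (\<Sum>a\<in>UNIV. \<Sum>b\<in>UNIV. ginv (g c) x a b * \<Upsilon> a * \<Upsilon> b))))"

definition parallel_tractor ::
  "('a, 'n::finite) chart set \<Rightarrow> ('a, 'n) metric set \<Rightarrow>
   (('a, 'n) metric \<Rightarrow> ('a, 'n) chart \<Rightarrow> real^'n \<Rightarrow> 'n tix \<Rightarrow> real) \<Rightarrow> bool" where
  "parallel_tractor \<A> G V \<longleftrightarrow>
     (\<forall>g\<in>G. \<forall>c\<in>\<A>. \<forall>x\<in>cimage c. \<forall>a A.
        pd a (\<lambda>y. V g c y A) x + tractor_conn (g c) x a (V g c x) A = 0)"

definition almost_einstein ::
  "'a topology \<Rightarrow> ('a, 'n::finite) chart set \<Rightarrow> ('a, 'n) metric set \<Rightarrow>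
   (('a, 'n) metric \<Rightarrow> ('a, 'n) chart \<Rightarrow> real^'n \<Rightarrow> 'n tix \<Rightarrow> real) \<Rightarrow> bool" where
  "almost_einstein M \<A> G I \<longleftrightarrow>
     smooth_manifold M \<A> \<and> connected_space M \<and> conformal_structure \<A> G \<and>
     tractor_section \<A> G I \<and> parallel_tractor \<A> G I \<and>
     (\<exists>g\<in>G. \<exists>c\<in>\<A>. \<exists>x\<in>cimage c. \<exists>A. I g c x A \<noteq> 0)"

end

theory Submission
  imports Defs
begin

text \<open>
  Let \<open>I = (\<sigma>,\<mu>,\<rho>)\<close>, let \<open>\<Omega>\<^sub>a\<^sub>b\<close> be the tractor curvature, and let \<open>W\<^sub>X\<^sub>b\<close> be the coefficient of
  \<open>X\<^sub>AZ\<^sub>B\<^sup>b\<close> in \<open>W\<^sub>A\<^sub>B\<^sub>C\<^sub>E\<close>. Where \<open>\<sigma> \<noteq> 0\<close> the Bianchi identity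
  together with \<open>\<Omega>I = 0\<close> gives \<open>\<nabla>\<^sup>a\<Omega>\<^sub>a\<^sub>b = -W\<^sub>X\<^sub>b\<close> and \<open>I\<^sup>AW\<^sub>A\<^sub>B\<^sub>C\<^sub>E = 0\<close>, that is
  \<open>\<sigma>\<nabla>\<^sup>a\<Omega>\<^sub>a\<^sub>b = (d-4)\<mu>\<^sup>a\<Omega>\<^sub>a\<^sub>b\<close>. Differentiating the Bianchi identity once more yields a wave equation for
  \<open>\<Omega>\<close>, whose quadratic curvature terms are those of \<open>W\<sharp>\<sharp>W\<close>; this is the tensorial part \<open>E\<^sub>a\<^sub>b\<^sub>C\<^sub>E = 0\<close> of
  \<open>E = I\<^sup>AD\<^sub>AW\<close>. The remaining components need no further derivatives of curvature: \<open>E\<close> is skew,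
  \<open>X\<^sup>AE\<^sub>A\<^sub>b\<^sub>C\<^sub>E = 0\<close> follows from the divergence of \<open>\<Omega>\<close>, and \<open>I\<^sup>AE\<^sub>A\<^sub>B\<^sub>C\<^sub>E = 0\<close> because \<open>I\<close> is parallel, so
  \<open>\<sigma> \<noteq> 0\<close> kills the rest. Finally, \<open>\<sigma>\<close> cannot vanish on an open set on which \<open>I\<close> does not, so
  \<open>E = 0\<close> everywhere by continuity (and trivially at the zeros of \<open>I\<close>).
\<close>

section \<open>Partial derivatives and smooth functions\<close>

text \<open>On \<sigma> \<noteq> 0 the Einstein metric \<open>\<sigma>^-2 g\<close> would make the
  Cotton and Bach tensors vanish, but passing to it presupposes conformal covariance of W and D. The
  computation therefore stays in one chart and one arbitrary metric of the class. To avoid a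
  coordinate calculation for each tensor, the calculus (Leibniz rule, commutator of derivatives,
  Bianchi identity, contraction with parallel forms) is developed once for a connection on a trivial
  bundle and all its tensor powers, and then applied to the sum of the cotangent and the tractor
  bundle. The constants fit together as follows. For w = -2 the factor \<open>d + 2w - 2\<close> is
  d-6. In the tensorial part the term \<open>-wJ\<close> and the factor \<open>-1/(2(d-4))\<close>
  remove exactly the J-terms and the quadratic curvature terms of the wave equation. What remains is
  d-6 times an expression that vanishes because I annihilates the derivative of W.\<close>

lemma has_derivative_at_pd:
  assumes "(f has_derivative f') (at x)"
  shows "pd i f x = f' (axis i 1)"
  unfolding pd_def using frechet_derivative_at[OF assms] by simp

lemma differentiable_has_derivative:
  "f differentiable (at x) \<Longrightarrow> (f has_derivative frechet_derivative f (at x)) (at x)"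
  by (simp add: frechet_derivative_works)

lemma pd_const [simp]: "pd i (\<lambda>_. c) x = 0"
  by (rule has_derivative_at_pd[OF has_derivative_const, THEN trans]) simp

lemma pd_add:
  assumes "f differentiable (at x)" "g differentiable (at x)"
  shows "pd i (\<lambda>y. f y + g y) x = pd i f x + pd i g x"
  using has_derivative_at_pd[OF has_derivative_add[OF assms[THEN differentiable_has_derivative]]]
  by (simp add: pd_def)

lemma pd_minus:
  assumes "f differentiable (at x)"
  shows "pd i (\<lambda>y. - f y) x = - pd i f x"
  using has_derivative_at_pd[OF has_derivative_minus[OF assms[THEN differentiable_has_derivative]]]
  by (simp add: pd_def)

lemma pd_diff:
  assumes "f differentiable (at x)" "g differentiable (at x)"
  shows "pd i (\<lambda>y. f y - g y) x = pd i f x - pd i g x"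
  using has_derivative_at_pd[OF has_derivative_diff[OF assms[THEN differentiable_has_derivative]]]
  by (simp add: pd_def)

lemma pd_mult:
  assumes "f differentiable (at x)" "g differentiable (at x)"
  shows "pd i (\<lambda>y. f y * g y) x = pd i f x * g x + f x * pd i g x"
  using has_derivative_at_pd[OF has_derivative_mult[OF assms[THEN differentiable_has_derivative]]]
  by (simp add: pd_def)

lemma pd_inverse:
  assumes "f differentiable (at x)" "f x \<noteq> 0"
  shows "pd i (\<lambda>y. inverse (f y)) x = - (inverse (f x) * pd i f x * inverse (f x))"
  using has_derivative_at_pd[OF Deriv.has_derivative_inverse[OF assms(2) differentiable_has_derivative[OF assms(1)]]]
  by (simp add: pd_def)

lemma pd_sum:
  assumes "\<And>k. k \<in> S \<Longrightarrow> f k differentiable (at x)"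
  shows "pd i (\<lambda>y. \<Sum>k\<in>S. f k y) x = (\<Sum>k\<in>S. pd i (f k) x)"
  using has_derivative_at_pd[OF has_derivative_sum[of S f "\<lambda>k. frechet_derivative (f k) (at x)" "at x"]]
    assms[THEN differentiable_has_derivative] by (simp add: pd_def)

lemma pd_cong:
  assumes "open U" "x \<in> U" "\<And>y. y \<in> U \<Longrightarrow> f y = g y"
  shows "pd i f x = pd i g x"
proof -
  have "(f has_derivative f') (at x) \<longleftrightarrow> (g has_derivative f') (at x)" for f'
    using assms has_derivative_transform_within_open[of f f' x UNIV U g]
      has_derivative_transform_within_open[of g f' x UNIV U f] by auto
  then show ?thesis unfolding pd_def frechet_derivative_def by simp
qed

lemma pd_eq_0_on:
  assumes "open U" "x \<in> U" "\<And>y. y \<in> U \<Longrightarrow> f y = 0"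
  shows "pd i f x = 0"
  using pd_cong[of U x f "\<lambda>_. 0" i] assms by simp

lemma differentiable_cong_open:
  assumes "open U" "x \<in> U" "\<And>y. y \<in> U \<Longrightarrow> f y = g y" "f differentiable (at x)"
  shows "g differentiable (at x)"
  using assms has_derivative_transform_within_open[of f _ x UNIV U g]
  unfolding differentiable_def by blast

text \<open>The differentiation rules for \<open>pd\<close> hold only at points of the set, so the
  inductions below need \<open>Ck_on\<close> to depend on the values on the open set U
  alone.\<close>

lemma Ck_on_cong:
  assumes "open U" "\<And>y. y \<in> U \<Longrightarrow> f y = g y" "Ck_on k U f"
  shows "Ck_on k U g"
  using assms(2,3)
proof (induction k arbitrary: f g)
  case 0
  then show ?case using continuous_on_cong by (metis Ck_on.simps(1))
next
  case (Suc k)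
  then show ?case
    using differentiable_cong_open[OF assms(1)] pd_cong[OF assms(1), of _ f g]
    by (simp, blast)
qed

lemma Ck_on_SucD: "Ck_on (Suc k) U f \<Longrightarrow> Ck_on k U f"
proof (induction k arbitrary: f)
  case 0
  then show ?case
    by (auto intro!: continuous_at_imp_continuous_on differentiable_imp_continuous_within)
qed auto

lemma Ck_on_const: "Ck_on k U (\<lambda>_. c)"
proof (induction k arbitrary: c)
  case (Suc k)
  have "pd i (\<lambda>_. c) = (\<lambda>_. 0)" for i :: 'a by (simp add: fun_eq_iff)
  then show ?case using Suc by simp
qed simp

context
  fixes U :: "(real^'n::finite) set"
  assumes U: "open U"
begin

lemma Ck_on_add: "Ck_on k U f \<Longrightarrow> Ck_on k U g \<Longrightarrow> Ck_on k U (\<lambda>x. f x + g x)"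
proof (induction k arbitrary: f g)
  case (Suc k)
  have "Ck_on k U (pd i (\<lambda>x. f x + g x))" for i
    by (rule Ck_on_cong[OF U _ Suc.IH, of "pd i f" "pd i g"]) (use Suc.prems in \<open>auto simp: pd_add\<close>)
  with Suc.prems show ?case by simp
qed (auto intro: continuous_intros)

lemma Ck_on_mult: "Ck_on k U f \<Longrightarrow> Ck_on k U g \<Longrightarrow> Ck_on k U (\<lambda>x. f x * g x)"
proof (induction k arbitrary: f g)
  case (Suc k)
  have "Ck_on k U (pd i (\<lambda>x. f x * g x))" for i
    by (rule Ck_on_cong[OF U _ Ck_on_add[OF Suc.IH Suc.IH], of "pd i f" g f "pd i g"])
      (use Suc.prems in \<open>auto simp: pd_mult Ck_on_SucD\<close>)
  with Suc.prems show ?case by simp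
qed (auto intro: continuous_intros)

lemma Ck_on_minus: "Ck_on k U f \<Longrightarrow> Ck_on k U (\<lambda>x. - f x)"
  using Ck_on_mult[OF Ck_on_const[of k U "-1"]] by simp

lemma Ck_on_inverse:
  assumes nz: "\<And>x. x \<in> U \<Longrightarrow> f x \<noteq> 0"
  shows "Ck_on k U f \<Longrightarrow> Ck_on k U (\<lambda>x. inverse (f x))"
proof (induction k)
  case (Suc k)
  have "Ck_on k U (pd i (\<lambda>x. inverse (f x)))" for i
    by (rule Ck_on_cong[OF U _ Ck_on_minus[OF Ck_on_mult[OF Ck_on_mult[OF Suc.IH] Suc.IH]], of "pd i f"])
      (use Suc.prems nz in \<open>auto simp: pd_inverse Ck_on_SucD\<close>)
  with Suc.prems nz show ?case by (auto intro: differentiable_inverse)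
qed (auto intro!: continuous_intros nz)

lemma smooth_on_add: "smooth_on U f \<Longrightarrow> smooth_on U g \<Longrightarrow> smooth_on U (\<lambda>x. f x + g x)"
  and smooth_on_mult: "smooth_on U f \<Longrightarrow> smooth_on U g \<Longrightarrow> smooth_on U (\<lambda>x. f x * g x)"
  and smooth_on_minus: "smooth_on U f \<Longrightarrow> smooth_on U (\<lambda>x. - f x)"
  and smooth_on_inverse:
    "(\<And>x. x \<in> U \<Longrightarrow> f x \<noteq> 0) \<Longrightarrow> smooth_on U f \<Longrightarrow> smooth_on U (\<lambda>x. inverse (f x))"
  by (simp_all add: smooth_on_def Ck_on_add Ck_on_mult Ck_on_minus Ck_on_inverse)

lemma smooth_on_const: "smooth_on U (\<lambda>_. c)"
  by (simp add: smooth_on_def Ck_on_const)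

lemma smooth_on_cong:
  "(\<And>x. x \<in> U \<Longrightarrow> f x = g x) \<Longrightarrow> smooth_on U f \<Longrightarrow> smooth_on U g"
  unfolding smooth_on_def using Ck_on_cong[OF U] by blast

lemma smooth_on_diff: "smooth_on U f \<Longrightarrow> smooth_on U g \<Longrightarrow> smooth_on U (\<lambda>x. f x - g x)"
  using smooth_on_add[OF _ smooth_on_minus, of f g] by simp

lemma smooth_on_divide_const: "smooth_on U f \<Longrightarrow> smooth_on U (\<lambda>x. f x / c)"
  using smooth_on_mult[OF _ smooth_on_const, of f "inverse c"] by (simp add: divide_inverse)

lemma smooth_on_sum: "(\<And>k. k \<in> S \<Longrightarrow> smooth_on U (f k)) \<Longrightarrow> smooth_on U (\<lambda>x. \<Sum>k\<in>S. f k x)"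
  by (induction S rule: infinite_finite_induct) (auto intro: smooth_on_const smooth_on_add)

lemma smooth_on_prod: "(\<And>k. k \<in> S \<Longrightarrow> smooth_on U (f k)) \<Longrightarrow> smooth_on U (\<lambda>x. \<Prod>k\<in>S. f k x)"
  by (induction S rule: infinite_finite_induct) (auto intro: smooth_on_const smooth_on_mult)

lemma smooth_on_pd: "smooth_on U f \<Longrightarrow> smooth_on U (pd i f)"
  unfolding smooth_on_def by (metis Ck_on.simps(2))

lemma smooth_on_if: "(P \<Longrightarrow> smooth_on U f) \<Longrightarrow> (\<not> P \<Longrightarrow> smooth_on U g) \<Longrightarrow>
    smooth_on U (\<lambda>x. if P then f x else g x)"
  by (cases P) simp_all

end

lemma smooth_on_subset:
  assumes "smooth_on U f" "V \<subseteq> U"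
  shows "smooth_on V f"
proof -
  have "Ck_on k U f \<Longrightarrow> Ck_on k V f" for k
    by (induction k arbitrary: f) (use assms(2) in \<open>auto intro: continuous_on_subset\<close>)
  with assms(1) show ?thesis by (simp add: smooth_on_def)
qed

lemma smooth_on_differentiable: "smooth_on U f \<Longrightarrow> x \<in> U \<Longrightarrow> f differentiable (at x)"
  unfolding smooth_on_def by (metis Ck_on.simps(2))

lemma smooth_on_continuous: "smooth_on U f \<Longrightarrow> continuous_on U f"
  unfolding smooth_on_def by (metis Ck_on.simps(1))

section \<open>Symmetry of second partial derivatives\<close>

lemma pd_along_axis:
  assumes "f differentiable (at (p + s *\<^sub>R axis i 1))"
  shows "((\<lambda>t. f (p + t *\<^sub>R axis i 1)) has_real_derivative pd i f (p + s *\<^sub>R axis i 1)) (at s)"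
proof -
  let ?q = "p + s *\<^sub>R axis i 1"
  note D = differentiable_has_derivative[OF assms]
  have "((\<lambda>t. f (p + t *\<^sub>R axis i 1)) has_derivative
      (\<lambda>t. frechet_derivative f (at ?q) (t *\<^sub>R axis i 1))) (at s)"
    by (rule has_derivative_compose[where g=f and f="\<lambda>t. p + t *\<^sub>R axis i 1", OF _ D])
      (auto intro!: derivative_eq_intros)
  moreover have "(\<lambda>t. frechet_derivative f (at ?q) (t *\<^sub>R axis i 1)) = (*) (pd i f ?q)"
    using linear_scale[OF linear_frechet_derivative[OF assms]] by (auto simp: pd_def fun_eq_iff)
  ultimately show ?thesis by (simp add: has_field_derivative_def)
qed

text \<open>Applied in both orders, this gives the symmetry of second partial derivatives.\<close>

lemma second_difference_mvt:
  fixes x :: "real^'n::finite"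
  assumes h: "h > 0"
    and box: "\<And>s t. 0 \<le> s \<Longrightarrow> s \<le> h \<Longrightarrow> 0 \<le> t \<Longrightarrow> t \<le> h \<Longrightarrow>
      x + s *\<^sub>R axis i 1 + t *\<^sub>R axis j 1 \<in> U"
    and f: "\<And>y. y \<in> U \<Longrightarrow> f differentiable (at y)"
      "\<And>y. y \<in> U \<Longrightarrow> pd i f differentiable (at y)"
  shows "\<exists>s t. 0 < s \<and> s < h \<and> 0 < t \<and> t < h \<and>
    f (x + h *\<^sub>R axis i 1 + h *\<^sub>R axis j 1) - f (x + h *\<^sub>R axis i 1) - f (x + h *\<^sub>R axis j 1) + f x
      = h * h * pd j (pd i f) (x + s *\<^sub>R axis i 1 + t *\<^sub>R axis j 1)"
proof -
  let ?a = "axis i 1 :: real^'n" and ?b = "axis j 1 :: real^'n"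
  \<comment> \<open>The mean value theorem is used twice: for \<open>u\<close> in direction i, then
    for \<open>pd i f\<close> in direction j, starting from the point given by the s found
    first.\<close>
  define u where "u s = f (x + h *\<^sub>R ?b + s *\<^sub>R ?a) - f (x + s *\<^sub>R ?a)" for s
  have du: "(u has_real_derivative
      (pd i f (x + h *\<^sub>R ?b + s *\<^sub>R ?a) - pd i f (x + s *\<^sub>R ?a))) (at s)"
    if "0 \<le> s" "s \<le> h" for s
    unfolding u_def
    by (intro DERIV_diff pd_along_axis f(1))
      (use box[of s h] box[of s 0] h that in \<open>simp_all add: algebra_simps\<close>)
  obtain s where s: "0 < s" "s < h"
    and us: "u h - u 0 = (h - 0) * (pd i f (x + h *\<^sub>R ?b + s *\<^sub>R ?a) - pd i f (x + s *\<^sub>R ?a))"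
    using MVT2[OF h du] by blast
  have dv: "((\<lambda>t. pd i f (x + s *\<^sub>R ?a + t *\<^sub>R ?b)) has_real_derivative
      pd j (pd i f) (x + s *\<^sub>R ?a + t *\<^sub>R ?b)) (at t)" if "0 \<le> t" "t \<le> h" for t
    by (intro pd_along_axis f(2)) (use box[of s t] s that in simp)
  obtain t where t: "0 < t" "t < h"
    and vt: "pd i f (x + s *\<^sub>R ?a + h *\<^sub>R ?b) - pd i f (x + s *\<^sub>R ?a + 0 *\<^sub>R ?b)
      = (h - 0) * pd j (pd i f) (x + s *\<^sub>R ?a + t *\<^sub>R ?b)"
    using MVT2[OF h dv] by blast
  have "f (x + h *\<^sub>R ?a + h *\<^sub>R ?b) - f (x + h *\<^sub>R ?a) - f (x + h *\<^sub>R ?b) + f x = u h - u 0"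
    by (simp add: u_def algebra_simps)
  also have "\<dots> = h * (pd i f (x + s *\<^sub>R ?a + h *\<^sub>R ?b) - pd i f (x + s *\<^sub>R ?a + 0 *\<^sub>R ?b))"
    using us by (simp add: algebra_simps)
  finally show ?thesis using s t vt by auto
qed

text \<open>The second difference over a square of side h is \<open>h * h\<close> times either mixed
  derivative, each taken at some point of the square; both are continuous at x, so they agree
  there.\<close>

lemma pd_commute:
  fixes f :: "real^'n::finite \<Rightarrow> real"
  assumes U: "open U" and x: "x \<in> U" and f: "smooth_on U f"
  shows "pd i (pd j f) x = pd j (pd i f) x"
proof (rule ccontr)
  assume neq: "\<not> ?thesis"
  \<comment> \<open>Half the gap: one number cannot lie within e of both mixed derivatives.\<close>
  define e where "e = \<bar>pd i (pd j f) x - pd j (pd i f) x\<bar> / 2"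
  have e: "e > 0" using neq by (simp add: e_def)
  have sm: "smooth_on U (pd k (pd l f))" for k l by (intro smooth_on_pd[OF U] f)
  have "\<exists>r>0. \<forall>y\<in>U. dist y x < r \<longrightarrow> dist (pd k (pd l f) y) (pd k (pd l f) x) < e" for k l
    using smooth_on_continuous[OF sm] x e unfolding continuous_on_iff by blast
  then obtain r1 r2 where r: "r1 > 0" "r2 > 0"
    and r1: "\<And>y. y \<in> U \<Longrightarrow> dist y x < r1 \<Longrightarrow> \<bar>pd i (pd j f) y - pd i (pd j f) x\<bar> < e"
    and r2: "\<And>y. y \<in> U \<Longrightarrow> dist y x < r2 \<Longrightarrow> \<bar>pd j (pd i f) y - pd j (pd i f) x\<bar> < e"
    unfolding dist_real_def by metis
  obtain r3 where r3: "r3 > 0" "ball x r3 \<subseteq> U" using U x openE by blast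
  define h where "h = min (min r1 r2) r3 / 3"
  have h: "h > 0" "3 * h \<le> r1" "3 * h \<le> r2" "3 * h \<le> r3" using r r3 by (auto simp: h_def)
  have near: "dist (x + s *\<^sub>R axis k 1 + t *\<^sub>R axis l 1) x < 3 * h"
    if "0 \<le> s" "s \<le> h" "0 \<le> t" "t \<le> h" for s t k l
  proof -
    have "norm (s *\<^sub>R axis k 1 + t *\<^sub>R axis l 1 :: real^'n) \<le> \<bar>s\<bar> + \<bar>t\<bar>"
      by (rule order_trans[OF norm_triangle_ineq]) simp
    then show ?thesis using that h by (simp add: dist_norm add.assoc)
  qed
  have box: "x + s *\<^sub>R axis k 1 + t *\<^sub>R axis l 1 \<in> U"
    if "0 \<le> s" "s \<le> h" "0 \<le> t" "t \<le> h" for s t k l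
    using near[OF that, of k l] h r3 by (auto simp: dist_commute subset_iff)
  note df = smooth_on_differentiable[OF f] smooth_on_differentiable[OF smooth_on_pd[OF U f]]
  obtain s t where st: "0 < s" "s < h" "0 < t" "t < h" and
    1: "f (x + h *\<^sub>R axis i 1 + h *\<^sub>R axis j 1) - f (x + h *\<^sub>R axis i 1) - f (x + h *\<^sub>R axis j 1) + f x
      = h * h * pd j (pd i f) (x + s *\<^sub>R axis i 1 + t *\<^sub>R axis j 1)"
    using second_difference_mvt[OF h(1) box df] by blast
  obtain s' t' where st': "0 < s'" "s' < h" "0 < t'" "t' < h" and
    2: "f (x + h *\<^sub>R axis j 1 + h *\<^sub>R axis i 1) - f (x + h *\<^sub>R axis j 1) - f (x + h *\<^sub>R axis i 1) + f x
      = h * h * pd i (pd j f) (x + s' *\<^sub>R axis j 1 + t' *\<^sub>R axis i 1)"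
    using second_difference_mvt[OF h(1) box df] by blast
  have "x + h *\<^sub>R axis j 1 + h *\<^sub>R axis i 1 = x + h *\<^sub>R axis i 1 + h *\<^sub>R axis j 1"
    by simp
  then have "f (x + h *\<^sub>R axis j 1 + h *\<^sub>R axis i 1) = f (x + h *\<^sub>R axis i 1 + h *\<^sub>R axis j 1)"
    by (rule arg_cong)
  then have "h * h * pd j (pd i f) (x + s *\<^sub>R axis i 1 + t *\<^sub>R axis j 1) =
      h * h * pd i (pd j f) (x + s' *\<^sub>R axis j 1 + t' *\<^sub>R axis i 1)"
    using 1 2 by linarith
  with h(1) have eq: "pd j (pd i f) (x + s *\<^sub>R axis i 1 + t *\<^sub>R axis j 1) =
      pd i (pd j f) (x + s' *\<^sub>R axis j 1 + t' *\<^sub>R axis i 1)"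
    by simp
  have "\<bar>pd j (pd i f) (x + s *\<^sub>R axis i 1 + t *\<^sub>R axis j 1) - pd j (pd i f) x\<bar> < e"
    using st h near[of s t i j] by (intro r2 box) auto
  moreover have "\<bar>pd i (pd j f) (x + s' *\<^sub>R axis j 1 + t' *\<^sub>R axis i 1) - pd i (pd j f) x\<bar> < e"
    using st' h near[of s' t' j i] by (intro r1 box) auto
  ultimately show False using eq by (simp add: e_def field_simps abs_if split: if_splits)
qed

text \<open>Cramer's rule makes the entries of the inverse quotients of polynomials in the entries
  of A, which gives the smoothness of \<open>ginv\<close>.\<close>

lemma matrix_inv_cramer:
  fixes A :: "real^'n^'n"
  assumes "invertible A"
  shows "matrix_inv A $ a $ b =
    det (\<chi> i j. if j = a then axis b 1 $ i else A $ i $ j) / det A"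
proof -
  have "A ** matrix_inv A = mat 1"
    using assms unfolding matrix_inv_def invertible_def by (metis (mono_tags, lifting) someI_ex)
  then have "A *v (matrix_inv A *v axis b 1) = axis b 1"
    by (simp add: matrix_vector_mul_assoc)
  moreover have "det A \<noteq> 0" using assms by (simp add: invertible_det_nz)
  ultimately have "matrix_inv A *v axis b 1 =
      (\<chi> k. det (\<chi> i j. if j = k then axis b 1 $ i else A $ i $ j) / det A)"
    using cramer by blast
  moreover have "(matrix_inv A *v axis b 1) $ a = matrix_inv A $ a $ b"
    by (simp add: matrix_vector_mult_basis column_def)
  ultimately show ?thesis by simp
qed

lemma smooth_on_det:
  assumes "open U" "\<And>i j. smooth_on U (\<lambda>x. A x $ i $ j)"
  shows "smooth_on U (\<lambda>x. det (A x :: real^'n^'n::finite))"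
  unfolding det_def
  by (intro smooth_on_sum smooth_on_mult smooth_on_prod smooth_on_const assms)

lemma smooth_on_matrix_inv:
  fixes A :: "real^'m::finite \<Rightarrow> real^'n^'n::finite"
  assumes U: "open U" and A: "\<And>i j. smooth_on U (\<lambda>x. A x $ i $ j)"
    and inv: "\<And>x. x \<in> U \<Longrightarrow> invertible (A x)"
  shows "smooth_on U (\<lambda>x. matrix_inv (A x) $ a $ b)"
proof (rule smooth_on_cong[OF U])
  show "smooth_on U (\<lambda>x. det (\<chi> i j. if j =
      a then axis b 1 $ i else A x $ i $ j) * inverse (det (A x)))"
    using inv A smooth_on_const[OF U]
    by (intro smooth_on_mult smooth_on_inverse smooth_on_det U)
      (auto simp: invertible_det_nz if_distrib[of "\<lambda>f. smooth_on U f"] intro!: smooth_on_if[OF U])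
qed (simp add: matrix_inv_cramer inv divide_inverse)

section \<open>Connections on a trivial bundle and its tensor powers\<close>

text \<open>The derivation of the tensor algebra induced by the endomorphism F. Recursion over the
  index list treats all valences at once and turns \<open>act_commutator\<close> into an induction;
  \<open>act_eq_sum\<close> is the slotwise form.\<close>

primrec act :: "('i::finite \<Rightarrow> 'i \<Rightarrow> real) \<Rightarrow> ('i list \<Rightarrow> real) \<Rightarrow> 'i list \<Rightarrow> real" where
  "act F T [] = 0"
| "act F T (A # As) = (\<Sum>B\<in>UNIV. F A B * T (B # As)) + act F (\<lambda>Bs. T (A # Bs)) As"

lemma act_eq_sum:
  "act F T As = (\<Sum>k<length As. \<Sum>B\<in>UNIV. F (As ! k) B * T (As[k := B]))"
  by (induction As arbitrary: T) (simp_all add: sum.lessThan_Suc_shift del: sum.lessThan_Suc)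

lemma act_zero [simp]: "act F (\<lambda>Bs. 0) As = 0"
  and act_add: "act F (\<lambda>Bs. S Bs + T Bs) As = act F S As + act F T As"
  and act_diff: "act F (\<lambda>Bs. S Bs - T Bs) As = act F S As - act F T As"
  and act_cmult: "act F (\<lambda>Bs. c * T Bs) As = c * act F T As"
  by (simp_all add: act_eq_sum sum.distrib sum_subtractf sum_negf sum_distrib_left algebra_simps)

lemma act_sum: "act F (\<lambda>Bs. \<Sum>k\<in>S. T k Bs) As = (\<Sum>k\<in>S. act F (T k) As)"
  by (induction S rule: infinite_finite_induct) (simp_all add: act_add)

lemma act_add_left: "act (\<lambda>A B. F A B + G A B) T As = act F T As + act G T As"
  and act_diff_left: "act (\<lambda>A B. F A B - G A B) T As = act F T As - act G T As"
  by (simp_all add: act_eq_sum sum.distrib sum_subtractf algebra_simps)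

text \<open>Terms in which F and G act on different slots occur in both orders and cancel; only
  products within one slot survive.\<close>

lemma act_commutator:
  "act F (act G T) As - act G (act F T) As
    = act (\<lambda>A B. \<Sum>C\<in>UNIV. F A C * G C B - G A C * F C B) T As"
proof (induction As arbitrary: T)
  case (Cons A As)
  have expand: "act F (act G T) (A # As) =
      (\<Sum>B\<in>UNIV. \<Sum>C\<in>UNIV. F A B * G B C * T (C # As))
      + (\<Sum>B\<in>UNIV. F A B * act G (\<lambda>Bs. T (B # Bs)) As)
      + (\<Sum>B\<in>UNIV. G A B * act F (\<lambda>Bs. T (B # Bs)) As)
      + act F (act G (\<lambda>Bs. T (A # Bs))) As" for F G
    by (simp add: act_add act_sum act_cmult sum.distrib sum_distrib_left algebra_simps)
  have sw: "(\<Sum>B\<in>UNIV. \<Sum>C\<in>UNIV. F A B * G B C * T (C # As))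
      = (\<Sum>C\<in>UNIV. (\<Sum>B\<in>UNIV. F A B * G B C) * T (C # As))" for F G
    by (subst sum.swap) (simp add: sum_distrib_right)
  show ?case
    unfolding expand[of F G] expand[of G F] sw
    unfolding act.simps(2) Cons.IH[of "\<lambda>Bs. T (A # Bs)", symmetric]
    by (simp add: sum_subtractf left_diff_distrib)
qed simp

text \<open>The direction a is no tensor slot, so \<open>cov_commute\<close> has no Christoffel term
  for it; \<open>grad\<close> later makes it a slot.\<close>

definition cov ::
  "('n \<Rightarrow> real^'n \<Rightarrow> 'i \<Rightarrow> 'i \<Rightarrow> real) \<Rightarrow> 'n \<Rightarrow> (real^'n \<Rightarrow> 'i list \<Rightarrow> real) \<Rightarrow>
    real^'n::finite \<Rightarrow> 'i::finite list \<Rightarrow> real" where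
  "cov \<omega> a T x As = pd a (\<lambda>y. T y As) x + act (\<omega> a x) (T x) As"

definition curv ::
  "('n \<Rightarrow> real^'n \<Rightarrow> 'i \<Rightarrow> 'i \<Rightarrow> real) \<Rightarrow> 'n \<Rightarrow> 'n \<Rightarrow> real^'n::finite \<Rightarrow> 'i::finite \<Rightarrow> 'i \<Rightarrow> real" where
  "curv \<omega> a b x A B = pd a (\<lambda>y. \<omega> b y A B) x - pd b (\<lambda>y. \<omega> a y A B) x
    + (\<Sum>C\<in>UNIV. \<omega> a x A C * \<omega> b x C B - \<omega> b x A C * \<omega> a x C B)"

lemma cov_Cons:
  "cov \<omega> a T x (A # As) =
    cov \<omega> a (\<lambda>y Bs. T y (A # Bs)) x As + (\<Sum>B\<in>UNIV. \<omega> a x A B * T x (B # As))"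
  by (simp add: cov_def)

locale connection =
  fixes U :: "(real^'n::finite) set"
    and \<omega> :: "'n \<Rightarrow> real^'n \<Rightarrow> 'i::finite \<Rightarrow> 'i \<Rightarrow> real"
  assumes U: "open U" and \<omega>: "\<And>a A B. smooth_on U (\<lambda>x. \<omega> a x A B)"
begin

abbreviation smooth_tensor :: "(real^'n \<Rightarrow> 'i list \<Rightarrow> real) \<Rightarrow> bool" where
  "smooth_tensor T \<equiv> \<forall>As. smooth_on U (\<lambda>x. T x As)"

lemmas smooth_intros = smooth_on_add[OF U] smooth_on_diff[OF U] smooth_on_minus[OF U]
  smooth_on_mult[OF U] smooth_on_sum[OF U] smooth_on_const[OF U] smooth_on_divide_const[OF U]
  smooth_on_pd[OF U]

lemma smooth_act:
  assumes "\<And>A B. smooth_on U (\<lambda>x. F x A B)" "\<And>Bs. smooth_on U (\<lambda>x. T x Bs)"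
  shows "smooth_on U (\<lambda>x. act (F x) (T x) As)"
  unfolding act_eq_sum by (intro smooth_intros assms)

lemma smooth_cov: "smooth_tensor T \<Longrightarrow> smooth_tensor (cov \<omega> a T)"
  unfolding cov_def by (intro allI smooth_intros smooth_act \<omega>) simp_all

lemma smooth_curv: "smooth_on U (\<lambda>x. curv \<omega> a b x A B)"
  unfolding curv_def by (intro smooth_intros \<omega>)

lemma cov_cong:
  assumes "x \<in> U" "\<And>y As. y \<in> U \<Longrightarrow> S y As = T y As"
  shows "cov \<omega> a S x As = cov \<omega> a T x As"
proof -
  have "S x = T x" using assms by auto
  then show ?thesis
    unfolding cov_def using pd_cong[OF U assms(1), of "\<lambda>y. S y As" "\<lambda>y. T y As"] assms(2) by simp
qed

context
  fixes x assumes x: "x \<in> U"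
begin

lemmas smooth_D = smooth_on_differentiable[OF _ x]

lemma pd_mult_smooth:
  "smooth_on U f \<Longrightarrow> smooth_on U h \<Longrightarrow> pd a (\<lambda>y. f y * h y) x = pd a f x * h x + f x * pd a h x"
  by (intro pd_mult smooth_D)

lemma pd_sum_smooth:
  "(\<And>k. smooth_on U (f k)) \<Longrightarrow> pd a (\<lambda>y. \<Sum>k\<in>S. f k y) x = (\<Sum>k\<in>S. pd a (f k) x)"
  by (intro pd_sum smooth_D)

lemma pd_act:
  assumes F: "\<And>A B. smooth_on U (\<lambda>x. F x A B)" and T: "\<And>Bs. smooth_on U (\<lambda>x. T x Bs)"
  shows "pd b (\<lambda>y. act (F y) (T y) As) x =
    act (\<lambda>A B. pd b (\<lambda>y. F y A B) x) (T x) As + act (F x) (\<lambda>Bs. pd b (\<lambda>y. T y Bs) x) As"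
  by (simp add: act_eq_sum pd_sum_smooth pd_mult_smooth F T smooth_intros sum.distrib)

lemma cov_diff:
  "smooth_tensor S \<Longrightarrow> smooth_tensor T \<Longrightarrow>
    cov \<omega> a (\<lambda>y As. S y As - T y As) x As = cov \<omega> a S x As - cov \<omega> a T x As"
  by (simp add: cov_def act_diff pd_diff smooth_D)

lemma cov_scale:
  "smooth_on U f \<Longrightarrow> smooth_tensor T \<Longrightarrow>
    cov \<omega> a (\<lambda>y As. f y * T y As) x As = pd a f x * T x As + f x * cov \<omega> a T x As"
  by (simp add: cov_def act_cmult pd_mult_smooth algebra_simps)

lemma cov_cmult:
  "smooth_tensor T \<Longrightarrow> cov \<omega> a (\<lambda>y As. c * T y As) x As = c * cov \<omega> a T x As"
  using cov_scale[of "\<lambda>_. c" T] smooth_intros by simp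

text \<open>\<open>act_commutator\<close> moves \<omega> past F; the commutator and the partial
  derivative of F together are the covariant derivative of the endomorphism.\<close>

lemma cov_act:
  assumes F: "\<And>A B. smooth_on U (\<lambda>x. F x A B)" and T: "smooth_tensor T"
  shows "cov \<omega> a (\<lambda>y. act (F y) (T y)) x As =
    act (\<lambda>A B. pd a (\<lambda>y. F y A B) x
      + (\<Sum>C\<in>UNIV. \<omega> a x A C * F x C B - F x A C * \<omega> a x C B)) (T x) As
    + act (F x) (cov \<omega> a T x) As"
proof -
  have "cov \<omega> a T x = (\<lambda>Bs. pd a (\<lambda>y. T y Bs) x + act (\<omega> a x) (T x) Bs)"
    by (simp add: cov_def fun_eq_iff)
  then show ?thesis
    using act_commutator[of "\<omega> a x" "F x" "T x" As] F T
    by (simp add: cov_def[of _ _ "\<lambda>y. act (F y) (T y)"] act_add act_add_left pd_act)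
qed

text \<open>Mixed partials commute, and the terms with one derivative on T are symmetric in a and b;
  what remains is the derivative of \<omega> and a commutator of actions.\<close>

lemma cov_commute:
  assumes T: "smooth_tensor T"
  shows "cov \<omega> a (cov \<omega> b T) x As - cov \<omega> b (cov \<omega> a T) x As = act (curv \<omega> a b x) (T x) As"
proof -
  have "cov \<omega> a (cov \<omega> b T) x As =
      pd a (pd b (\<lambda>y. T y As)) x
      + act (\<lambda>A B. pd a (\<lambda>y. \<omega> b y A B) x) (T x) As
      + act (\<omega> b x) (\<lambda>Bs. pd a (\<lambda>y. T y Bs) x) As
      + act (\<omega> a x) (\<lambda>Bs. pd b (\<lambda>y. T y Bs) x) As
      + act (\<omega> a x) (act (\<omega> b x) (T x)) As" for a b
    using T by (simp add: cov_def[abs_def] act_add pd_add pd_act \<omega> smooth_D smooth_act smooth_intros)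
  moreover have "pd a (pd b (\<lambda>y. T y As)) x = pd b (pd a (\<lambda>y. T y As)) x"
    using T by (intro pd_commute[OF U x]) simp
  ultimately show ?thesis
    using act_commutator[of "\<omega> a x" "\<omega> b x" "T x" As]
    by (simp add: curv_def[abs_def] act_add_left act_diff_left)
qed

end

text \<open>The Jacobi identity for \<open>cov\<close>, evaluated on constant sections.\<close>

lemma curv_bianchi:
  assumes x: "x \<in> U"
  defines "D \<equiv> \<lambda>f a b A B. pd f (\<lambda>y. curv \<omega> a b y A B) x
    + (\<Sum>C\<in>UNIV. \<omega> f x A C * curv \<omega> a b x C B - curv \<omega> a b x A C * \<omega> f x C B)"
  shows "D f a b A B + D a b f A B + D b f a A B = 0"
proof -
  \<comment> \<open>A constant section with the single component B: an endomorphism acting on it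
    shows its column B.\<close>
  define T :: "real^'n \<Rightarrow> 'i list \<Rightarrow> real" where "T = (\<lambda>_ As. if As = [B] then 1 else 0)"
  have T: "smooth_tensor T" by (auto simp: T_def smooth_intros)
  have TT: "act F (T x) [A] = F A B" for F
    by (simp add: T_def if_distrib[of "(*) _"] cong: if_cong)
  have J: "cov \<omega> f (cov \<omega> a (cov \<omega> b T)) x [A] - cov \<omega> f (cov \<omega> b (cov \<omega> a T)) x [A]
      - (cov \<omega> a (cov \<omega> b (cov \<omega> f T)) x [A] - cov \<omega> b (cov \<omega> a (cov \<omega> f T)) x [A])
      = D f a b A B" for f a b
  proof -
    have "cov \<omega> f (cov \<omega> a (cov \<omega> b T)) x [A] - cov \<omega> f (cov \<omega> b (cov \<omega> a T)) x [A]
        = cov \<omega> f (\<lambda>y As. act (curv \<omega> a b y) (T y) As) x [A]"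
      using T by (subst cov_diff[OF x, symmetric])
        (auto intro: smooth_cov[rule_format] cov_cong[OF x] cov_commute)
    then show ?thesis
      using cov_commute[OF x smooth_cov[OF T], of a b f "[A]"]
        cov_act[OF x, where F = "curv \<omega> a b" and a = f and As = "[A]", OF smooth_curv T]
      by (simp only: TT D_def)
  qed
  show ?thesis using J[of f a b] J[of a b f] J[of b f a] by simp
qed

text \<open>\<open>\<gamma>\<close> contracts two slots, so it is a form on the dual bundle.\<close>

definition parallel_form :: "(real^'n \<Rightarrow> 'i \<Rightarrow> 'i \<Rightarrow> real) \<Rightarrow> bool" where
  "parallel_form \<gamma> \<longleftrightarrow> (\<forall>B C. smooth_on U (\<lambda>x. \<gamma> x B C)) \<and>
    (\<forall>x\<in>U. \<forall>a B C. pd a (\<lambda>y. \<gamma> y B C) x =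
      (\<Sum>D\<in>UNIV. \<gamma> x D C * \<omega> a x D B) + (\<Sum>D\<in>UNIV. \<gamma> x B D * \<omega> a x D C))"

text \<open>Differentiating the parallel \<gamma> transposes the connection onto the two contracted
  slots (facts 1 and 2), which supplies the terms that \<open>act\<close> on the remaining indices
  omits.\<close>

lemma cov_contract:
  assumes \<gamma>: "parallel_form \<gamma>" and x: "x \<in> U" and T: "smooth_tensor T"
  shows "cov \<omega> a (\<lambda>y As. \<Sum>B\<in>UNIV. \<Sum>C\<in>UNIV. \<gamma> y B C * T y (B # C # As)) x As
    = (\<Sum>B\<in>UNIV. \<Sum>C\<in>UNIV. \<gamma> x B C * cov \<omega> a T x (B # C # As))"
proof -
  have s\<gamma>: "smooth_on U (\<lambda>x. \<gamma> x B C)" for B C using \<gamma> by (simp add: parallel_form_def)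
  have d\<gamma>: "pd a (\<lambda>y. \<gamma> y B C) x =
      (\<Sum>D\<in>UNIV. \<gamma> x D C * \<omega> a x D B) + (\<Sum>D\<in>UNIV. \<gamma> x B D * \<omega> a x D C)" for B C
    using \<gamma> x by (simp add: parallel_form_def sum_negf)
  have 1: "(\<Sum>B\<in>UNIV. \<Sum>C\<in>UNIV. (\<Sum>D\<in>UNIV. \<gamma> x D C * \<omega> a x D B) * T x (B # C # As))
      = (\<Sum>B\<in>UNIV. \<Sum>C\<in>UNIV. \<gamma> x B C * (\<Sum>D\<in>UNIV. \<omega> a x B D * T x (D # C # As)))"
  proof -
    have "(\<Sum>B\<in>UNIV. \<Sum>C\<in>UNIV. (\<Sum>D\<in>UNIV. \<gamma> x D C * \<omega> a x D B) * T x (B # C # As))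
      = (\<Sum>C\<in>UNIV. \<Sum>B\<in>UNIV. \<Sum>D\<in>UNIV. \<gamma> x D C * \<omega> a x D B * T x (B # C # As))"
      by (subst sum.swap) (simp add: sum_distrib_right)
    also have "\<dots> = (\<Sum>C\<in>UNIV. \<Sum>D\<in>UNIV. \<Sum>B\<in>UNIV. \<gamma> x D C * \<omega> a x D B * T x (B # C # As))"
      by (intro sum.cong refl sum.swap)
    also have "\<dots> = (\<Sum>D\<in>UNIV. \<Sum>C\<in>UNIV. \<Sum>B\<in>UNIV. \<gamma> x D C * \<omega> a x D B * T x (B # C # As))"
      by (rule sum.swap)
    finally show ?thesis by (simp add: sum_distrib_left mult.assoc)
  qed
  have 2: "(\<Sum>B\<in>UNIV. \<Sum>C\<in>UNIV. (\<Sum>D\<in>UNIV. \<gamma> x B D * \<omega> a x D C) * T x (B # C # As))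
      = (\<Sum>B\<in>UNIV. \<Sum>C\<in>UNIV. \<gamma> x B C * (\<Sum>D\<in>UNIV. \<omega> a x C D * T x (B # D # As)))"
  proof (rule sum.cong[OF refl])
    fix B
    have "(\<Sum>C\<in>UNIV. (\<Sum>D\<in>UNIV. \<gamma> x B D * \<omega> a x D C) * T x (B # C # As))
      = (\<Sum>C\<in>UNIV. \<Sum>D\<in>UNIV. \<gamma> x B D * \<omega> a x D C * T x (B # C # As))"
      by (simp add: sum_distrib_right)
    also have "\<dots> = (\<Sum>D\<in>UNIV. \<Sum>C\<in>UNIV. \<gamma> x B D * \<omega> a x D C * T x (B # C # As))"
      by (rule sum.swap)
    finally show "(\<Sum>C\<in>UNIV. (\<Sum>D\<in>UNIV. \<gamma> x B D * \<omega> a x D C) * T x (B # C # As))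
      = (\<Sum>C\<in>UNIV. \<gamma> x B C * (\<Sum>D\<in>UNIV. \<omega> a x C D * T x (B # D # As)))"
      by (simp add: sum_distrib_left mult.assoc)
  qed
  have "cov \<omega> a (\<lambda>y As. \<Sum>B\<in>UNIV. \<Sum>C\<in>UNIV. \<gamma> y B C * T y (B # C # As)) x As
    = (\<Sum>B\<in>UNIV. \<Sum>C\<in>UNIV. pd a (\<lambda>y. \<gamma> y B C) x * T x (B # C # As)
        + \<gamma> x B C * pd a (\<lambda>y. T y (B # C # As)) x
        + \<gamma> x B C * act (\<omega> a x) (\<lambda>Bs. T x (B # C # Bs)) As)"
    using T by (simp add: cov_def act_sum act_cmult pd_sum_smooth[OF x] pd_mult_smooth[OF x] s\<gamma>
        smooth_intros sum.distrib)
  also have "\<dots> = (\<Sum>B\<in>UNIV. \<Sum>C\<in>UNIV. \<gamma> x B C * cov \<omega> a T x (B # C # As))"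
    by (simp add: d\<gamma> distrib_right sum.distrib 1 2 cov_def distrib_left)
  finally show ?thesis .
qed

definition sec :: "(real^'n \<Rightarrow> 'i \<Rightarrow> real) \<Rightarrow> real^'n \<Rightarrow> 'i list \<Rightarrow> real" where
  "sec m x As = (case As of [A] \<Rightarrow> m x A | _ \<Rightarrow> 0)"

lemma cov_contract_sec:
  assumes \<gamma>: "parallel_form \<gamma>" and x: "x \<in> U" and T: "smooth_tensor T"
    and m: "\<And>A. smooth_on U (\<lambda>x. m x A)"
  shows "cov \<omega> a (\<lambda>y As. \<Sum>B\<in>UNIV. \<Sum>C\<in>UNIV. \<gamma> y B C * (m y B * T y (C # As))) x As
    = (\<Sum>B\<in>UNIV. \<Sum>C\<in>UNIV. \<gamma> x B C *
        (cov \<omega> a (sec m) x [B] * T x (C # As) + m x B * cov \<omega> a T x (C # As)))"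
proof -
  \<comment> \<open>The tensor product of m and T, so that \<open>cov_contract\<close> applies; the
    value on the empty list is a default.\<close>
  define S where "S y As = (case As of [] \<Rightarrow> 0 | B # Bs \<Rightarrow> m y B * T y Bs)" for y As
  have S: "smooth_tensor S"
  proof
    fix As show "smooth_on U (\<lambda>x. S x As)"
      using m T by (cases As) (simp_all add: S_def smooth_intros)
  qed
  have "cov \<omega> a S x (B # C # As) =
      cov \<omega> a (sec m) x [B] * T x (C # As) + m x B * cov \<omega> a T x (C # As)" for B C
    using m T by (simp add: cov_def S_def sec_def pd_mult_smooth[OF x] act_add act_cmult
        sum_distrib_left sum_distrib_right algebra_simps)
  moreover have "S y (B # Bs) = m y B * T y Bs" for y B Bs by (simp add: S_def)
  ultimately show ?thesis using cov_contract[OF \<gamma> x S, of a As] by simp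
qed

end

section \<open>The Levi-Civita connection\<close>

lemma sum_tix: "(\<Sum>A\<in>UNIV. f A) = f TY + (\<Sum>a\<in>UNIV. f (TZ a)) + f TX"
  for f :: "'n::finite tix \<Rightarrow> real"
proof -
  have U: "(UNIV :: 'n tix set) = insert TY (insert TX (range TZ))"
    by (auto intro: tix.exhaust)
  have "sum f (range TZ) = (\<Sum>a\<in>UNIV. f (TZ a))"
    by (subst sum.reindex) (simp_all add: inj_on_def)
  moreover have "sum f (insert TY (insert TX (range TZ))) = f TY + (f TX + sum f (range TZ))"
    by (simp add: image_iff)
  ultimately show ?thesis unfolding U by simp
qed

lemma sum_Plus: "(\<Sum>A\<in>UNIV. f A) = (\<Sum>a\<in>UNIV. f (Inl a)) + (\<Sum>a\<in>UNIV. f (Inr a))"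
  for f :: "'a::finite + 'b::finite \<Rightarrow> real"
  using sum.Plus[of "UNIV :: 'a set" "UNIV :: 'b set" f] by (simp add: UNIV_Plus_UNIV)

lemma sum_delta_simps:
  fixes f :: "'a::finite \<Rightarrow> real"
  shows "(\<Sum>k\<in>UNIV. (if k = j then 1 else 0) * f k) = f j"
    "(\<Sum>k\<in>UNIV. (if j = k then 1 else 0) * f k) = f j"
    "(\<Sum>k\<in>UNIV. f k * (if k = j then 1 else 0)) = f j"
    "(\<Sum>k\<in>UNIV. f k * (if j = k then 1 else 0)) = f j"
  by (simp_all add: if_distrib[of "(*) _"] if_distrib[of "\<lambda>x. x * _"] cong: if_cong)

text \<open>U is an arbitrary open set rather than a chart image, because the argument is later
  restricted to the part where \<sigma> is non-zero.\<close>

locale chart_metric =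
  fixes U :: "(real^'n::finite) set" and g :: "'n local_metric"
  assumes U: "open U"
    and smooth_g: "\<And>i j. smooth_on U (\<lambda>x. g x $ i $ j)"
    and g_sym: "\<And>x i j. x \<in> U \<Longrightarrow> g x $ i $ j = g x $ j $ i"
    and g_invertible: "\<And>x. x \<in> U \<Longrightarrow> invertible (g x)"
    and dim: "CARD('n) \<ge> 3"
begin

lemmas smooth_intros = smooth_on_add[OF U] smooth_on_diff[OF U] smooth_on_minus[OF U]
  smooth_on_mult[OF U] smooth_on_sum[OF U] smooth_on_const[OF U] smooth_on_divide_const[OF U]
  smooth_on_pd[OF U]

lemma smooth_ginv: "smooth_on U (\<lambda>x. ginv g x a b)"
  unfolding ginv_def by (intro smooth_on_matrix_inv U smooth_g g_invertible)

lemma smooth_christoffel: "smooth_on U (\<lambda>x. christoffel g x c a b)"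
  unfolding christoffel_def by (intro smooth_intros smooth_ginv smooth_g)

lemma smooth_riemann: "smooth_on U (\<lambda>x. riemann g x a b c e)"
  unfolding riemann_def by (intro smooth_intros smooth_christoffel)

lemma smooth_ricci: "smooth_on U (\<lambda>x. ricci g x a b)"
  unfolding ricci_def by (intro smooth_intros smooth_riemann)

lemma smooth_Jsc: "smooth_on U (\<lambda>x. Jsc g x)"
  unfolding Jsc_def by (intro smooth_intros smooth_ricci smooth_ginv)

lemma smooth_schouten: "smooth_on U (\<lambda>x. schouten g x a b)"
  unfolding schouten_def by (intro smooth_intros smooth_ricci smooth_Jsc smooth_g)

lemma smooth_weyl: "smooth_on U (\<lambda>x. weyl g x a b c e)"
  unfolding weyl_def riemann_low_def by (intro smooth_intros smooth_riemann smooth_schouten smooth_g)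

lemma smooth_cotton: "smooth_on U (\<lambda>x. cotton g x a b c)"
  unfolding cotton_def nabla_schouten_def
  by (intro smooth_intros smooth_schouten smooth_christoffel)

lemma smooth_bach: "smooth_on U (\<lambda>x. bach g x a b)"
  unfolding bach_def nabla_cotton_def
  by (intro smooth_intros smooth_schouten smooth_christoffel smooth_cotton smooth_ginv smooth_weyl)

lemmas smooth_geometry =
    smooth_g smooth_ginv smooth_christoffel smooth_riemann smooth_ricci smooth_Jsc
  smooth_schouten smooth_weyl smooth_cotton smooth_bach

context
  fixes x assumes x: "x \<in> U"
begin

lemma pd_mult_smooth:
  "smooth_on U f \<Longrightarrow> smooth_on U h \<Longrightarrow> pd a (\<lambda>y. f y * h y) x = pd a f x * h x + f x * pd a h x"
  by (intro pd_mult smooth_on_differentiable[OF _ x])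

lemma pd_sum_smooth:
  "(\<And>k. smooth_on U (f k)) \<Longrightarrow> pd a (\<lambda>y. \<Sum>k\<in>S. f k y) x = (\<Sum>k\<in>S. pd a (f k) x)"
  by (intro pd_sum smooth_on_differentiable[OF _ x])

lemma pd_minus_smooth: "smooth_on U f \<Longrightarrow> pd a (\<lambda>y. - f y) x = - pd a f x"
  by (intro pd_minus smooth_on_differentiable[OF _ x])

lemma matrix_inv_g: "matrix_inv (g x) ** g x = mat 1 \<and> g x ** matrix_inv (g x) = mat 1"
  using someI_ex[OF g_invertible[OF x, unfolded invertible_def]]
  unfolding matrix_inv_def by blast

lemma ginv_g: "(\<Sum>b\<in>UNIV. ginv g x a b * g x $ b $ c) = (if a = c then 1 else 0)"
  and g_ginv: "(\<Sum>b\<in>UNIV. g x $ a $ b * ginv g x b c) = (if a = c then 1 else 0)"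
proof -
  have "(matrix_inv (g x) ** g x) $ a $ c = mat 1 $ a $ c"
    "(g x ** matrix_inv (g x)) $ a $ c = mat 1 $ a $ c" using matrix_inv_g by simp_all
  then show "(\<Sum>b\<in>UNIV. ginv g x a b * g x $ b $ c) = (if a = c then 1 else 0)"
    "(\<Sum>b\<in>UNIV. g x $ a $ b * ginv g x b c) = (if a = c then 1 else 0)"
    by (simp_all add: matrix_matrix_mult_def mat_def ginv_def)
qed

lemma ginv_sym: "ginv g x a b = ginv g x b a"
proof -
  let ?B = "matrix_inv (g x)"
  have t: "transpose (g x) = g x" using g_sym[OF x] by (simp add: transpose_def vec_eq_iff)
  have 1: "g x ** ?B = mat 1" using matrix_inv_g by simp
  have "transpose ?B ** g x = mat 1"
    using arg_cong[OF 1, of transpose] by (simp add: matrix_transpose_mul t transpose_mat)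
  then have "?B = transpose ?B ** g x ** ?B" by simp
  also have "\<dots> = transpose ?B" by (simp add: matrix_mul_assoc[symmetric] 1)
  finally have "?B $ a $ b = transpose ?B $ a $ b" by (rule arg_cong)
  then show ?thesis by (simp add: ginv_def transpose_def)
qed

lemma lower_ginv: "(\<Sum>e\<in>UNIV. g x $ e $ c * (\<Sum>f\<in>UNIV. ginv g x e f * v f)) = v c"
proof -
  have "(\<Sum>e\<in>UNIV. g x $ e $ c * (\<Sum>f\<in>UNIV. ginv g x e f * v f))
      = (\<Sum>f\<in>UNIV. (\<Sum>e\<in>UNIV. g x $ c $ e * ginv g x e f) * v f)"
    by (simp add: sum_distrib_left sum_distrib_right g_sym[OF x, of _ c] mult.assoc)
      (rule sum.swap)
  also have "\<dots> = v c" by (simp add: g_ginv sum_delta_simps)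
  finally show ?thesis .
qed

lemma raise_g: "(\<Sum>e\<in>UNIV. ginv g x c e * (\<Sum>f\<in>UNIV. g x $ f $ e * v f)) = v c"
proof -
  have "(\<Sum>e\<in>UNIV. ginv g x c e * (\<Sum>f\<in>UNIV. g x $ f $ e * v f))
      = (\<Sum>e\<in>UNIV. ginv g x c e * (\<Sum>f\<in>UNIV. g x $ e $ f * v f))"
    by (intro sum.cong refl arg_cong2[where f = "(*)"] g_sym x)
  also have "\<dots> = (\<Sum>f\<in>UNIV. (\<Sum>e\<in>UNIV. ginv g x c e * g x $ e $ f) * v f)"
    by (simp add: sum_distrib_left sum_distrib_right mult.assoc) (rule sum.swap)
  also have "\<dots> = v c" by (simp add: ginv_g sum_delta_simps)
  finally show ?thesis .
qed

lemma christoffel_sym: "christoffel g x c a b = christoffel g x c b a"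
proof -
  have "pd e (\<lambda>y. g y $ a $ b) x = pd e (\<lambda>y. g y $ b $ a) x" for e a b
    using g_sym by (intro pd_cong[OF U x])
  then show ?thesis by (simp add: christoffel_def add.commute)
qed

lemma christoffel_low: "(\<Sum>e\<in>UNIV. g x $ e $ c * christoffel g x e a b) =
    (pd a (\<lambda>y. g y $ b $ c) x + pd b (\<lambda>y. g y $ a $ c) x - pd c (\<lambda>y. g y $ a $ b) x) / 2"
  unfolding christoffel_def times_divide_eq_right sum_divide_distrib[symmetric] lower_ginv ..

text \<open>This is \<nabla>g = 0: in the sum of two lowered Christoffel symbols all derivatives of
  g except the one in direction a cancel.\<close>

lemma pd_g: "pd a (\<lambda>y. g y $ b $ c) x =
    (\<Sum>e\<in>UNIV. christoffel g x e a b * g x $ e $ c) + (\<Sum>e\<in>UNIV. christoffel g x e a c * g x $ b $ e)"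
proof -
  have s: "pd e (\<lambda>y. g y $ a $ b) x = pd e (\<lambda>y. g y $ b $ a) x" for e a b
    using g_sym by (intro pd_cong[OF U x])
  have "(\<Sum>e\<in>UNIV. christoffel g x e a b * g x $ e $ c) +
      (\<Sum>e\<in>UNIV. christoffel g x e a c * g x $ b $ e)
      = (\<Sum>e\<in>UNIV. g x $ e $ c * christoffel g x e a b) + (\<Sum>e\<in>UNIV. g x $ e $ b * christoffel g x e a c)"
    by (simp add: g_sym[OF x, of b] mult.commute)
  also have "\<dots> = pd a (\<lambda>y. g y $ b $ c) x"
    unfolding christoffel_low s[of a c b] s[of b c a] s[of c b a] by (simp add: field_simps)
  finally show ?thesis ..
qed

lemma pd_ginv: "pd a (\<lambda>y. ginv g y b c) x =
    - (\<Sum>e\<in>UNIV. christoffel g x b a e * ginv g x e c) -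
        (\<Sum>e\<in>UNIV. christoffel g x c a e * ginv g x b e)"
proof -
  let ?G = "ginv g x" and ?g = "\<lambda>i j. g x $ i $ j" and ?C = "\<lambda>c b. christoffel g x c a b"
  let ?D = "\<lambda>e. pd a (\<lambda>y. ginv g y b e) x"
  \<comment> \<open>From differentiating the relation \<open>ginv_g\<close>; raising f with
    \<open>raise_g\<close> then isolates the derivative of \<open>ginv\<close>.\<close>
  have eq: "(\<Sum>e\<in>UNIV. ?g f e * ?D e) =
      - ?C b f - (\<Sum>e\<in>UNIV. ?G b e * (\<Sum>h\<in>UNIV. ?C h e * ?g h f))" for f
  proof -
    have "pd a (\<lambda>y. \<Sum>e\<in>UNIV. ginv g y b e * g y $ e $ f) x = pd a (\<lambda>y. if b = f then 1 else 0) x"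
      using x by (intro pd_cong[OF U]) (auto simp: chart_metric.ginv_g[OF chart_metric_axioms])
    then have "(\<Sum>e\<in>UNIV. ?D e * ?g e f) + (\<Sum>e\<in>UNIV. ?G b e * pd a (\<lambda>y. g y $ e $ f) x) = 0"
      by (simp add: pd_sum_smooth pd_mult_smooth smooth_intros smooth_geometry sum.distrib)
    moreover have "(\<Sum>e\<in>UNIV. ?G b e * (\<Sum>h\<in>UNIV. ?C h f * ?g e h)) = ?C b f"
      using raise_g[of b "\<lambda>h. ?C h f"] by (simp add: g_sym[OF x, of _ _] mult.commute)
    ultimately show ?thesis
      by (simp add: pd_g distrib_left sum.distrib g_sym[OF x, of f] mult.commute)
  qed
  have "?D c = (\<Sum>f\<in>UNIV. ?G c f * (\<Sum>e\<in>UNIV. ?g e f * ?D e))"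
    by (rule raise_g[symmetric])
  also have "\<dots> = (\<Sum>f\<in>UNIV. ?G c f * (- ?C b f - (\<Sum>e\<in>UNIV. ?G b e * (\<Sum>h\<in>UNIV. ?C h e * ?g h f))))"
    by (simp add: eq g_sym[OF x, of _ _])
  also have "\<dots> = - (\<Sum>f\<in>UNIV. ?C b f * ?G f c)
      - (\<Sum>f\<in>UNIV. ?G c f * (\<Sum>h\<in>UNIV. ?g h f * (\<Sum>e\<in>UNIV. ?C h e * ?G b e)))"
  proof -
    have "(\<Sum>e\<in>UNIV. ?G b e * (\<Sum>h\<in>UNIV. ?C h e * ?g h f))
        = (\<Sum>h\<in>UNIV. ?g h f * (\<Sum>e\<in>UNIV. ?C h e * ?G b e))" for f
      by (simp add: sum_distrib_left mult_ac) (rule sum.swap)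
    then show ?thesis
      by (simp add: right_diff_distrib sum_subtractf sum_negf ginv_sym[of c] mult.commute)
  qed
  finally show ?thesis by (simp add: raise_g)
qed

lemma riemann_skew: "riemann g x b a c e = - riemann g x a b c e"
  by (simp add: riemann_def sum_subtractf)

lemma riemann_cyclic: "riemann g x a b c e + riemann g x b e c a + riemann g x e a c b = 0"
proof -
  have "pd f (\<lambda>y. christoffel g y c a b) x = pd f (\<lambda>y. christoffel g y c b a) x" for f a b
    by (intro pd_cong[OF U x] chart_metric.christoffel_sym[OF chart_metric_axioms])
  then show ?thesis
    by (simp add: riemann_def sum_subtractf christoffel_sym[of _ a e] christoffel_sym[of _ b e]
      christoffel_sym[of _ a b])
qed

end

end

section \<open>Coupled tractor and Levi-Civita connection\<close>

fun tconn :: "'n::finite local_metric \<Rightarrow> 'n \<Rightarrow> real^'n \<Rightarrow> 'n tix \<Rightarrow> 'n tix \<Rightarrow> real" where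
  "tconn g a x TY (TZ b) = - (if a = b then 1 else 0)"
| "tconn g a x (TZ b) TY = schouten g x a b"
| "tconn g a x (TZ b) (TZ c) = - christoffel g x c a b"
| "tconn g a x (TZ b) TX = g x $ a $ b"
| "tconn g a x TX (TZ c) = - (\<Sum>b\<in>UNIV. schouten g x a b * ginv g x b c)"
| "tconn g a x _ _ = 0"

lemma tractor_conn_eq_tconn: "tractor_conn g x a V A = (\<Sum>B\<in>UNIV. tconn g a x A B * V B)"
proof (cases A)
  case TX
  have "(\<Sum>b\<in>UNIV. \<Sum>c\<in>UNIV. schouten g x a b * ginv g x b c * V (TZ c))
      = (\<Sum>c\<in>UNIV. (\<Sum>b\<in>UNIV. schouten g x a b * ginv g x b c) * V (TZ c))"
    by (subst sum.swap) (simp add: sum_distrib_right)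
  with TX show ?thesis by (simp add: sum_tix sum_negf)
next
  case TY
  have "(\<Sum>b\<in>UNIV. (if a = b then 1 else 0) * V (TZ b)) = V (TZ a)"
    by (rule sum_delta_simps)
  with TY show ?thesis by (simp add: sum_tix sum_negf)
qed (simp add: sum_tix sum_negf)

text \<open>\<open>Inl\<close> marks lower indices of the cotangent bundle, \<open>Inr\<close> upper tractor indices.\<close>

fun mconn :: "'n::finite local_metric \<Rightarrow> 'n \<Rightarrow> real^'n \<Rightarrow> 'n + 'n tix \<Rightarrow> 'n + 'n tix \<Rightarrow> real" where
  "mconn g a x (Inl i) (Inl j) = - christoffel g x j a i"
| "mconn g a x (Inr A) (Inr B) = tconn g a x A B"
| "mconn g a x _ _ = 0"

text \<open>\<open>mconn\<close> is block diagonal and keeps the kind of every slot, so a tensor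
  need only be known on lists with the given pattern of cotangent and tractor slots.\<close>

lemma act_cong_kind:
  assumes "\<And>Bs. map isl Bs = map isl As \<Longrightarrow> S Bs = T Bs"
  shows "act (mconn g a x) S As = act (mconn g a x) T As"
  using assms
proof (induction As arbitrary: S T)
  case (Cons A As)
  have "mconn g a x A B * S (B # As) = mconn g a x A B * T (B # As)" for B
    using Cons.prems[of "B # As"] by (cases A; cases B) auto
  moreover have "act (mconn g a x) (\<lambda>Bs. S (A # Bs)) As = act (mconn g a x) (\<lambda>Bs. T (A # Bs)) As"
    by (rule Cons.IH) (simp add: Cons.prems)
  ultimately show ?case unfolding act.simps(2) by (intro arg_cong2[where f = "(+)"] sum.cong refl)
qed simp

text \<open>\<open>Omega g x a b C E\<close> is \<open>\<Omega>\<^sub>a\<^sub>b\<^sup>C\<^sup>E\<close>, the curvature of \<open>tconn\<close> (lemma \<open>Omega_curv\<close>).\<close>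

fun Omega :: "'n::finite local_metric \<Rightarrow> real^'n \<Rightarrow> 'n \<Rightarrow> 'n \<Rightarrow> 'n tix \<Rightarrow> 'n tix \<Rightarrow> real" where
  "Omega g x a b (TZ c) (TZ e) = weyl g x a b c e"
| "Omega g x a b (TZ c) TX = cotton g x c a b"
| "Omega g x a b TX (TZ e) = - cotton g x e a b"
| "Omega g x a b _ _ = 0"

context chart_metric
begin

lemma smooth_tconn: "smooth_on U (\<lambda>x. tconn g a x A B)"
  by (cases A; cases B) (simp_all add: smooth_intros smooth_geometry)

lemma smooth_mconn: "smooth_on U (\<lambda>x. mconn g a x A B)"
  by (cases A; cases B) (simp_all add: smooth_intros smooth_geometry smooth_tconn)

sublocale mc: connection U "mconn g"
  by unfold_locales (rule U smooth_mconn)+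

lemma cov_cong_kind:
  assumes "x \<in> U" "\<And>y Bs. y \<in> U \<Longrightarrow> map isl Bs = map isl As \<Longrightarrow> S y Bs = T y Bs"
  shows "cov (mconn g) a S x As = cov (mconn g) a T x As"
proof -
  have "pd a (\<lambda>y. S y As) x = pd a (\<lambda>y. T y As) x"
    using assms by (intro pd_cong[OF U]) auto
  moreover have "act (mconn g a x) (S x) As = act (mconn g a x) (T x) As"
    using assms by (intro act_cong_kind) auto
  ultimately show ?thesis by (simp add: cov_def)
qed

definition tr :: "real^'n \<Rightarrow> ('n \<Rightarrow> 'n \<Rightarrow> real) \<Rightarrow> real" where
  "tr x f = (\<Sum>a\<in>UNIV. \<Sum>b\<in>UNIV. ginv g x a b * f a b)"

lemma tr_add: "tr x (\<lambda>a b. f a b + h a b) = tr x f + tr x h"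
  and tr_diff: "tr x (\<lambda>a b. f a b - h a b) = tr x f - tr x h"
  and tr_minus: "tr x (\<lambda>a b. - f a b) = - tr x f"
  and tr_cmult: "tr x (\<lambda>a b. c * f a b) = c * tr x f"
  and tr_multc: "tr x (\<lambda>a b. f a b * c) = tr x f * c"
  and tr_zero: "tr x (\<lambda>a b. 0) = 0"
  by (simp_all add: tr_def sum.distrib sum_subtractf sum_negf sum_distrib_left sum_distrib_right
      algebra_simps)

lemmas tr_linear = tr_add tr_diff tr_minus tr_cmult tr_multc tr_zero

lemma tr_sum: "tr x (\<lambda>a b. \<Sum>k\<in>S. f k a b) = (\<Sum>k\<in>S. tr x (f k))"
  by (induction S rule: infinite_finite_induct) (simp_all add: tr_linear)

lemma tr_swap: "tr x (\<lambda>a b. tr x (\<lambda>c e. f a b c e)) = tr x (\<lambda>c e. tr x (\<lambda>a b. f a b c e))"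
  unfolding tr_def[of x "\<lambda>c e. f _ _ c e"] tr_sum tr_cmult
  by (simp add: tr_def)

context
  fixes x assumes x: "x \<in> U"
begin

lemma tr_flip: "tr x f = tr x (\<lambda>a b. f b a)"
  unfolding tr_def by (subst sum.swap) (simp add: ginv_sym[OF x])

lemma tr_g1: "tr x (\<lambda>a b. g x $ a $ c * v b) = v c"
  and tr_g2: "tr x (\<lambda>a b. g x $ c $ a * v b) = v c"
  and tr_g3: "tr x (\<lambda>a b. g x $ b $ c * v a) = v c"
  and tr_g4: "tr x (\<lambda>a b. g x $ c $ b * v a) = v c"
proof -
  show 1: "tr x (\<lambda>a b. g x $ a $ c * v b) = v c" for v c
    using lower_ginv[OF x, of c v] by (simp add: tr_def sum_distrib_left algebra_simps)
  then show 2: "tr x (\<lambda>a b. g x $ c $ a * v b) = v c" for v c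
    by (simp add: g_sym[OF x, of c])
  show "tr x (\<lambda>a b. g x $ b $ c * v a) = v c" "tr x (\<lambda>a b. g x $ c $ b * v a) = v c"
    by (subst tr_flip, rule 1, subst tr_flip, rule 2)
qed

lemma tr_gg: "tr x (\<lambda>a b. g x $ a $ b) = real CARD('n)"
proof -
  have "(\<Sum>b\<in>UNIV. ginv g x a b * g x $ a $ b) = 1" for a
    using ginv_g[OF x, of a a] by (simp add: g_sym[OF x, of a])
  then show ?thesis by (simp add: tr_def)
qed

lemma tr_gg': "tr x (\<lambda>a b. g x $ b $ a) = real CARD('n)"
  using tr_gg by (subst tr_flip)

lemmas tr_g = tr_g1 tr_g2 tr_g3 tr_g4 tr_gg tr_gg'

lemma tr_skew:
  assumes "\<And>a b. f b a = - f a b"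
  shows "tr x f = 0"
proof -
  have "tr x f = tr x (\<lambda>a b. - f a b)" unfolding assms[symmetric] by (rule tr_flip)
  then show ?thesis by (simp add: tr_minus)
qed

section \<open>Symmetries of the Riemann, Weyl and Cotton tensors\<close>

lemma curv_LC: "curv (mconn g) a b x (Inl i) (Inl j) = - riemann g x a b j i"
  by (simp add: curv_def riemann_def pd_minus_smooth[OF x] smooth_geometry sum_Plus sum_subtractf)
    (simp add: mult.commute)

lemma curv_mixed:
  "curv (mconn g) a b x (Inl i) (Inr B) = 0" "curv (mconn g) a b x (Inr B) (Inl i) = 0"
  by (simp_all add: curv_def sum_Plus)

lemma act_curv_Inl: "act (curv (mconn g) a b x) T (Inl i # As) =
    - (\<Sum>j\<in>UNIV. riemann g x a b j i * T (Inl j # As))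
    + act (curv (mconn g) a b x) (\<lambda>Bs. T (Inl i # Bs)) As"
  by (simp add: sum_Plus curv_LC curv_mixed sum_negf)

text \<open>\<open>\<nabla>g = 0\<close>, so the curvature annihilates \<open>g\<close>.\<close>

lemma riemann_low_skew2: "riemann_low g x a b e c = - riemann_low g x a b c e"
proof -
  define T :: "real^'n \<Rightarrow> ('n + 'n tix) list \<Rightarrow> real" where
    "T = (\<lambda>y As. if map isl As = [True, True] then g y $ projl (As ! 0) $ projl (As ! 1) else 0)"
  have T: "mc.smooth_tensor T"
    unfolding T_def by (intro allI smooth_on_if[OF U] smooth_g smooth_on_const[OF U])
  have T0: "cov (mconn g) a T y [Inl i, Inl j] = 0" if "y \<in> U" for a y i j
    by (simp add: cov_def T_def sum_Plus pd_g[OF that] sum_negf)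
  have zero: "cov (mconn g) a (cov (mconn g) b T) x [Inl c, Inl e] = 0" for a b
  proof -
    have "cov (mconn g) a (cov (mconn g) b T) x [Inl c, Inl e] =
        cov (mconn g) a (\<lambda>_ _. 0) x [Inl c, Inl e]"
    proof (rule cov_cong_kind[OF x])
      fix y and Bs :: "('n + 'n tix) list"
      assume y: "y \<in> U" and k: "map isl Bs = map isl [Inl c :: 'n + 'n tix, Inl e]"
      obtain i j where "Bs = [Inl i, Inl j]" using k by (auto simp: isl_def)
      with T0[OF y] show "cov (mconn g) b T y Bs = 0" by simp
    qed
    also have "\<dots> = 0" by (simp add: cov_def)
    finally show ?thesis .
  qed
  have "act (curv (mconn g) a b x) (T x) [Inl c, Inl e] = 0"
    using mc.cov_commute[OF x T, of a b "[Inl c, Inl e]"] by (simp add: zero)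
  then have "(\<Sum>j\<in>UNIV. riemann g x a b j c * g x $ j $ e) +
      (\<Sum>j\<in>UNIV. riemann g x a b j e * g x $ c $ j) = 0"
    by (simp add: act_curv_Inl T_def del: act.simps(2))
  then show ?thesis
    by (simp add: riemann_low_def g_sym[OF x, of _ e] mult.commute)
qed

lemma riemann_low_skew1: "riemann_low g x b a c e = - riemann_low g x a b c e"
  using riemann_skew[OF x, of b a] by (simp add: riemann_low_def sum_negf)

lemma riemann_low_cyclic:
  "riemann_low g x a b c e + riemann_low g x b e c a + riemann_low g x e a c b = 0"
  using riemann_cyclic[OF x, of a b _ e]
  by (simp add: riemann_low_def sum.distrib[symmetric] distrib_left[symmetric])

text \<open>Four cyclic identities, one for each choice of the fixed index, combined through the two
  skew symmetries.\<close>

lemma riemann_low_pair: "riemann_low g x c e a b = riemann_low g x a b c e"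
proof -
  have "riemann_low g x c a e b = riemann_low g x a c b e"
    "riemann_low g x e b a c = riemann_low g x b e c a"
    using riemann_low_skew1 riemann_low_skew2 by (metis minus_minus)+
  then show ?thesis
    using riemann_low_cyclic[of a b c e] riemann_low_cyclic[of b c e a] riemann_low_cyclic[of c e a b]
      riemann_low_cyclic[of e a b c] riemann_low_skew2[of a b e c] riemann_low_skew2[of b c a e]
      riemann_low_skew2[of c e b a] riemann_low_skew2[of e a b c]
    by linarith
qed

lemma ricci_tr: "ricci g x a b = tr x (\<lambda>c e. riemann_low g x c a e b)"
proof -
  have "(\<Sum>e\<in>UNIV. ginv g x c e * riemann_low g x c a e b) = riemann g x c a c b" for c
    using raise_g[OF x, of c "\<lambda>f. riemann g x c a f b"] by (simp add: riemann_low_def g_sym[OF x])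
  then show ?thesis by (simp add: ricci_def tr_def)
qed

lemma ricci_sym: "ricci g x a b = ricci g x b a"
  unfolding ricci_tr by (subst tr_flip) (simp add: riemann_low_pair)

lemma schouten_sym: "schouten g x a b = schouten g x b a"
  by (simp add: schouten_def ricci_sym[of a b] g_sym[OF x, of a b])

lemma Jsc_tr: "Jsc g x = tr x (\<lambda>a b. schouten g x a b)"
  unfolding tr_def by (intro Jsc_trace_schouten dim g_invertible g_sym x)

lemma weyl_skew1: "weyl g x b a c e = - weyl g x a b c e"
  by (simp add: weyl_def riemann_low_skew1[of a b])

lemma weyl_skew2: "weyl g x a b e c = - weyl g x a b c e"
  by (simp add: weyl_def riemann_low_skew2[of a b e c])

lemma weyl_pair: "weyl g x c e a b = weyl g x a b c e"
  by (simp add: weyl_def riemann_low_pair[of c e] schouten_sym[of c] schouten_sym[of e a]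
     schouten_sym[of e b] g_sym[OF x, of a] g_sym[OF x, of b])

lemma weyl_cyclic: "weyl g x a b c e + weyl g x b e c a + weyl g x e a c b = 0"
  using riemann_low_cyclic[of a b c e]
  by (simp add: weyl_def schouten_sym[of b a] schouten_sym[of e a] schouten_sym[of e b]
    g_sym[OF x, of b a] g_sym[OF x, of e a] g_sym[OF x, of e b] algebra_simps)

text \<open>P is defined so that the trace of the subtracted terms is
  \<open>(d - 2) P + J g\<close>, the Ricci tensor.\<close>

lemma weyl_tr: "tr x (\<lambda>a c. weyl g x a b c e) = 0"
proof -
  have "tr x (\<lambda>a c. weyl g x a b c e) = ricci g x b e - (real CARD('n) * schouten g x b e
      - schouten g x b e + Jsc g x * g x $ e $ b - schouten g x b e)"
    unfolding weyl_def ricci_tr Jsc_tr by (simp add: tr_linear tr_g)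
  also have "\<dots> = 0"
    using ricci_schouten[OF dim, of g x b e] g_sym[OF x, of e b] by (simp add: algebra_simps)
  finally show ?thesis .
qed

lemma cotton_skew: "cotton g x a c b = - cotton g x a b c"
  by (simp add: cotton_def)

lemma nabla_schouten_sym: "nabla_schouten g x c a b = nabla_schouten g x c b a"
proof -
  have "pd c (\<lambda>y. schouten g y a b) x = pd c (\<lambda>y. schouten g y b a) x"
    by (intro pd_cong[OF U x] chart_metric.schouten_sym[OF chart_metric_axioms])
  then show ?thesis
    by (simp add: nabla_schouten_def sum.distrib schouten_sym[of _ b] schouten_sym[of _ a] add.commute)
qed

lemma cotton_cyclic: "cotton g x a b c + cotton g x b c a + cotton g x c a b = 0"
  by (simp add: cotton_def nabla_schouten_sym[of a c b] nabla_schouten_sym[of b c a]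
     nabla_schouten_sym[of c b a])

end

end

section \<open>Curvature of the tractor connection\<close>

text \<open>The inverse of \<open>tractor_metric\<close>. The middle slot of a tractor is a
  covector, so h carries the inverse metric and the inverse of h carries g.\<close>

fun tractor_cometric :: "'n::finite local_metric \<Rightarrow> real^'n \<Rightarrow> 'n tix \<Rightarrow> 'n tix \<Rightarrow> real" where
  "tractor_cometric g x TY TX = 1"
| "tractor_cometric g x TX TY = 1"
| "tractor_cometric g x (TZ a) (TZ b) = g x $ a $ b"
| "tractor_cometric g x _ _ = 0"

context chart_metric
begin

lemma smooth_Omega: "smooth_on U (\<lambda>x. Omega g x a b C E)"
  by (cases C; cases E) (simp_all add: smooth_intros smooth_geometry)

context
  fixes x assumes x: "x \<in> U"
begin

lemma curv_Inr: "curv (mconn g) a b x (Inr A) (Inr B) =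
    pd a (\<lambda>y. tconn g b y A B) x - pd b (\<lambda>y. tconn g a y A B) x
    + (\<Sum>C\<in>UNIV. tconn g a x A C * tconn g b x C B - tconn g b x A C * tconn g a x C B)"
  by (simp add: curv_def sum_Plus)

lemma schouten_raise_swap:
  "(\<Sum>d\<in>UNIV. (\<Sum>h\<in>UNIV. schouten g x a h * ginv g x h d) * v d)
    = (\<Sum>h\<in>UNIV. schouten g x a h * (\<Sum>d\<in>UNIV. ginv g x h d * v d))"
  by (simp add: sum_distrib_left sum_distrib_right mult.assoc) (rule sum.swap)

text \<open>The products of connection entries through \<open>TY\<close> and \<open>TX\<close>
  contribute exactly the terms in g and P by which the Weyl and Riemann tensors differ.\<close>

lemma curv_TZ_TZ: "curv (mconn g) a b x (Inr (TZ c)) (Inr (TZ e)) =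
    (\<Sum>h\<in>UNIV. weyl g x a b c h * ginv g x h e)"
proof -
  let ?P = "schouten g x"
  have P: "(\<Sum>h\<in>UNIV. g x $ h $ b * ginv g x h e) = (if b = e then 1 else 0)" for b
    using g_ginv[OF x, of b e] by (simp add: g_sym[OF x, of b])
  have "riemann_low g x a b c h = - (\<Sum>f\<in>UNIV. g x $ f $ h * riemann g x a b f c)" for h
    by (subst riemann_low_skew2[OF x]) (simp add: riemann_low_def g_sym[OF x, of h])
  then have "(\<Sum>h\<in>UNIV. riemann_low g x a b c h * ginv g x h e) =
      - (\<Sum>h\<in>UNIV. ginv g x e h * (\<Sum>f\<in>UNIV. g x $ f $ h * riemann g x a b f c))"
    by (simp add: sum_negf ginv_sym[OF x, of e] mult.commute)
  then have "(\<Sum>h\<in>UNIV. riemann_low g x a b c h * ginv g x h e) = - riemann g x a b e c"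
    by (simp only: raise_g[OF x])
  then have "(\<Sum>h\<in>UNIV. weyl g x a b c h * ginv g x h e) = - riemann g x a b e c
      - (g x $ c $ a * (\<Sum>h\<in>UNIV. ?P b h * ginv g x h e) -
          g x $ c $ b * (\<Sum>h\<in>UNIV. ?P a h * ginv g x h e)
      + (if b = e then 1 else 0) * ?P a c - (if a = e then 1 else 0) * ?P b c)"
    unfolding P[symmetric]
    by (simp add: weyl_def sum.distrib sum_subtractf sum_distrib_left sum_distrib_right algebra_simps)
  also have "\<dots> = curv (mconn g) a b x (Inr (TZ c)) (Inr (TZ e))"
    by (simp add: curv_Inr sum_tix pd_minus_smooth[OF x] smooth_geometry riemann_def sum_subtractf
        g_sym[OF x, of c] mult.commute)
  finally show ?thesis ..
qed

lemma curv_TZ_TX: "curv (mconn g) a b x (Inr (TZ c)) (Inr TX) = 0"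
  by (simp add: curv_Inr sum_tix pd_g[OF x] sum_subtractf sum_negf christoffel_sym[OF x, of _ b a])

lemma curv_TZ_TY: "curv (mconn g) a b x (Inr (TZ c)) (Inr TY) = cotton g x c a b"
  by (simp add: curv_Inr sum_tix cotton_def nabla_schouten_def sum.distrib sum_subtractf sum_negf
      christoffel_sym[OF x, of _ b a] schouten_sym[OF x, of _ c] mult.commute algebra_simps)

text \<open>The \<open>TX\<close> row contains P with one index raised. The Christoffel terms from
  differentiating \<open>ginv\<close> in fact 1 partly cancel against the products in fact 2 and
  partly complete \<nabla>P in fact 3.\<close>

lemma curv_TX_TZ:
  "curv (mconn g) a b x (Inr TX) (Inr (TZ c)) = - (\<Sum>e\<in>UNIV. cotton g x e a b * ginv g x e c)"
proof -
  let ?P = "schouten g x" and ?G = "ginv g x" and ?\<Gamma> = "christoffel g x"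
  have 1: "pd a (\<lambda>y. - (\<Sum>h\<in>UNIV. schouten g y b h * ginv g y h c)) x =
      - (\<Sum>h\<in>UNIV. pd a (\<lambda>y. schouten g y b h) x * ?G h c)
      + (\<Sum>k\<in>UNIV. (\<Sum>h\<in>UNIV. ?\<Gamma> h a k * ?P b h) * ?G k c)
      + (\<Sum>h\<in>UNIV. ?P b h * (\<Sum>k\<in>UNIV. ?G h k * ?\<Gamma> c a k))" for a b
  proof -
    have "(\<Sum>h\<in>UNIV. ?P b h * (\<Sum>k\<in>UNIV. ?\<Gamma> h a k * ?G k c)) =
        (\<Sum>k\<in>UNIV. (\<Sum>h\<in>UNIV. ?\<Gamma> h a k * ?P b h) * ?G k c)"
      by (simp add: sum_distrib_left sum_distrib_right mult_ac) (rule sum.swap)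
    then show ?thesis
      by (simp add: pd_minus_smooth[OF x] pd_sum_smooth[OF x] pd_mult_smooth[OF x] smooth_intros
          smooth_geometry pd_ginv[OF x] sum.distrib sum_subtractf sum_negf right_diff_distrib mult.commute)
  qed
  have 2: "(\<Sum>C\<in>UNIV. tconn g a x TX C * tconn g b x C (TZ c)) =
      (\<Sum>h\<in>UNIV. ?P a h * (\<Sum>d\<in>UNIV. ?G h d * ?\<Gamma> c b d))" for a b
    by (simp add: sum_tix schouten_raise_swap)
  have 3: "(\<Sum>e\<in>UNIV. cotton g x e a b * ?G e c) =
      (\<Sum>h\<in>UNIV. pd a (\<lambda>y. schouten g y b h) x * ?G h c) - (\<Sum>k\<in>UNIV. (\<Sum>h\<in>UNIV. ?\<Gamma> h a k * ?P b h) * ?G k c)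
     - ((\<Sum>h\<in>UNIV. pd b (\<lambda>y. schouten g y a h) x * ?G h c) -
         (\<Sum>k\<in>UNIV. (\<Sum>h\<in>UNIV. ?\<Gamma> h b k * ?P a h) * ?G k c))"
    by (simp add: cotton_def nabla_schouten_def sum.distrib christoffel_sym[OF x, of _ b a]
        left_diff_distrib distrib_right sum_subtractf)
  show ?thesis
    unfolding curv_Inr tconn.simps 1 3 sum_subtractf 2 by simp
qed

lemma curv_TX_TY: "curv (mconn g) a b x (Inr TX) (Inr TY) = 0"
proof -
  have 2: "(\<Sum>C\<in>UNIV. tconn g a x TX C * tconn g b x C TY) =
      - (\<Sum>h\<in>UNIV. \<Sum>d\<in>UNIV. schouten g x a h * (ginv g x h d * schouten g x b d))" for a b
    by (simp add: sum_tix schouten_raise_swap sum_negf sum_distrib_left)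
  have "(\<Sum>h\<in>UNIV. \<Sum>d\<in>UNIV. schouten g x b h * (ginv g x h d * schouten g x a d)) =
      (\<Sum>d\<in>UNIV. \<Sum>h\<in>UNIV. schouten g x b h * (ginv g x h d * schouten g x a d))"
    by (rule sum.swap)
  then have "(\<Sum>h\<in>UNIV. \<Sum>d\<in>UNIV. schouten g x b h * (ginv g x h d * schouten g x a d)) =
      (\<Sum>h\<in>UNIV. \<Sum>d\<in>UNIV. schouten g x a h * (ginv g x h d * schouten g x b d))"
    by (simp add: ginv_sym[OF x, of _ _] mult_ac)
  then show ?thesis unfolding curv_Inr sum_subtractf 2 by simp
qed

lemma curv_TX_TX: "curv (mconn g) a b x (Inr TX) (Inr TX) = 0"
proof -
  have "(\<Sum>h\<in>UNIV. schouten g x a h * (\<Sum>d\<in>UNIV. ginv g x h d * g x $ b $ d)) =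
      schouten g x a b" for a b
    using ginv_g[OF x] by (simp add: g_sym[OF x, of b] sum_delta_simps)
  then show ?thesis
    by (simp add: curv_Inr sum_tix sum_subtractf sum_negf schouten_raise_swap schouten_sym[OF x, of b a])
qed

lemma curv_TY: "curv (mconn g) a b x (Inr TY) (Inr B) = 0"
proof (cases B)
  case TY
  then show ?thesis
    by (simp add: curv_Inr sum_tix sum_subtractf sum_negf sum_delta_simps schouten_sym[OF x, of b a])
next
  case (TZ c)
  then show ?thesis
    by (simp add: curv_Inr sum_tix sum_subtractf sum_negf sum_delta_simps christoffel_sym[OF x, of c b a])
next
  case TX
  then show ?thesis
    by (simp add: curv_Inr sum_tix sum_subtractf sum_negf sum_delta_simps g_sym[OF x, of b a])
qed

lemma curv_tractor: "curv (mconn g) a b x (Inr A) (Inr B) =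
    (\<Sum>E\<in>UNIV. Omega g x a b A E * tractor_metric g x E B)"
  by (cases A; cases B) (simp_all add: sum_tix curv_TY curv_TZ_TZ curv_TZ_TX curv_TZ_TY curv_TX_TZ
      curv_TX_TY curv_TX_TX sum_negf)

lemma tractor_metric_tractor_cometric:
  "(\<Sum>B\<in>UNIV. tractor_metric g x E B * tractor_cometric g x B D) = (if E = D then 1 else 0)"
  by (cases E; cases D) (simp_all add: sum_tix ginv_g[OF x])

lemma Omega_curv:
  "Omega g x a b A E = (\<Sum>B\<in>UNIV. curv (mconn g) a b x (Inr A) (Inr B) * tractor_cometric g x B E)"
proof -
  have "(\<Sum>B\<in>UNIV. curv (mconn g) a b x (Inr A) (Inr B) * tractor_cometric g x B E) =
      (\<Sum>D\<in>UNIV. Omega g x a b A D * (\<Sum>B\<in>UNIV. tractor_metric g x D B * tractor_cometric g x B E))"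
    by (simp add: curv_tractor sum_distrib_left sum_distrib_right mult.assoc) (rule sum.swap)
  then show ?thesis by (simp add: tractor_metric_tractor_cometric sum_delta_simps)
qed

text \<open>The tractor connection is metric; hence raising the second curvature index commutes with
  \<nabla> in \<open>nabla_Omega_bianchi\<close>.\<close>

lemma pd_tractor_cometric: "pd f (\<lambda>y. tractor_cometric g y D E) x =
    - (\<Sum>G\<in>UNIV. tconn g f x D G * tractor_cometric g x G E) -
        (\<Sum>G\<in>UNIV. tconn g f x E G * tractor_cometric g x D G)"
proof -
  have 1: "(\<Sum>c\<in>UNIV. (\<Sum>b\<in>UNIV. schouten g x f b * ginv g x b c) * g x $ e $ c) = schouten g x f e"
    "(\<Sum>c\<in>UNIV. (\<Sum>b\<in>UNIV. schouten g x f b * ginv g x b c) * g x $ c $ e) = schouten g x f e" for e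
    using ginv_g[OF x] by (simp_all add: schouten_raise_swap g_sym[OF x, of e] sum_delta_simps)
  show ?thesis
    by (cases D; cases E)
      (simp_all add: sum_tix sum_negf sum_delta_simps 1 pd_g[OF x] g_sym[OF x, of _ f])
qed

end

text \<open>
  Tensors are total functions of the list of indices; they are set to zero on lists of the wrong
  length or with the wrong kinds of indices.
\<close>

definition Omega_tensor :: "real^'n \<Rightarrow> ('n + 'n tix) list \<Rightarrow> real" where
  "Omega_tensor x As = (if map isl As = [True, True, False, False]
    then Omega g x (projl (As ! 0)) (projl (As ! 1)) (projr (As ! 2)) (projr (As ! 3)) else 0)"

lemma Omega_tensor_simp [simp]: "Omega_tensor x [Inl a, Inl b, Inr C, Inr E] = Omega g x a b C E"
  by (simp add: Omega_tensor_def)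

lemma smooth_Omega_tensor: "mc.smooth_tensor Omega_tensor"
  unfolding Omega_tensor_def by (intro allI smooth_on_if[OF U] smooth_Omega smooth_on_const[OF U])

definition nabla_Omega :: "real^'n \<Rightarrow> 'n \<Rightarrow> 'n \<Rightarrow> 'n \<Rightarrow> 'n tix \<Rightarrow> 'n tix \<Rightarrow> real" where
  "nabla_Omega x f a b C E = cov (mconn g) f Omega_tensor x [Inl a, Inl b, Inr C, Inr E]"

lemma nabla_Omega_expand: "nabla_Omega x f a b C E = pd f (\<lambda>y. Omega g y a b C E) x
    - (\<Sum>c\<in>UNIV. christoffel g x c f a * Omega g x c b C E) -
        (\<Sum>c\<in>UNIV. christoffel g x c f b * Omega g x a c C E)
    + (\<Sum>G\<in>UNIV. tconn g f x C G * Omega g x a b G E) +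
        (\<Sum>G\<in>UNIV. tconn g f x E G * Omega g x a b C G)"
  by (simp add: nabla_Omega_def cov_def sum_Plus sum_negf)

context
  fixes x assumes x: "x \<in> U"
begin

lemma Omega_skew1: "Omega g x b a C E = - Omega g x a b C E"
  by (cases C; cases E) (simp_all add: weyl_skew1[OF x, of b a] cotton_skew[OF x, of _ b a])

lemma Omega_skew2: "Omega g x a b E C = - Omega g x a b C E"
  by (cases C; cases E) (auto intro: weyl_skew2[OF x])

end

context
  fixes x assumes x: "x \<in> U"
begin

lemma nabla_Omega_skew1: "nabla_Omega x f b a C E = - nabla_Omega x f a b C E"
proof -
  have "pd f (\<lambda>y. Omega g y b a C E) x = pd f (\<lambda>y. - Omega g y a b C E) x"
    by (intro pd_cong[OF U x] Omega_skew1)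
  then show ?thesis
    by (simp add: nabla_Omega_expand pd_minus_smooth[OF x] smooth_Omega Omega_skew1[OF x, of _ a] Omega_skew1[OF x, of b] sum_negf)
qed

lemma nabla_Omega_skew2: "nabla_Omega x f a b E C = - nabla_Omega x f a b C E"
proof -
  have "pd f (\<lambda>y. Omega g y a b E C) x = pd f (\<lambda>y. - Omega g y a b C E) x"
    by (intro pd_cong[OF U x] Omega_skew2)
  then show ?thesis
    by (simp add: nabla_Omega_expand pd_minus_smooth[OF x] smooth_Omega Omega_skew2[OF x, of _ _ E] Omega_skew2[OF x, of _ _ _ C] sum_negf)
qed

text \<open>\<open>curv_bianchi\<close> differentiates the form indices by plain partial
  derivatives. The Christoffel terms that \<nabla> adds for them cancel in the cyclic sum, since
  \<open>christoffel\<close> is symmetric and \<Omega> is skew.\<close>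

lemma nabla_Omega_bianchi:
  "nabla_Omega x f a b C E + nabla_Omega x a b f C E + nabla_Omega x b f a C E = 0"
proof -
  let ?F = "\<lambda>a b A B. curv (mconn g) a b x (Inr A) (Inr B)"
  define D where "D f a b A B = pd f (\<lambda>y. curv (mconn g) a b y A B) x
    + (\<Sum>C\<in>UNIV. mconn g f x A C * curv (mconn g) a b x C B -
        curv (mconn g) a b x A C * mconn g f x C B)" for f a b A B
  have D: "D f a b A B + D a b f A B + D b f a A B = 0" for A B
    unfolding D_def by (rule mc.curv_bianchi[OF x])
  have DI: "D f a b (Inr A) (Inr B) = pd f (\<lambda>y. curv (mconn g) a b y (Inr A) (Inr B)) x
    + (\<Sum>G\<in>UNIV. tconn g f x A G * ?F a b G B) -
        (\<Sum>G\<in>UNIV. ?F a b A G * tconn g f x G B)" for f a b A B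
    by (simp add: D_def sum_Plus sum_subtractf)
  have sh: "smooth_on U (\<lambda>x. tractor_cometric g x A B)" for A B
    by (cases A; cases B) (simp_all add: smooth_intros smooth_geometry)
  have N: "nabla_Omega x f a b C E = (\<Sum>B\<in>UNIV. D f a b (Inr C) (Inr B) * tractor_cometric g x B E)
    - (\<Sum>c\<in>UNIV. christoffel g x c f a * Omega g x c b C E) -
        (\<Sum>c\<in>UNIV. christoffel g x c f b * Omega g x a c C E)" for f a b
  proof -
    have 0: "pd f (\<lambda>y. Omega g y a b C E) x =
        pd f (\<lambda>y. \<Sum>B\<in>UNIV. curv (mconn g) a b y (Inr C) (Inr B) * tractor_cometric g y B E) x"
      by (intro pd_cong[OF U x] Omega_curv)
    have 1: "(\<Sum>G\<in>UNIV. tconn g f x C G * Omega g x a b G E) =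
      (\<Sum>B\<in>UNIV. (\<Sum>G\<in>UNIV. tconn g f x C G * ?F a b G B) * tractor_cometric g x B E)"
      by (simp add: Omega_curv[OF x] sum_distrib_left sum_distrib_right mult.assoc) (rule sum.swap)
    have 2: "(\<Sum>B\<in>UNIV. ?F a b C B * (\<Sum>G\<in>UNIV. tconn g f x B G * tractor_cometric g x G E)) =
      (\<Sum>B\<in>UNIV. (\<Sum>G\<in>UNIV. ?F a b C G * tconn g f x G B) * tractor_cometric g x B E)"
      by (simp add: sum_distrib_left sum_distrib_right mult.assoc) (rule sum.swap)
    have 3: "(\<Sum>B\<in>UNIV. ?F a b C B * (\<Sum>G\<in>UNIV. tconn g f x E G * tractor_cometric g x B G)) =
       (\<Sum>G\<in>UNIV. tconn g f x E G * Omega g x a b C G)"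
      by (simp add: Omega_curv[OF x] sum_distrib_left mult.left_commute) (rule sum.swap)
    show ?thesis
      unfolding nabla_Omega_expand 0 DI 1
      by (simp add: pd_sum_smooth[OF x] pd_mult_smooth[OF x] smooth_intros mc.smooth_curv sh pd_tractor_cometric[OF x]
          sum.distrib sum_subtractf sum_negf distrib_right left_diff_distrib right_diff_distrib 2 3)
  qed
  have "(\<Sum>B\<in>UNIV. D f a b (Inr C) (Inr B) * tractor_cometric g x B E) +
      (\<Sum>B\<in>UNIV. D a b f (Inr C) (Inr B) * tractor_cometric g x B E)
     + (\<Sum>B\<in>UNIV. D b f a (Inr C) (Inr B) * tractor_cometric g x B E) = 0"
    by (simp add: sum.distrib[symmetric] distrib_right[symmetric] D)
  then show ?thesis
    unfolding N[of f a b] N[of a b f] N[of b f a]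
    by (simp add: Omega_skew1[OF x, of _ b] Omega_skew1[OF x, of _ f] Omega_skew1[OF x, of _ a]
      christoffel_sym[OF x, of _ b a] christoffel_sym[OF x, of _ f a]  christoffel_sym[OF x, of _ f b] sum_negf)
qed

end

end

section \<open>Divergence of the tractor curvature\<close>

fun W_X :: "'n::finite local_metric \<Rightarrow> real^'n \<Rightarrow> 'n \<Rightarrow> 'n tix \<Rightarrow> 'n tix \<Rightarrow> real" where
  "W_X g x b (TZ c) (TZ e) = - (real CARD('n) - 4) * cotton g x b c e"
| "W_X g x b TX (TZ e) = bach g x e b"
| "W_X g x b (TZ e) TX = - bach g x e b"
| "W_X g x b _ _ = 0"

context chart_metric
begin

text \<open>The inverse metric extended by zero to the mixed bundle; as a parallel form it makes
  \<open>tr\<close> a contraction to which \<open>cov_contract\<close> applies.\<close>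

definition cometric :: "real^'n \<Rightarrow> 'n + 'n tix \<Rightarrow> 'n + 'n tix \<Rightarrow> real" where
  "cometric x B C = (if isl B \<and> isl C then ginv g x (projl B) (projl C) else 0)"

lemma parallel_cometric: "mc.parallel_form cometric"
  unfolding mc.parallel_form_def
proof (intro conjI allI ballI)
  fix B C show "smooth_on U (\<lambda>x. cometric x B C)"
    unfolding cometric_def by (intro smooth_on_if[OF U] smooth_ginv smooth_on_const[OF U])
next
  fix x a B C assume "x \<in> U"
  then show "pd a (\<lambda>y. cometric y B C) x = (\<Sum>D\<in>UNIV. cometric x D C * mconn g a x D B)
    + (\<Sum>D\<in>UNIV. cometric x B D * mconn g a x D C)"
    by (cases B; cases C) (simp_all add: cometric_def sum_Plus pd_ginv sum_negf mult.commute)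
qed

lemma tr_cov:
  assumes "x \<in> U" "mc.smooth_tensor T"
  shows "tr x (\<lambda>a b. cov (mconn g) f T x (Inl a # Inl b # As)) =
    cov (mconn g) f (\<lambda>y As. tr y (\<lambda>a b. T y (Inl a # Inl b # As))) x As"
  using mc.cov_contract[OF parallel_cometric assms, of f As]
  by (simp add: sum_Plus cometric_def tr_def)

definition nabla_weyl :: "real^'n \<Rightarrow> 'n \<Rightarrow> 'n \<Rightarrow> 'n \<Rightarrow> 'n \<Rightarrow> 'n \<Rightarrow> real" where
  "nabla_weyl x f a b c e = pd f (\<lambda>y. weyl g y a b c e) x - (\<Sum>h\<in>UNIV.
     christoffel g x h f a * weyl g x h b c e + christoffel g x h f b * weyl g x a h c e
     + christoffel g x h f c * weyl g x a b h e + christoffel g x h f e * weyl g x a b c h)"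

context
  fixes x assumes x: "x \<in> U"
begin

lemma nabla_weyl_skew1: "nabla_weyl x f b a c e = - nabla_weyl x f a b c e"
proof -
  have "pd f (\<lambda>y. weyl g y b a c e) x = pd f (\<lambda>y. - weyl g y a b c e) x"
    by (intro pd_cong[OF U x] weyl_skew1)
  then show ?thesis
    by (simp add: nabla_weyl_def pd_minus_smooth[OF x] smooth_geometry weyl_skew1[OF x, of _ a]
      weyl_skew1[OF x, of b] sum.distrib sum_subtractf sum_negf)
qed

lemma nabla_weyl_pair: "nabla_weyl x f c e a b = nabla_weyl x f a b c e"
proof -
  have "pd f (\<lambda>y. weyl g y c e a b) x = pd f (\<lambda>y. weyl g y a b c e) x"
    by (intro pd_cong[OF U x] weyl_pair)
  moreover have "weyl g x h e a b = weyl g x a b h e" "weyl g x c h a b = weyl g x a b c h"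
     "weyl g x c e h b = weyl g x h b c e" "weyl g x c e a h = weyl g x a h c e" for h
    by (rule weyl_pair[OF x])+
  ultimately show ?thesis by (simp add: nabla_weyl_def sum.distrib)
qed

lemma nabla_weyl_skew2: "nabla_weyl x f a b e c = - nabla_weyl x f a b c e"
  using nabla_weyl_pair nabla_weyl_skew1 by metis

lemma nabla_weyl_tr: "tr x (\<lambda>a c. nabla_weyl x f a b c e) = 0"
proof -
  \<comment> \<open>The second and third slots are exchanged, because \<open>tr_cov\<close>
    contracts the first two.\<close>
  define T :: "real^'n \<Rightarrow> ('n + 'n tix) list \<Rightarrow> real" where
    "T = (\<lambda>y As. if map isl As = [True, True, True, True]
      then weyl g y (projl (As ! 0)) (projl (As ! 2)) (projl (As ! 1)) (projl (As ! 3)) else 0)"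
  have T: "mc.smooth_tensor T"
    unfolding T_def by (intro allI smooth_on_if[OF U] smooth_weyl smooth_on_const[OF U])
  have "nabla_weyl x f a b c e = cov (mconn g) f T x [Inl a, Inl c, Inl b, Inl e]" for a c
    by (simp add: cov_def nabla_weyl_def T_def sum_Plus sum.distrib sum_negf)
  then have "tr x (\<lambda>a c. nabla_weyl x f a b c e) =
      cov (mconn g) f (\<lambda>y As. tr y (\<lambda>a b. T y (Inl a # Inl b # As))) x [Inl b, Inl e]"
    using tr_cov[OF x T, of f "[Inl b, Inl e]"] by simp
  also have "\<dots> = cov (mconn g) f (\<lambda>y As. 0) x [Inl b, Inl e]"
  proof (rule cov_cong_kind[OF x])
    fix y and Bs :: "('n + 'n tix) list"
    assume y: "y \<in> U" and k: "map isl Bs = map isl [Inl b :: 'n + 'n tix, Inl e]"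
    obtain i j where "Bs = [Inl i, Inl j]" using k by (auto simp: isl_def)
    then show "tr y (\<lambda>a b. T y (Inl a # Inl b # Bs)) = 0" by (simp add: T_def weyl_tr[OF y])
  qed
  also have "\<dots> = 0" by (simp add: cov_def)
  finally show ?thesis .
qed

lemma nabla_weyl_tr_skew:
  "tr x (\<lambda>b c. nabla_weyl x f a b c e) = 0" "tr x (\<lambda>a e. nabla_weyl x f a b c e) = 0"
  using nabla_weyl_tr[of f a e] nabla_weyl_tr[of f b c]
  by (simp_all add: nabla_weyl_skew1[of f a] nabla_weyl_skew2[of f _ b c] tr_minus)

lemma nabla_Omega_TZ_TZ: "nabla_Omega x f a b (TZ c) (TZ e) =
    nabla_weyl x f a b c e - g x $ f $ c * cotton g x e a b + g x $ f $ e * cotton g x c a b"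
  by (simp add: nabla_Omega_expand nabla_weyl_def sum_tix sum.distrib sum_negf)

definition cotton_tr :: "'n \<Rightarrow> real" where "cotton_tr b = tr x (\<lambda>c f. cotton g x c b f)"

text \<open>The ZZ component of the Bianchi identity, traced over f and c. Only the first Weyl
  derivative survives; the Cotton coefficient is -d + 1 + 1 + 1.\<close>

lemma div_weyl_aux: "tr x (\<lambda>f c. nabla_weyl x f a b c e) + (3 - real CARD('n)) * cotton g x e a b
    + g x $ a $ e * cotton_tr b - g x $ b $ e * cotton_tr a = 0"
proof -
  have "tr x (\<lambda>f c. nabla_Omega x f a b (TZ c) (TZ e) + nabla_Omega x a b f (TZ c) (TZ e) +
      nabla_Omega x b f a (TZ c) (TZ e)) = 0"
    unfolding nabla_Omega_bianchi[OF x] by (simp add: tr_zero)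
  moreover have "tr x (\<lambda>f c. cotton g x c b f) = cotton_tr b" for b
    unfolding cotton_tr_def by (subst tr_flip[OF x]) simp
  moreover have "tr x (\<lambda>f c. cotton g x c f a) = - cotton_tr a"
    using calculation(2)[of a] by (simp add: cotton_skew[OF x, of _ _ a] tr_minus)
  moreover have "cotton g x e b a = - cotton g x e a b" by (rule cotton_skew[OF x])
  ultimately show ?thesis
    using nabla_weyl_tr[of b f e for f]
    by (simp add: nabla_Omega_TZ_TZ tr_linear tr_g[OF x] nabla_weyl_tr_skew nabla_weyl_tr) (simp add: algebra_simps)
qed

text \<open>After a second trace, over a and e, all Weyl terms vanish and 2d-4 times the trace of
  Cotton is left. This is the contracted Bianchi identity
  \<open>\<nabla>^a P_ab = \<nabla>_b J\<close>.\<close>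

lemma cotton_tr_zero: "cotton_tr b = 0"
proof -
  let ?d = "real CARD('n)"
  have 0: "tr x (\<lambda>a e. tr x (\<lambda>f c. nabla_weyl x f a b c e)) = 0"
    by (subst tr_swap) (simp add: nabla_weyl_tr_skew tr_zero)
  have 1: "tr x (\<lambda>a e. cotton g x e a b) = - cotton_tr b"
    unfolding cotton_tr_def by (subst tr_flip[OF x]) (simp add: cotton_skew[OF x, of _ b] tr_minus)
  have "tr x (\<lambda>a e. tr x (\<lambda>f c. nabla_weyl x f a b c e) + (3 - ?d) * cotton g x e a b
    + g x $ a $ e * cotton_tr b - g x $ b $ e * cotton_tr a) = 0"
    unfolding div_weyl_aux by (rule tr_zero)
  then have "(2 * ?d - 4) * cotton_tr b = 0"
    by (simp add: tr_linear tr_g[OF x] 0 1) (auto simp: algebra_simps)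
  moreover have "2 * ?d - 4 \<noteq> 0" using dim by simp
  ultimately show ?thesis by simp
qed

lemma div_weyl: "tr x (\<lambda>f c. nabla_weyl x f a b c e) = (real CARD('n) - 3) * cotton g x e a b"
  using div_weyl_aux[of a b e] by (simp add: cotton_tr_zero algebra_simps)

text \<open>The derivative of the \<open>TX\<close> entry gives the divergence of Cotton, and the
  \<open>TX\<close> row of the connection gives P contracted with Weyl; together they form the
  definition of Bach.\<close>

lemma div_cotton_eq_bach: "tr x (\<lambda>f a. nabla_Omega x f a b TX (TZ e)) = - bach g x e b"
proof -
  let ?P = "schouten g x" and ?G = "ginv g x"
  have "nabla_Omega x f a b TX (TZ e) = - nabla_cotton g x f e a b
      - (\<Sum>c\<in>UNIV. (\<Sum>h\<in>UNIV. ?P f h * ?G h c) * weyl g x a b c e)" for f a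
    by (simp add: nabla_Omega_expand nabla_cotton_def sum_tix pd_minus_smooth[OF x] smooth_geometry sum.distrib sum_negf)
  then have "tr x (\<lambda>f a. nabla_Omega x f a b TX (TZ e)) = - tr x (\<lambda>f a. nabla_cotton g x f e a b)
      - tr x (\<lambda>f a. \<Sum>c\<in>UNIV. (\<Sum>h\<in>UNIV. ?P f h * ?G h c) * weyl g x a b c e)"
    by (simp add: tr_linear)
  moreover have "tr x (\<lambda>f a. nabla_cotton g x f e a b) =
      (\<Sum>c\<in>UNIV. \<Sum>h\<in>UNIV. ?G c h * nabla_cotton g x h e c b)"
    by (subst tr_flip[OF x]) (simp add: tr_def)
  moreover have "tr x (\<lambda>f a. \<Sum>c\<in>UNIV. (\<Sum>h\<in>UNIV. ?P f h * ?G h c) * weyl g x a b c e)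
    = (\<Sum>p\<in>UNIV. \<Sum>c\<in>UNIV. (\<Sum>i\<in>UNIV. \<Sum>j\<in>UNIV. ?G p i * ?G c j * ?P i j) * weyl g x p e c b)"
  proof -
    have w: "weyl g x a b c e = weyl g x c e a b" for a c by (rule weyl_pair[OF x])
    have "tr x (\<lambda>f a. \<Sum>c\<in>UNIV. (\<Sum>h\<in>UNIV. ?P f h * ?G h c) * weyl g x a b c e) =
      (\<Sum>f\<in>UNIV. \<Sum>a\<in>UNIV. \<Sum>c\<in>UNIV. \<Sum>h\<in>UNIV. ?G f a * (?P f h * ?G h c * weyl g x c e a b))"
      by (simp add: tr_def sum_distrib_left sum_distrib_right w)
    also have "\<dots> =
        (\<Sum>a\<in>UNIV. \<Sum>c\<in>UNIV. \<Sum>f\<in>UNIV. \<Sum>h\<in>UNIV. ?G f a * (?P f h * ?G h c * weyl g x c e a b))"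
      by (subst sum.swap) (intro sum.cong refl sum.swap)
    also have "\<dots> =
        (\<Sum>c\<in>UNIV. \<Sum>a\<in>UNIV. \<Sum>h\<in>UNIV. \<Sum>f\<in>UNIV. ?G f a * (?P f h * ?G h c * weyl g x c e a b))"
      by (subst sum.swap) (intro sum.cong refl sum.swap)
    also have "\<dots> =
        (\<Sum>c\<in>UNIV. \<Sum>a\<in>UNIV. \<Sum>h\<in>UNIV. \<Sum>f\<in>UNIV. ?G c h * ?G a f * ?P h f * weyl g x c e a b)"
      by (intro sum.cong refl) (simp add: ginv_sym[OF x, of _ _] schouten_sym[OF x, of _ _])
    finally show ?thesis by (simp add: sum_distrib_right)
  qed
  ultimately show ?thesis by (simp add: bach_def)
qed

lemma W_X_skew: "W_X g x b E C = - W_X g x b C E"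
proof (cases "\<exists>c e. C = TZ c \<and> E = TZ e")
  case True
  then obtain c e where "C = TZ c" "E = TZ e" by blast
  then show ?thesis using cotton_skew[OF x, of b e c] by simp
qed (cases C; cases E; auto)

text \<open>In the ZZ block the divergence of Weyl has the factor d-3, and the two Cotton terms of
  the connection combine by the cyclic identity to minus one Cotton tensor: this is the origin of
  the d-4 in W. The Y entries are traces of Weyl and Cotton.\<close>

lemma nabla_Omega_div: "tr x (\<lambda>f a. nabla_Omega x f a b C E) = - W_X g x b C E"
proof -
  have skew: "tr x (\<lambda>f a. nabla_Omega x f a b E C) = - tr x (\<lambda>f a. nabla_Omega x f a b C E)" for C E
    unfolding tr_minus[symmetric] by (simp add: nabla_Omega_skew2[OF x, of _ _ _ E C])
  have diag: "tr x (\<lambda>f a. nabla_Omega x f a b C C) = 0" for C using skew[of C C] by simp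
  have ZZ: "tr x (\<lambda>f a. nabla_Omega x f a b (TZ c) (TZ e)) = - W_X g x b (TZ c) (TZ e)" for c e
  proof -
    have "tr x (\<lambda>f a. nabla_weyl x f a b c e) = (real CARD('n) - 3) * cotton g x b c e"
      using div_weyl[of c e b] by (simp add: nabla_weyl_pair[of _ c e])
    then show ?thesis
      using cotton_cyclic[OF x, of b c e] cotton_skew[OF x, of e c b]
      by (simp add: nabla_Omega_TZ_TZ tr_linear tr_g[OF x]) (simp add: algebra_simps)
  qed
  have YZ: "tr x (\<lambda>f a. nabla_Omega x f a b TY (TZ e)) = 0" for e
  proof -
    have "nabla_Omega x f a b TY (TZ e) = - weyl g x a b f e" for f a
      by (simp add: nabla_Omega_expand sum_tix sum_negf sum_delta_simps)
    then show ?thesis by (simp add: tr_minus) (subst tr_flip[OF x], rule weyl_tr[OF x])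
  qed
  have YX: "tr x (\<lambda>f a. nabla_Omega x f a b TY TX) = 0"
  proof -
    have "nabla_Omega x f a b TY TX = - cotton g x f a b" for f a
      by (simp add: nabla_Omega_expand sum_tix sum_negf sum_delta_simps)
    also have "- cotton g x f a b = cotton g x f b a" for f a
      using cotton_skew[OF x, of f a b] by simp
    finally show ?thesis using cotton_tr_zero[of b] by (simp add: cotton_tr_def)
  qed
  show ?thesis
    using ZZ YZ YX diag div_cotton_eq_bach skew[of "TZ _" TY] skew[of TX TY] skew[of "TZ _" TX]
    by (cases C; cases E) simp_all
qed

end

lemma tractor_metric_sym: "x \<in> U \<Longrightarrow> tractor_metric g x A B = tractor_metric g x B A"
  using ginv_sym by (cases A; cases B) auto

lemma smooth_tractor_metric: "smooth_on U (\<lambda>x. tractor_metric g x A B)"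
  by (cases A; cases B) (simp_all add: smooth_intros smooth_geometry)

section \<open>Components of the \<open>W\<close>-tractor\<close>

text \<open>For each first pair, W is d-4 times \<Omega>, plus or minus \<open>W_X\<close>, or zero,
  whatever C and E are; the halves in \<open>XZskew\<close> cancel the outer factors 2 and 4. Later
  computations can thus treat C and E as passive tractor indices.\<close>

lemma W_comp_simps:
  fixes a b :: 'n
  shows "W_comp g x (TZ a) (TZ b) C E = (real CARD('n) - 4) * Omega g x a b C E"
    "W_comp g x TX (TZ b) C E = W_X g x b C E"
    "W_comp g x (TZ b) TX C E = - W_X g x b C E"
    "W_comp g x TX TX C E = 0"
    "W_comp g x TY B C E = 0" "W_comp g x A TY C E = 0"
proof -
  have d: "(if A then p else 0) * (y::real) = (if A then p * y else 0)"
    "y * (if A then p else 0) = (if A then y * p else 0)" for A p y by auto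
  note defs = W_comp_def Xtr_def Ztr_def XZskew_def d if_distrib[of "\<lambda>y. y / 2"]
  show "W_comp g x (TZ a) (TZ b) C E = (real CARD('n) - 4) * Omega g x a b C E"
    by (cases C; cases E) (simp_all add: defs sum_negf cong: if_cong)
  show "W_comp g x TX (TZ b) C E = W_X g x b C E"
    by (cases C; cases E) (simp_all add: defs sum_negf cong: if_cong, simp_all add: algebra_simps)
  show "W_comp g x (TZ b) TX C E = - W_X g x b C E"
    by (cases C; cases E) (simp_all add: defs sum_negf cong: if_cong, simp_all add: algebra_simps)
qed (simp_all add: W_comp_def Xtr_def Ztr_def XZskew_def)

end

section \<open>The \<open>W\<close>-tractor in the presence of a parallel tractor\<close>

locale parallel_chart = chart_metric U g for U :: "(real^'n::finite) set" and g :: "'n local_metric" +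
  fixes I :: "real^'n \<Rightarrow> 'n tix \<Rightarrow> real"
  assumes smooth_I: "\<And>A. smooth_on U (\<lambda>x. I x A)"
    and parallel_I: "\<And>x a A. x \<in> U \<Longrightarrow> pd a (\<lambda>y. I y A) x + tractor_conn g x a (I x) A = 0"
    and sigma_nz: "\<And>x. x \<in> U \<Longrightarrow> I x TY \<noteq> 0"
    and dim_neq_4: "CARD('n) \<noteq> 4"
begin

definition I_low :: "real^'n \<Rightarrow> 'n tix \<Rightarrow> real" where
  "I_low x A = (\<Sum>B\<in>UNIV. tractor_metric g x A B * I x B)"

text \<open>As h pairs X with Y, in a contraction with I the function \<sigma> multiplies the
  \<open>TX\<close> entry, which for \<sigma> \<noteq> 0 is thereby determined by the other
  entries.\<close>

lemma I_low_simps: "I_low x TY = I x TX" "I_low x TX = I x TY"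
    "I_low x (TZ a) = (\<Sum>b\<in>UNIV. ginv g x a b * I x (TZ b))"
  by (simp_all add: I_low_def sum_tix)

definition tractor_form :: "real^'n \<Rightarrow> 'n + 'n tix \<Rightarrow> 'n + 'n tix \<Rightarrow> real" where
  "tractor_form x B C = (if \<not> isl B \<and> \<not> isl C then tractor_metric g x (projr B) (projr C) else 0)"

lemma parallel_tractor_form: "mc.parallel_form tractor_form"
  unfolding mc.parallel_form_def
proof (intro conjI allI ballI)
  fix B C show "smooth_on U (\<lambda>x. tractor_form x B C)"
    unfolding tractor_form_def by (intro smooth_on_if[OF U] smooth_tractor_metric smooth_on_const[OF U])
next
  fix x a and B C :: "'n + 'n tix" assume x: "x \<in> U"
  have 1: "(\<Sum>c\<in>UNIV. ginv g x b c * g x $ a $ c) = (if a = b then 1 else 0)"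
    "(\<Sum>c\<in>UNIV. ginv g x c b * g x $ a $ c) = (if a = b then 1 else 0)" for a b
    using ginv_g[OF x, of b a] by (auto simp: g_sym[OF x, of a] ginv_sym[OF x, of _ b])
  show "pd a (\<lambda>y. tractor_form y B C) x = (\<Sum>D\<in>UNIV. tractor_form x D C * mconn g a x D B)
    + (\<Sum>D\<in>UNIV. tractor_form x B D * mconn g a x D C)"
  proof (cases "\<exists>A E. B = Inr A \<and> C = Inr E")
    case True
    then obtain A E where BC: "B = Inr A" "C = Inr E" by blast
    show ?thesis unfolding BC
      by (cases A; cases E) (simp_all add: tractor_form_def sum_Plus sum_tix pd_ginv[OF x] sum_negf 1
        ginv_sym[OF x, of _ b for b] mult.commute)
  next
    case False
    then show ?thesis by (cases B; cases C) (auto simp: tractor_form_def sum_Plus)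
  qed
qed

definition I_mixed :: "real^'n \<Rightarrow> 'n + 'n tix \<Rightarrow> real" where
  "I_mixed x B = (if isl B then 0 else I x (projr B))"

lemma smooth_I_mixed: "smooth_on U (\<lambda>x. I_mixed x B)"
  unfolding I_mixed_def by (intro smooth_on_if[OF U] smooth_I smooth_on_const[OF U])

lemma smooth_sec_I_mixed: "mc.smooth_tensor (mc.sec I_mixed)"
proof
  fix As show "smooth_on U (\<lambda>x. mc.sec I_mixed x As)"
    by (cases As; cases "tl As") (simp_all add: mc.sec_def smooth_I_mixed smooth_on_const[OF U])
qed

lemma cov_I_mixed: "x \<in> U \<Longrightarrow> cov (mconn g) a (mc.sec I_mixed) x [Inr A] = 0"
  using parallel_I[of x a A] by (simp add: cov_def mc.sec_def sum_Plus I_mixed_def tractor_conn_eq_tconn)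

lemma contract_eq_I_low:
  "(\<Sum>B\<in>UNIV. \<Sum>C\<in>UNIV. tractor_form x B C * (I_mixed x B * T C)) =
      (\<Sum>C\<in>UNIV. I_low x C * T (Inr C))" if "x \<in> U"
proof -
  have "(\<Sum>B\<in>UNIV. \<Sum>C\<in>UNIV. tractor_form x B C * (I_mixed x B * T C)) =
    (\<Sum>B\<in>UNIV. \<Sum>C\<in>UNIV. tractor_metric g x C B * I x B * T (Inr C))"
    by (simp add: sum_Plus tractor_form_def I_mixed_def tractor_metric_sym[OF that, of B for B] mult.assoc)
  also have "\<dots> = (\<Sum>C\<in>UNIV. I_low x C * T (Inr C))"
    by (subst sum.swap) (simp add: I_low_def sum_distrib_right)
  finally show ?thesis .
qed

text \<open>As h and I are parallel, only the Leibniz term on T remains. The contracted slot has to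
  come first, which is why later proofs introduce permuted copies of a tensor.\<close>

lemma cov_contract_I:
  assumes x: "x \<in> U" and T: "mc.smooth_tensor T"
  shows "(\<Sum>C\<in>UNIV. I_low x C * cov (mconn g) f T x (Inr C # As)) =
    cov (mconn g) f (\<lambda>y As. \<Sum>C\<in>UNIV. I_low y C * T y (Inr C # As)) x As"
proof -
  have "cov (mconn g) f (\<lambda>y As. \<Sum>C\<in>UNIV. I_low y C * T y (Inr C # As)) x As =
    cov (mconn g) f (\<lambda>y As. \<Sum>B\<in>UNIV. \<Sum>C\<in>UNIV. tractor_form y B C * (I_mixed y B * T y (C # As))) x As"
    by (rule mc.cov_cong[OF x]) (simp add: contract_eq_I_low)
  also have "\<dots> = (\<Sum>B\<in>UNIV. \<Sum>C\<in>UNIV. tractor_form x B C *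
        (cov (mconn g) f (mc.sec I_mixed) x [B] * T x (C # As) + I_mixed x B * cov (mconn g) f T x (C # As)))"
    by (rule mc.cov_contract_sec[OF parallel_tractor_form x T smooth_I_mixed])
  also have "\<dots> =
      (\<Sum>B\<in>UNIV. \<Sum>C\<in>UNIV. tractor_form x B C * (I_mixed x B * cov (mconn g) f T x (C # As)))"
    by (simp add: sum_Plus tractor_form_def cov_I_mixed[OF x])
  finally show ?thesis by (simp add: contract_eq_I_low[OF x])
qed

text \<open>The commutator of covariant derivatives of the parallel section I is zero, and it is the
  curvature acting on I.\<close>

lemma Omega_I: assumes x: "x \<in> U" shows "(\<Sum>E\<in>UNIV. I_low x E * Omega g x a b C E) = 0"
proof -
  have "cov (mconn g) a (cov (mconn g) b (mc.sec I_mixed)) x [Inr C] = 0" for a b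
  proof -
    have "cov (mconn g) a (cov (mconn g) b (mc.sec I_mixed)) x [Inr C] =
        cov (mconn g) a (\<lambda>_ _. 0) x [Inr C]"
    proof (rule cov_cong_kind[OF x])
      fix y and Bs :: "('n + 'n tix) list"
      assume y: "y \<in> U" and k: "map isl Bs = map isl [Inr C :: 'n + 'n tix]"
      obtain i where "Bs = [Inr i]" using k by (auto simp: isl_def map_eq_Cons_conv) (metis sum.exhaust)
      then show "cov (mconn g) b (mc.sec I_mixed) y Bs = 0" by (simp add: cov_I_mixed[OF y])
    qed
    also have "\<dots> = 0" by (simp add: cov_def)
    finally show ?thesis .
  qed
  then have "act (curv (mconn g) a b x) (mc.sec I_mixed x) [Inr C] = 0"
    using mc.cov_commute[OF x smooth_sec_I_mixed, of a b "[Inr C]"] by simp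
  then have "(\<Sum>B\<in>UNIV. (\<Sum>E\<in>UNIV. Omega g x a b C E * tractor_metric g x E B) * I x B) = 0"
    by (simp add: sum_Plus curv_mixed[OF x] mc.sec_def I_mixed_def curv_tractor[OF x])
  also have "(\<Sum>B\<in>UNIV. (\<Sum>E\<in>UNIV. Omega g x a b C E * tractor_metric g x E B) * I x B)
      = (\<Sum>E\<in>UNIV. I_low x E * Omega g x a b C E)"
    by (simp add: I_low_def sum_distrib_left sum_distrib_right mult_ac) (rule sum.swap)
  finally show ?thesis .
qed

lemma Omega_I': assumes x: "x \<in> U" shows "(\<Sum>C\<in>UNIV. I_low x C * Omega g x a b C E) = 0"
  using Omega_I[OF x, of a b E] by (simp add: Omega_skew2[OF x, of a b _ E] sum_negf)

lemma nabla_Omega_I: assumes x: "x \<in> U" shows "(\<Sum>C\<in>UNIV. I_low x C * nabla_Omega x f a b C E) = 0"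
proof -
  define T :: "real^'n \<Rightarrow> ('n + 'n tix) list \<Rightarrow> real" where
    "T = (\<lambda>y As. if map isl As = [False, True, True, False]
      then Omega g y (projl (As ! 1)) (projl (As ! 2)) (projr (As ! 0)) (projr (As ! 3)) else 0)"
  have T: "mc.smooth_tensor T"
    unfolding T_def by (intro allI smooth_on_if[OF U] smooth_Omega smooth_on_const[OF U])
  have "nabla_Omega x f a b C E = cov (mconn g) f T x [Inr C, Inl a, Inl b, Inr E]" for C
    by (simp add: cov_def nabla_Omega_expand T_def sum_Plus sum_negf)
  then have "(\<Sum>C\<in>UNIV. I_low x C * nabla_Omega x f a b C E) =
      cov (mconn g) f (\<lambda>y As. \<Sum>C\<in>UNIV. I_low y C * T y (Inr C # As)) x [Inl a, Inl b, Inr E]"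
    using cov_contract_I[OF x T, of f "[Inl a, Inl b, Inr E]"] by simp
  also have "\<dots> = cov (mconn g) f (\<lambda>_ _. 0) x [Inl a, Inl b, Inr E]"
  proof (rule cov_cong_kind[OF x])
    fix y and Bs :: "('n + 'n tix) list"
    assume y: "y \<in> U" and k: "map isl Bs = map isl [Inl a, Inl b, Inr E]"
    then show "(\<Sum>C\<in>UNIV. I_low y C * T y (Inr C # Bs)) = 0"
      using Omega_I'[OF y] by (simp add: T_def)
  qed
  also have "\<dots> = 0" by (simp add: cov_def)
  finally show ?thesis .
qed

lemma W_X_I: assumes x: "x \<in> U" shows "(\<Sum>C\<in>UNIV. I_low x C * W_X g x b C E) = 0"
proof -
  have "(\<Sum>C\<in>UNIV. I_low x C * W_X g x b C E) =
      - tr x (\<lambda>f a. \<Sum>C\<in>UNIV. I_low x C * nabla_Omega x f a b C E)"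
    by (simp add: tr_sum tr_linear nabla_Omega_div[OF x] sum_negf)
  then show ?thesis by (simp add: nabla_Omega_I[OF x] tr_zero)
qed

text \<open>\<open>I\<^sup>AW\<^sub>A\<^sub>b\<^sub>C\<^sub>E = 0\<close>; for tensorial \<open>CE\<close> this is \<open>\<sigma>A = C\<mu>\<close>, the rest follows since both terms are
  annihilated by \<open>I\<^sup>C\<close> and \<open>\<sigma> \<noteq> 0\<close>.\<close>

lemma W_I_aux: assumes x: "x \<in> U"
  shows "I x TY * W_X g x b C E +
      (real CARD('n) - 4) * (\<Sum>a\<in>UNIV. I_low x (TZ a) * Omega g x a b C E) = 0"
proof -
  define L where "L C E = I x TY * W_X g x b C E + (real CARD('n) - 4) * (\<Sum>a\<in>UNIV. I_low x (TZ a) * Omega g x a b C E)" for C E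
  have skew: "L E C = - L C E" for C E
    by (simp add: L_def W_X_skew[OF x, of b E C] Omega_skew2[OF x, of _ b E C] sum_negf)
  have Y: "L TY E = 0" for E by (simp add: L_def)
  have ZZ: "L (TZ c) (TZ e) = 0" for c e
  proof -
    have w: "weyl g x a b c e = - weyl g x c e b a" for a
      using weyl_pair[OF x, of c e a b] weyl_skew2[OF x, of c e a b] by simp
    have "(\<Sum>a\<in>UNIV. I_low x (TZ a) * weyl g x c e b a) + I x TY * cotton g x b c e = 0"
      using Omega_I[OF x, of c e "TZ b"] by (simp add: sum_tix I_low_simps)
    moreover have "L (TZ c) (TZ e) =
        - (real CARD('n) - 4) * ((\<Sum>a\<in>UNIV. I_low x (TZ a) * weyl g x c e b a) + I x TY * cotton g x b c e)"
      by (simp add: L_def w sum_negf algebra_simps)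
    ultimately show ?thesis by simp
  qed
  have "(\<Sum>C\<in>UNIV. I_low x C * L C E) = I x TY * (\<Sum>C\<in>UNIV. I_low x C * W_X g x b C E)
      + (real CARD('n) -
          4) * (\<Sum>a\<in>UNIV. I_low x (TZ a) * (\<Sum>C\<in>UNIV. I_low x C * Omega g x a b C E))" for E
  proof -
    have "(\<Sum>C\<in>UNIV. \<Sum>a\<in>UNIV. I_low x C * ((real CARD('n) -
        4) * (I_low x (TZ a) * Omega g x a b C E))) =
       (\<Sum>a\<in>UNIV. \<Sum>C\<in>UNIV. I_low x C * ((real CARD('n) - 4) * (I_low x (TZ a) * Omega g x a b C E)))"
      by (rule sum.swap)
    then show ?thesis
      by (simp add: L_def distrib_left sum.distrib sum_distrib_left mult.left_commute)
  qed
  then have S: "(\<Sum>C\<in>UNIV. I_low x C * L C E) = 0" for E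
    by (simp add: W_X_I[OF x] Omega_I'[OF x])
  have X: "I x TY * L TX (TZ e) = 0" for e
    using S[of "TZ e"] by (simp add: sum_tix Y ZZ I_low_simps)
  have XZ: "L TX (TZ e) = 0" for e using X[of e] sigma_nz[OF x] by simp
  have "L C E = 0"
    using Y ZZ XZ skew[of TY] skew[of "TZ _" TX] skew[of TX TX] skew[of "TZ _" TY]
    by (cases C; cases E) simp_all
  then show ?thesis by (simp add: L_def)
qed

text \<open>Since \<Omega> is skew, its double contraction with \<mu> vanishes, so
  \<open>W_I_aux\<close> contracted with \<mu> leaves \<sigma> times the claim.\<close>

lemma mu_W_X: assumes x: "x \<in> U" shows "(\<Sum>b\<in>UNIV. I_low x (TZ b) * W_X g x b C E) = 0"
proof -
  let ?S = "\<Sum>b\<in>UNIV. \<Sum>a\<in>UNIV. I_low x (TZ b) * (I_low x (TZ a) * Omega g x a b C E)"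
  have "?S = (\<Sum>a\<in>UNIV. \<Sum>b\<in>UNIV. I_low x (TZ b) * (I_low x (TZ a) * Omega g x a b C E))"
    by (rule sum.swap)
  also have "\<dots> = (\<Sum>a\<in>UNIV. \<Sum>b\<in>UNIV. - (I_low x (TZ a) * (I_low x (TZ b) * Omega g x b a C E)))"
  proof (intro sum.cong refl)
    fix a b
    show "I_low x (TZ b) * (I_low x (TZ a) * Omega g x a b C E) =
        - (I_low x (TZ a) * (I_low x (TZ b) * Omega g x b a C E))"
      using Omega_skew1[OF x, of b a C E] by simp
  qed
  finally have S: "?S = 0" by (simp add: sum_negf)
  have "I x TY * (\<Sum>b\<in>UNIV. I_low x (TZ b) * W_X g x b C E) =
     (\<Sum>b\<in>UNIV. I_low x (TZ b) * (I x TY * W_X g x b C E + (real CARD('n) - 4) * (\<Sum>a\<in>UNIV. I_low x (TZ a) * Omega g x a b C E)))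
      - (real CARD('n) - 4) * ?S"
    by (simp add: distrib_left sum.distrib sum_distrib_left mult.left_commute)
  also have "\<dots> = 0" by (simp add: W_I_aux[OF x] S)
  finally show ?thesis using sigma_nz[OF x] by simp
qed

lemma W_I: assumes x: "x \<in> U" shows "(\<Sum>A\<in>UNIV. I_low x A * W_comp g x A B C E) = 0"
proof (cases B)
  case (TZ b)
  have "(\<Sum>A\<in>UNIV. I_low x A * W_comp g x A B C E) =
    I x TY * W_X g x b C E + (real CARD('n) - 4) * (\<Sum>a\<in>UNIV. I_low x (TZ a) * Omega g x a b C E)"
    unfolding TZ by (simp only: sum_tix W_comp_simps) (simp add: I_low_simps sum_distrib_left mult.left_commute)
  then show ?thesis by (simp add: W_I_aux[OF x])
qed (simp_all add: sum_tix W_comp_simps sum_negf mu_W_X[OF x])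

end

section \<open>Second derivatives\<close>

context chart_metric
begin

text \<open>Makes the direction a tensor slot, so that the next \<open>cov\<close> supplies the
  Christoffel term of a second covariant derivative.\<close>

definition grad :: "(real^'n \<Rightarrow> ('n + 'n tix) list \<Rightarrow> real) \<Rightarrow> real^'n \<Rightarrow> ('n + 'n tix) list \<Rightarrow> real" where
  "grad T x As = (case As of Inl f # Bs \<Rightarrow> cov (mconn g) f T x Bs | _ \<Rightarrow> 0)"

lemma grad_simp [simp]: "grad T x (Inl f # Bs) = cov (mconn g) f T x Bs"
  by (simp add: grad_def)

lemma smooth_grad: assumes "mc.smooth_tensor T" shows "mc.smooth_tensor (grad T)"
proof
  fix As show "smooth_on U (\<lambda>x. grad T x As)"
    by (cases As; cases "hd As") (use mc.smooth_cov[OF assms] in \<open>simp_all add: grad_def smooth_on_const[OF U]\<close>)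
qed

definition W_X_tensor :: "real^'n \<Rightarrow> ('n + 'n tix) list \<Rightarrow> real" where
  "W_X_tensor x As = (if map isl As = [True, False, False]
    then W_X g x (projl (As ! 0)) (projr (As ! 1)) (projr (As ! 2)) else 0)"

definition W_tensor :: "real^'n \<Rightarrow> ('n + 'n tix) list \<Rightarrow> real" where
  "W_tensor x As = (if map isl As = [False, False, False, False]
    then W_comp g x (projr (As ! 0)) (projr (As ! 1)) (projr (As ! 2)) (projr (As ! 3)) else 0)"

definition nabla_W_X :: "real^'n \<Rightarrow> 'n \<Rightarrow> 'n \<Rightarrow> 'n tix \<Rightarrow> 'n tix \<Rightarrow> real" where
  "nabla_W_X x f b C E = cov (mconn g) f W_X_tensor x [Inl b, Inr C, Inr E]"

definition nabla_W :: "real^'n \<Rightarrow> 'n \<Rightarrow> 'n tix \<Rightarrow> 'n tix \<Rightarrow> 'n tix \<Rightarrow> 'n tix \<Rightarrow> real" where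
  "nabla_W x f A B C E = cov (mconn g) f W_tensor x [Inr A, Inr B, Inr C, Inr E]"

definition nabla2_Omega :: "real^'n \<Rightarrow> 'n \<Rightarrow> 'n \<Rightarrow> 'n \<Rightarrow> 'n \<Rightarrow> 'n tix \<Rightarrow> 'n tix \<Rightarrow> real" where
  "nabla2_Omega x h f a b C E =
      cov (mconn g) h (grad Omega_tensor) x [Inl f, Inl a, Inl b, Inr C, Inr E]"

definition nabla2_W :: "real^'n \<Rightarrow> 'n \<Rightarrow> 'n \<Rightarrow> 'n tix \<Rightarrow> 'n tix \<Rightarrow> 'n tix \<Rightarrow> 'n tix \<Rightarrow> real" where
  "nabla2_W x h f A B C E = cov (mconn g) h (grad W_tensor) x [Inl f, Inr A, Inr B, Inr C, Inr E]"

lemma smooth_W_X: "smooth_on U (\<lambda>x. W_X g x b C E)"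
  by (cases C; cases E) (simp_all add: smooth_intros smooth_geometry)

lemma smooth_W_comp: "smooth_on U (\<lambda>x. W_comp g x A B C E)"
  by (cases A; cases B) (simp_all add: W_comp_simps smooth_intros smooth_Omega smooth_W_X)

lemma smooth_W_X_tensor: "mc.smooth_tensor W_X_tensor"
  unfolding W_X_tensor_def by (intro allI smooth_on_if[OF U] smooth_W_X smooth_on_const[OF U])

lemma smooth_W_tensor: "mc.smooth_tensor W_tensor"
  unfolding W_tensor_def by (intro allI smooth_on_if[OF U] smooth_W_comp smooth_on_const[OF U])

lemma smooth_nabla_Omega: "smooth_on U (\<lambda>x. nabla_Omega x f a b C E)"
  unfolding nabla_Omega_def using mc.smooth_cov[OF smooth_Omega_tensor] by simp

lemma smooth_nabla_W: "smooth_on U (\<lambda>x. nabla_W x f A B C E)"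
  unfolding nabla_W_def using mc.smooth_cov[OF smooth_W_tensor] by simp

lemma smooth_nabla2_W: "smooth_on U (\<lambda>x. nabla2_W x h f A B C E)"
  unfolding nabla2_W_def using mc.smooth_cov[OF smooth_grad[OF smooth_W_tensor]] by simp

lemma tconn_row:
  "(\<Sum>G\<in>UNIV. tconn g a x (TZ b) G * v G) =
    schouten g x a b * v TY - (\<Sum>c\<in>UNIV. christoffel g x c a b * v (TZ c)) + g x $ a $ b * v TX"
  "(\<Sum>G\<in>UNIV. tconn g a x TY G * v G) = - v (TZ a)"
  "(\<Sum>G\<in>UNIV. tconn g a x TX G * v G) =
      - (\<Sum>c\<in>UNIV. (\<Sum>h\<in>UNIV. schouten g x a h * ginv g x h c) * v (TZ c))"
  by (simp_all add: sum_tix sum_negf sum_delta_simps)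

lemma nabla_W_X_expand: "nabla_W_X x f b C E = pd f (\<lambda>y. W_X g y b C E) x
    - (\<Sum>c\<in>UNIV. christoffel g x c f b * W_X g x c C E)
    + (\<Sum>G\<in>UNIV. tconn g f x C G * W_X g x b G E) + (\<Sum>G\<in>UNIV. tconn g f x E G * W_X g x b C G)"
  by (simp add: nabla_W_X_def cov_def W_X_tensor_def sum_Plus sum_negf)

lemma nabla2_Omega_expand: "nabla2_Omega x h f a b C E = pd h (\<lambda>y. nabla_Omega y f a b C E) x
    - (\<Sum>c\<in>UNIV. christoffel g x c h f * nabla_Omega x c a b C E) -
        (\<Sum>c\<in>UNIV. christoffel g x c h a * nabla_Omega x f c b C E)
    - (\<Sum>c\<in>UNIV. christoffel g x c h b * nabla_Omega x f a c C E)
    + (\<Sum>G\<in>UNIV. tconn g h x C G * nabla_Omega x f a b G E) +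
        (\<Sum>G\<in>UNIV. tconn g h x E G * nabla_Omega x f a b C G)"
  unfolding nabla2_Omega_def cov_def[of _ h] nabla_Omega_def by (simp add: sum_Plus sum_negf)

lemma nabla_W_expand: "nabla_W x f A B C E = pd f (\<lambda>y. W_comp g y A B C E) x
    + (\<Sum>G\<in>UNIV. tconn g f x A G * W_comp g x G B C E) +
        (\<Sum>G\<in>UNIV. tconn g f x B G * W_comp g x A G C E)
    + (\<Sum>G\<in>UNIV. tconn g f x C G * W_comp g x A B G E) +
        (\<Sum>G\<in>UNIV. tconn g f x E G * W_comp g x A B C G)"
  by (simp add: nabla_W_def cov_def W_tensor_def sum_Plus)

lemma nabla2_W_expand: "nabla2_W x h f A B C E = pd h (\<lambda>y. nabla_W y f A B C E) x
    - (\<Sum>c\<in>UNIV. christoffel g x c h f * nabla_W x c A B C E)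
    + (\<Sum>G\<in>UNIV. tconn g h x A G * nabla_W x f G B C E) +
        (\<Sum>G\<in>UNIV. tconn g h x B G * nabla_W x f A G C E)
    + (\<Sum>G\<in>UNIV. tconn g h x C G * nabla_W x f A B G E) +
        (\<Sum>G\<in>UNIV. tconn g h x E G * nabla_W x f A B C G)"
  unfolding nabla2_W_def cov_def[of _ h] nabla_W_def by (simp add: sum_Plus sum_negf)

text \<open>Links the operators of the statement to the calculus on the mixed bundle.\<close>

lemma tractor_nabla_W: "tractor_nabla g f (W_tractor g) x [A, B, C, E] = nabla_W x f A B C E"
  by (simp add: tractor_nabla_def nabla_W_expand tractor_conn_eq_tconn W_tractor_def eval_nat_numeral)

lemma tractor_nabla2_W: "tractor_nabla2 g h f (W_tractor g) x [A, B, C, E] = nabla2_W x h f A B C E"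
  unfolding tractor_nabla2_def tractor_nabla_W tractor_nabla_def[of g h]
  by (simp add: tractor_nabla_W nabla2_W_expand tractor_conn_eq_tconn eval_nat_numeral)

lemma tractor_laplacian_W:
  "tractor_laplacian g (W_tractor g) x [A, B, C, E] = - tr x (\<lambda>h f. nabla2_W x h f A B C E)"
  by (simp add: tractor_laplacian_def tractor_nabla2_W tr_def)

context
  fixes x assumes x: "x \<in> U"
begin

lemma W_skew: "W_comp g x B A C E = - W_comp g x A B C E"
proof (cases "\<exists>a b. A = TZ a \<and> B = TZ b")
  case True
  then obtain a b where "A = TZ a" "B = TZ b" by blast
  then show ?thesis using Omega_skew1[OF x, of b a C E] by (simp add: W_comp_simps)
qed (cases A; cases B; auto simp: W_comp_simps)

end

context
  fixes x assumes x: "x \<in> U"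
begin

lemma nabla_W_skew: "nabla_W x f B A C E = - nabla_W x f A B C E"
proof -
  have "pd f (\<lambda>y. W_comp g y B A C E) x = pd f (\<lambda>y. - W_comp g y A B C E) x"
    by (intro pd_cong[OF U x] W_skew)
  moreover have "W_comp g x B G C E = - W_comp g x G B C E" "W_comp g x B A G E =
      - W_comp g x A B G E"
    "W_comp g x B A C G = - W_comp g x A B C G" "W_comp g x G A C E = - W_comp g x A G C E" for G
    by (rule W_skew[OF x])+
  ultimately show ?thesis
    by (simp add: nabla_W_expand pd_minus_smooth[OF x] smooth_W_comp sum_negf)
qed

text \<open>The \<open>TZ\<close> rows of the connection feed in the entries of W with
  \<open>TY\<close>, which vanish, and those with \<open>TX\<close>, which are plus or minus
  \<open>W_X\<close>.\<close>

lemma nabla_W_ZZ: "nabla_W x f (TZ a) (TZ b) C E =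
    (real CARD('n) - 4) * nabla_Omega x f a b C E + g x $ f $ a * W_X g x b C E - g x $ f $ b * W_X g x a C E"
  by (simp add: nabla_W_expand nabla_Omega_expand tconn_row W_comp_simps pd_mult_smooth[OF x] smooth_on_const[OF U] smooth_Omega)
    (simp add: sum_distrib_left algebra_simps)

lemma nabla_W_XZ: "nabla_W x f TX (TZ b) C E = nabla_W_X x f b C E - (real CARD('n) - 4) *
    (\<Sum>c\<in>UNIV. (\<Sum>h\<in>UNIV. schouten g x f h * ginv g x h c) * Omega g x c b C E)"
  by (simp add: nabla_W_expand nabla_W_X_expand tconn_row W_comp_simps sum_distrib_left mult.left_commute)

text \<open>W vanishes on \<open>TY\<close>, but its derivative does not: the \<open>TY\<close> row
  of the connection is minus the \<open>TZ f\<close> component.\<close>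

lemma nabla_W_YZ: "nabla_W x f TY (TZ b) C E = - (real CARD('n) - 4) * Omega g x f b C E"
  by (simp add: nabla_W_expand tconn_row W_comp_simps algebra_simps)

lemma nabla_W_YX: "nabla_W x f TY TX C E = W_X g x f C E"
  by (simp add: nabla_W_expand tconn_row W_comp_simps)

lemma nabla_W_YY: "nabla_W x f TY TY C E = 0"
  using nabla_W_skew[of f TY TY C E] by simp

end

context
  fixes x assumes x: "x \<in> U"
begin

lemma nabla2_W_skew: "nabla2_W x h f B A C E = - nabla2_W x h f A B C E"
proof -
  have "pd h (\<lambda>y. nabla_W y f B A C E) x = pd h (\<lambda>y. - nabla_W y f A B C E) x"
    by (intro pd_cong[OF U x] nabla_W_skew)
  moreover have "nabla_W x c B A C E = - nabla_W x c A B C E" "nabla_W x f B G C E =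
      - nabla_W x f G B C E"
    "nabla_W x f B A G E = - nabla_W x f A B G E"
    "nabla_W x f B A C G = - nabla_W x f A B C G" "nabla_W x f G A C E =
        - nabla_W x f A G C E" for c G
    by (rule nabla_W_skew[OF x])+
  ultimately show ?thesis
    by (simp add: nabla2_W_expand pd_minus_smooth[OF x] smooth_nabla_W sum_negf)
qed

lemma nabla2_W_ZZ:
  "nabla2_W x h f (TZ a) (TZ b) C E = (real CARD('n) - 4) * nabla2_Omega x h f a b C E
    + g x $ f $ a * nabla_W_X x h b C E - g x $ f $ b * nabla_W_X x h a C E
    + g x $ h $ a * nabla_W x f TX (TZ b) C E + schouten g x h a * nabla_W x f TY (TZ b) C E
    + g x $ h $ b * nabla_W x f (TZ a) TX C E + schouten g x h b * nabla_W x f (TZ a) TY C E"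
proof -
  have "pd h (\<lambda>y. nabla_W y f (TZ a) (TZ b) C E) x =
      pd h (\<lambda>y. (real CARD('n) - 4) * nabla_Omega y f a b C E
      + g y $ f $ a * W_X g y b C E - g y $ f $ b * W_X g y a C E) x"
    by (intro pd_cong[OF U x] nabla_W_ZZ)
  also have "\<dots> = (real CARD('n) - 4) * pd h (\<lambda>y. nabla_Omega y f a b C E) x
      + (pd h (\<lambda>y. g y $ f $ a) x * W_X g x b C E + g x $ f $ a * pd h (\<lambda>y. W_X g y b C E) x)
      - (pd h (\<lambda>y. g y $ f $ b) x * W_X g x a C E + g x $ f $ b * pd h (\<lambda>y. W_X g y a C E) x)"
    by (simp add: pd_diff[OF smooth_on_differentiable[OF _ x] smooth_on_differentiable[OF _ x]]
        pd_add[OF smooth_on_differentiable[OF _ x] smooth_on_differentiable[OF _ x]]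
        pd_mult_smooth[OF x] smooth_intros smooth_nabla_Omega smooth_W_X smooth_g)
  finally show ?thesis
    unfolding nabla2_W_expand tconn_row nabla_W_ZZ[OF x] nabla2_Omega_expand nabla_W_X_expand pd_g[OF x]
    by (simp add: sum.distrib sum_subtractf sum_distrib_left sum_distrib_right algebra_simps)
qed

lemma nabla2_W_YZ: "nabla2_W x h f TY (TZ b) C E = - (real CARD('n) - 4) * nabla_Omega x h f b C E
    - nabla_W x f (TZ h) (TZ b) C E + g x $ h $ b * W_X g x f C E"
proof -
  have "pd h (\<lambda>y. nabla_W y f TY (TZ b) C E) x =
      pd h (\<lambda>y. - (real CARD('n) - 4) * Omega g y f b C E) x"
    by (intro pd_cong[OF U x] nabla_W_YZ)
  also have "\<dots> = - (real CARD('n) - 4) * pd h (\<lambda>y. Omega g y f b C E) x"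
    by (simp only: pd_mult_smooth[OF x] smooth_on_const[OF U] smooth_Omega pd_const)
  finally show ?thesis
    unfolding nabla2_W_expand tconn_row nabla_W_YZ[OF x] nabla_W_YX[OF x] nabla_W_YY[OF x] nabla_Omega_expand
    by (simp add: sum.distrib sum_subtractf sum_distrib_left sum_distrib_right algebra_simps)
qed

text \<open>Slot by slot, the connection terms of the three second derivatives add up to
  combinations of cyclic sums of \<open>nabla_Omega\<close>, so they vanish along with the
  derivative of the first identity.\<close>

lemma nabla2_Omega_bianchi:
  "nabla2_Omega x h f a b C E + nabla2_Omega x h a b f C E + nabla2_Omega x h b f a C E = 0"
proof -
  have B: "nabla_Omega x f a b C E + nabla_Omega x a b f C E + nabla_Omega x b f a C E =
      0" for f a b C E
    by (rule nabla_Omega_bianchi[OF x])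
  have "pd h (\<lambda>y. nabla_Omega y f a b C E + nabla_Omega y a b f C E + nabla_Omega y b f a C E) x =
      0"
    by (rule pd_eq_0_on[OF U x nabla_Omega_bianchi])
  then have "pd h (\<lambda>y. nabla_Omega y f a b C E) x + pd h (\<lambda>y. nabla_Omega y a b f C E) x +
      pd h (\<lambda>y. nabla_Omega y b f a C E) x = 0"
    by (simp add: pd_add[OF smooth_on_differentiable[OF _ x] smooth_on_differentiable[OF _ x]] smooth_nabla_Omega
      smooth_intros)
  moreover have "(\<Sum>k\<in>S. v k * nabla_Omega x (F k) (A k) (Z k) (CC k) (EE k)) +
      (\<Sum>k\<in>S. v k * nabla_Omega x (A k) (Z k) (F k) (CC k) (EE k))
     + (\<Sum>k\<in>S. v k * nabla_Omega x (Z k) (F k) (A k) (CC k) (EE k)) = 0"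
    for v :: "'z \<Rightarrow> real" and S F A Z CC EE
    by (simp add: sum.distrib[symmetric] distrib_left[symmetric] B)
  note this[of "\<lambda>c. christoffel g x c h f" "\<lambda>c. c" "\<lambda>c. a" "\<lambda>c. b" "\<lambda>c. C" "\<lambda>c. E" UNIV]
    this[of "\<lambda>c. christoffel g x c h a" "\<lambda>c. f" "\<lambda>c. c" "\<lambda>c. b" "\<lambda>c. C" "\<lambda>c. E" UNIV]
    this[of "\<lambda>c. christoffel g x c h b" "\<lambda>c. f" "\<lambda>c. a" "\<lambda>c. c" "\<lambda>c. C" "\<lambda>c. E" UNIV]
    this[of "\<lambda>G. tconn g h x C G" "\<lambda>c. f" "\<lambda>c. a" "\<lambda>c. b" "\<lambda>G. G" "\<lambda>c. E" UNIV]
    this[of "\<lambda>G. tconn g h x E G" "\<lambda>c. f" "\<lambda>c. a" "\<lambda>c. b" "\<lambda>c. C" "\<lambda>G. G" UNIV]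
  ultimately show ?thesis by (simp add: nabla2_Omega_expand)
qed

lemma nabla2_Omega_skew1: "nabla2_Omega x h f b a C E = - nabla2_Omega x h f a b C E"
proof -
  have "pd h (\<lambda>y. nabla_Omega y f b a C E) x = pd h (\<lambda>y. - nabla_Omega y f a b C E) x"
    by (intro pd_cong[OF U x] nabla_Omega_skew1)
  moreover have "nabla_Omega x c b a C E = - nabla_Omega x c a b C E" "nabla_Omega x f c a C E =
      - nabla_Omega x f a c C E"
    "nabla_Omega x f b c C E = - nabla_Omega x f c b C E" "nabla_Omega x f b a G E =
        - nabla_Omega x f a b G E" 
     "nabla_Omega x f b a C G = - nabla_Omega x f a b C G" for c G
    by (rule nabla_Omega_skew1[OF x])+
  ultimately show ?thesis
    by (simp add: nabla2_Omega_expand pd_minus_smooth[OF x] smooth_nabla_Omega sum_negf)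
qed

text \<open>The Christoffel terms of the two derivative indices are symmetric and cancel, so
  \<open>cov_commute\<close> leaves one curvature term for each of the slots f, b, C, E.\<close>

lemma nabla2_Omega_commute: "nabla2_Omega x h a f b C E - nabla2_Omega x a h f b C E =
    - (\<Sum>c\<in>UNIV. riemann g x h a c f * Omega g x c b C E) -
        (\<Sum>c\<in>UNIV. riemann g x h a c b * Omega g x f c C E)
    + (\<Sum>D\<in>UNIV. curv (mconn g) h a x (Inr C) (Inr D) * Omega g x f b D E)
    + (\<Sum>D\<in>UNIV. curv (mconn g) h a x (Inr E) (Inr D) * Omega g x f b C D)"
proof -
  have N: "nabla2_Omega x h a f b C E =
      cov (mconn g) h (cov (mconn g) a Omega_tensor) x [Inl f, Inl b, Inr C, Inr E]
      - (\<Sum>c\<in>UNIV. christoffel g x c h a * nabla_Omega x c f b C E)" for h a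
    by (simp add: nabla2_Omega_def cov_Cons[of _ _ _ _ "Inl a"] sum_Plus sum_negf nabla_Omega_def)
  have "nabla2_Omega x h a f b C E - nabla2_Omega x a h f b C E =
      act (curv (mconn g) h a x) (Omega_tensor x) [Inl f, Inl b, Inr C, Inr E]"
    unfolding N mc.cov_commute[OF x smooth_Omega_tensor, symmetric] by (simp add: christoffel_sym[OF x, of _ a h])
  then show ?thesis
    by (simp add: sum_Plus curv_LC[OF x] curv_mixed[OF x] sum_negf)
qed

lemma nabla2_Omega_div: "tr x (\<lambda>h f. nabla2_Omega x a h f b C E) = - nabla_W_X x a b C E"
proof -
  have "tr x (\<lambda>h f. nabla2_Omega x a h f b C E) =
      cov (mconn g) a (\<lambda>y As. tr y (\<lambda>h f. grad Omega_tensor y (Inl h # Inl f # As))) x [Inl b, Inr C, Inr E]"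
    unfolding nabla2_Omega_def by (rule tr_cov[OF x smooth_grad[OF smooth_Omega_tensor]])
  \<comment> \<open>The divergence formula holds at every y in U and may be differentiated; the
    factor \<open>- 1\<close> fits \<open>cov_cmult\<close>.\<close>
  also have "\<dots> = cov (mconn g) a (\<lambda>y As. - 1 * W_X_tensor y As) x [Inl b, Inr C, Inr E]"
  proof (rule cov_cong_kind[OF x])
    fix y and Bs :: "('n + 'n tix) list"
    assume y: "y \<in> U" and k: "map isl Bs = map isl [Inl b, Inr C, Inr E]"
    obtain i j k where "Bs = [Inl i, Inr j, Inr k]"
      using k by (auto simp: map_eq_Cons_conv isl_def) (metis sum.exhaust)
    then show "tr y (\<lambda>h f. grad Omega_tensor y (Inl h # Inl f # Bs)) = - 1 * W_X_tensor y Bs"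
      using nabla_Omega_div[OF y, of i j k] by (simp add: nabla_Omega_def W_X_tensor_def)
  qed
  also have "\<dots> = - nabla_W_X x a b C E"
    unfolding nabla_W_X_def mc.cov_cmult[OF x smooth_W_X_tensor] by simp
  finally show ?thesis .
qed

text \<open>The wave equation of the tractor curvature, up to the curvature terms of \<open>nabla2_Omega_commute\<close>.\<close>

lemma nabla2_Omega_laplace:
  "tr x (\<lambda>h f. nabla2_Omega x h f a b C E) = - nabla_W_X x a b C E + nabla_W_X x b a C E
    + tr x (\<lambda>h f. (nabla2_Omega x h a f b C E - nabla2_Omega x a h f b C E) -
        (nabla2_Omega x h b f a C E - nabla2_Omega x b h f a C E))"
proof -
  have "nabla2_Omega x h f a b C E =
      nabla2_Omega x h a f b C E - nabla2_Omega x h b f a C E" for h f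
    using nabla2_Omega_bianchi[of h f a b C E] nabla2_Omega_skew1[of h a b f C E] by simp
  then show ?thesis by (simp add: tr_linear nabla2_Omega_div)
qed

end

end

section \<open>The double action of the \<open>W\<close>-tractor on itself\<close>

lemma sharp_elem_end:
  "sharp (elem_end P Q) T [A, B, C, E] =
    (if A = P then T [Q, B, C, E] else 0) + (if B = P then T [A, Q, C, E] else 0)
    + (if C = P then T [A, B, Q, E] else 0) + (if E = P then T [A, B, C, Q] else 0)"
proof -
  have "(\<Sum>F\<in>UNIV. elem_end P Q A F * f F) = (if A =
      P then f Q else 0)" for A and f :: "'a tix \<Rightarrow> real"
  proof -
    have "(\<Sum>F\<in>UNIV. elem_end P Q A F * f F) = (\<Sum>F\<in>UNIV. if F = Q then (if A =
        P then f Q else 0) else 0)"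
      by (intro sum.cong refl) (simp add: elem_end_def)
    then show ?thesis by simp
  qed
  then show ?thesis by (simp add: sharp_def eval_nat_numeral)
qed

text \<open>Each of the two actions selects one of four slots, hence sixteen terms; if both select
  the same slot the endomorphisms are composed, as in \<open>V x A Q Q S\<close>.\<close>

lemma W_sharp_sharp_expand:
  fixes g :: "'n::finite local_metric"
  defines "V \<equiv> W_end g"
  assumes W: "\<And>A B C E. W A B C E = T x [A, B, C, E]"
  shows "W_sharp_sharp g T x [A, B, C, E] = (\<Sum>Q\<in>UNIV. \<Sum>S\<in>UNIV.
      V x A Q Q S * W S B C E + V x A Q B S * W Q S C E + V x A Q C S * W Q B S E + V x A Q E S * W Q B C S
    + V x B Q A S * W S Q C E + V x B Q Q S * W A S C E + V x B Q C S * W A Q S E +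
        V x B Q E S * W A Q C S
    + V x C Q A S * W S B Q E + V x C Q B S * W A S Q E + V x C Q Q S * W A B S E +
        V x C Q E S * W A B Q S
    + V x E Q A S * W S B C Q + V x E Q B S * W A S C Q + V x E Q C S * W A B S Q +
        V x E Q Q S * W A B C S)"
proof -
  let ?V = "V x"
  have 1: "(\<Sum>P\<in>UNIV. \<Sum>Q\<in>UNIV. \<Sum>R\<in>UNIV. \<Sum>S\<in>UNIV. ?V P Q R S * (if A = P then t Q R S else 0))
    = (\<Sum>Q\<in>UNIV. \<Sum>S\<in>UNIV. \<Sum>R\<in>UNIV. ?V A Q R S * t Q R S)" for A and t :: "'n tix \<Rightarrow> 'n tix \<Rightarrow> 'n tix \<Rightarrow> real"
  proof -
    have "(\<Sum>P\<in>UNIV. \<Sum>Q\<in>UNIV. \<Sum>R\<in>UNIV. \<Sum>S\<in>UNIV. ?V P Q R S * (if A = P then t Q R S else 0))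
      = (\<Sum>P\<in>UNIV. if P = A then (\<Sum>Q\<in>UNIV. \<Sum>R\<in>UNIV. \<Sum>S\<in>UNIV. ?V A Q R S * t Q R S) else 0)"
      by (intro sum.cong refl) auto
    then show ?thesis by (simp, intro sum.cong refl sum.swap)
  qed
  have 2: "(\<Sum>R\<in>UNIV. ?V A Q R S * (if B = R then u else 0)) = ?V A Q B S * u" for A Q S B u
  proof -
    have "(\<Sum>R\<in>UNIV. ?V A Q R S * (if B = R then u else 0)) = (\<Sum>R\<in>UNIV. if R =
        B then ?V A Q B S * u else 0)"
      by (intro sum.cong refl) auto
    then show ?thesis by simp
  qed
  have "W_sharp_sharp g T x [A, B, C, E] =
      (\<Sum>P\<in>UNIV. \<Sum>Q\<in>UNIV. \<Sum>R\<in>UNIV. \<Sum>S\<in>UNIV. ?V P Q R S * (if A = P then sharp (elem_end R S) (T x) [Q, B, C, E] else 0))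
    + (\<Sum>P\<in>UNIV. \<Sum>Q\<in>UNIV. \<Sum>R\<in>UNIV. \<Sum>S\<in>UNIV. ?V P Q R S * (if B =
        P then sharp (elem_end R S) (T x) [A, Q, C, E] else 0))
    + (\<Sum>P\<in>UNIV. \<Sum>Q\<in>UNIV. \<Sum>R\<in>UNIV. \<Sum>S\<in>UNIV. ?V P Q R S * (if C =
        P then sharp (elem_end R S) (T x) [A, B, Q, E] else 0))
    + (\<Sum>P\<in>UNIV. \<Sum>Q\<in>UNIV. \<Sum>R\<in>UNIV. \<Sum>S\<in>UNIV. ?V P Q R S * (if E =
        P then sharp (elem_end R S) (T x) [A, B, C, Q] else 0))"
    unfolding W_sharp_sharp_def sharp_elem_end[of _ _ "sharp _ _"] V_def distrib_left sum.distrib ..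
  then show ?thesis
    unfolding 1 sharp_elem_end distrib_left sum.distrib 2 W by simp
qed

context chart_metric
begin

lemma W_comp_TY: "W_comp g x A B TY E = 0" "W_comp g x A B C TY = 0"
  by (cases A; cases B; simp add: W_comp_simps)+

lemma W_end_eq: "W_end g x P Q R S = (\<Sum>B\<in>UNIV. \<Sum>E\<in>UNIV.
    W_comp g x P B R E * tractor_metric g x B Q * tractor_metric g x E S)"
  by (simp add: W_end_def W_tractor_def)

definition tr2 :: "real^'n \<Rightarrow> ('n \<Rightarrow> 'n \<Rightarrow> 'n \<Rightarrow> 'n \<Rightarrow> real) \<Rightarrow> real" where
  "tr2 x F = tr x (\<lambda>p q. tr x (\<lambda>r s. F p q r s))"

lemma tr2_add: "tr2 x (\<lambda>p q r s. F p q r s + G p q r s) = tr2 x F + tr2 x G"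
  and tr2_diff: "tr2 x (\<lambda>p q r s. F p q r s - G p q r s) = tr2 x F - tr2 x G"
  and tr2_minus: "tr2 x (\<lambda>p q r s. - F p q r s) = - tr2 x F"
  and tr2_cmult: "tr2 x (\<lambda>p q r s. c * F p q r s) = c * tr2 x F"
  by (simp_all add: tr2_def tr_linear)

lemmas tr2_linear = tr2_add tr2_diff tr2_minus tr2_cmult

lemma tr2_swap: "tr2 x F = tr2 x (\<lambda>p q r s. F r s p q)"
  unfolding tr2_def by (rule tr_swap)

text \<open>As h pairs \<open>TY\<close> with \<open>TX\<close> and both factors vanish on
  \<open>TY\<close>, only the Z block of h, the inverse metric, contributes.\<close>

lemma W_end_contract:
  assumes T: "\<And>S. T TY S = 0" "\<And>Q. T Q TY = 0"
  shows "(\<Sum>Q\<in>UNIV. \<Sum>S\<in>UNIV. W_end g x A Q R S * T Q S) =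
    tr2 x (\<lambda>p q r s. W_comp g x A (TZ p) R (TZ r) * T (TZ q) (TZ s))"
proof -
  have "(\<Sum>Q\<in>UNIV. \<Sum>S\<in>UNIV. W_end g x A Q R S * T Q S) =
    (\<Sum>q\<in>UNIV. \<Sum>s\<in>UNIV. \<Sum>p\<in>UNIV. \<Sum>r\<in>UNIV.
      ginv g x p q * (ginv g x r s * (W_comp g x A (TZ p) R (TZ r) * T (TZ q) (TZ s))))"
    by (simp add: sum_tix T W_end_eq W_comp_simps W_comp_TY sum_distrib_left sum_distrib_right mult_ac)
  also have "\<dots> = (\<Sum>q\<in>UNIV. \<Sum>p\<in>UNIV. \<Sum>s\<in>UNIV. \<Sum>r\<in>UNIV.
      ginv g x p q * (ginv g x r s * (W_comp g x A (TZ p) R (TZ r) * T (TZ q) (TZ s))))"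
    by (intro sum.cong refl sum.swap)
  also have "\<dots> = (\<Sum>p\<in>UNIV. \<Sum>q\<in>UNIV. \<Sum>s\<in>UNIV. \<Sum>r\<in>UNIV.
      ginv g x p q * (ginv g x r s * (W_comp g x A (TZ p) R (TZ r) * T (TZ q) (TZ s))))"
    by (rule sum.swap)
  also have "\<dots> = (\<Sum>p\<in>UNIV. \<Sum>q\<in>UNIV. \<Sum>r\<in>UNIV. \<Sum>s\<in>UNIV.
      ginv g x p q * (ginv g x r s * (W_comp g x A (TZ p) R (TZ r) * T (TZ q) (TZ s))))"
    by (intro sum.cong refl sum.swap)
  finally show ?thesis by (simp add: tr2_def tr_def sum_distrib_left)
qed

context
  fixes x assumes x: "x \<in> U"
begin

lemma tr2_flip: "tr2 x F = tr2 x (\<lambda>p q r s. F q p s r)"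
  unfolding tr2_def by (subst tr_flip[OF x]) (intro arg_cong[of _ _ "tr x"] ext tr_flip[OF x])

lemma W_trace: "(\<Sum>Q\<in>UNIV. \<Sum>B\<in>UNIV. W_comp g x A B Q (TZ e) * tractor_metric g x B Q) = 0"
proof -
  have "(\<Sum>Q\<in>UNIV. \<Sum>B\<in>UNIV. W_comp g x A B Q (TZ e) * tractor_metric g x B Q) =
      tr x (\<lambda>q b. W_comp g x A (TZ b) (TZ q) (TZ e))"
    by (simp add: sum_tix W_comp_simps W_comp_TY tr_def ginv_sym[OF x, of _ _] mult.commute)
  also have "\<dots> = 0"
  proof (cases A)
    case TX
    have "tr x (\<lambda>q b. cotton g x b q e) = tr x (\<lambda>q b. cotton g x q b e)"
      by (rule tr_flip[OF x])
    also have "\<dots> = tr x (\<lambda>q b. - cotton g x q e b)"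
      by (intro arg_cong[of _ _ "tr x"] ext cotton_skew[OF x])
    also have "\<dots> = 0" using cotton_tr_zero[OF x, of e] by (simp add: tr_minus cotton_tr_def[OF x])
    finally show ?thesis using TX by (simp add: W_comp_simps tr_linear)
  next
    case (TZ a)
    have "weyl g x a b q e = - weyl g x b a q e" for b q by (rule weyl_skew1[OF x])
    then show ?thesis
      using weyl_tr[OF x, of a e] TZ tr_flip[OF x, of "\<lambda>b q. weyl g x b a q e"]
      by (simp add: W_comp_simps tr_linear)
  qed (simp add: W_comp_simps tr_zero)
  finally show ?thesis .
qed

text \<open>Removes the four terms in which both actions hit the same slot. The column
  \<open>TX\<close> of the trace would involve the trace of Bach, but h lowers it to
  \<open>TY\<close>, where v vanishes.\<close>

lemma W_end_trace:
  assumes "v TY = 0"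
  shows "(\<Sum>Q\<in>UNIV. \<Sum>S\<in>UNIV. W_end g x A Q Q S * v S) = 0"
proof -
  have *: "(\<Sum>Q\<in>UNIV. W_end g x A Q Q S) * v S = 0" for S
  proof -
    have "(\<Sum>Q\<in>UNIV. W_end g x A Q Q S) =
      (\<Sum>E\<in>UNIV. (\<Sum>Q\<in>UNIV. \<Sum>B\<in>UNIV. W_comp g x A B Q E * tractor_metric g x B Q) * tractor_metric g x E S)"
    proof -
      have "(\<Sum>Q\<in>UNIV. W_end g x A Q Q S) =
        (\<Sum>Q\<in>UNIV. \<Sum>E\<in>UNIV. \<Sum>B\<in>UNIV. W_comp g x A B Q E * tractor_metric g x B Q * tractor_metric g x E S)"
        unfolding W_end_eq by (intro sum.cong refl sum.swap)
      also have "\<dots> =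
          (\<Sum>E\<in>UNIV. \<Sum>Q\<in>UNIV. \<Sum>B\<in>UNIV. W_comp g x A B Q E * tractor_metric g x B Q * tractor_metric g x E S)"
        by (rule sum.swap)
      finally show ?thesis by (simp add: sum_distrib_right)
    qed
    moreover define f where "f E = (\<Sum>Q\<in>UNIV. \<Sum>B\<in>UNIV. W_comp g x A B Q E * tractor_metric g x B Q)" for E
    have "f TY = 0" "\<And>e. f (TZ e) = 0" unfolding f_def W_trace by (simp_all add: W_comp_TY)
    then have "(\<Sum>E\<in>UNIV. f E * tractor_metric g x E S) * v S = 0"
      using assms by (cases S) (simp_all add: sum_tix)
    ultimately show ?thesis by (simp only: f_def)
  qed
  show ?thesis
    by (subst sum.swap) (simp only: sum_distrib_right[symmetric] * sum.neutral_const)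
qed

text \<open>With one pair tangential, exchange of pairs needs only the pair symmetry of Weyl; the
  Bach entries have to wait for \<open>bach_sym\<close>.\<close>

lemma W_pair: "W_comp g x C E (TZ p) (TZ r) = (real CARD('n) - 4) * Omega g x p r C E"
  by (cases C; cases E) (auto simp: W_comp_simps weyl_pair[OF x, of _ _ p r] algebra_simps)

lemma W_pair': "W_comp g x C (TZ p) (TZ a) (TZ r) = (real CARD('n) - 4) * Omega g x a r C (TZ p)"
  by (rule W_pair)

end

end

section \<open>The curvature terms\<close>

context chart_metric
begin

text \<open>
  \<open>schouten_Omega\<close> is \<open>P\<^sub>a\<^sup>c\<Omega>\<^sub>c\<^sub>b\<close>, \<open>weyl_Omega\<close> is \<open>C\<^sub>h\<^sub>a\<^sub>c\<^sub>b\<Omega>\<^sup>h\<^sup>c\<close>, and \<open>Omega_sharp_Omega\<close> is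
  \<open>(\<Omega>\<^sub>h\<^sub>a\<sharp>\<Omega>\<^sup>h\<^sub>b)\<^sub>C\<^sub>E\<close>.
\<close>

definition schouten_Omega where
  "schouten_Omega x a b C E = tr x (\<lambda>h f. schouten g x a h * Omega g x f b C E)"

definition weyl_Omega where
  "weyl_Omega x a b C E = tr2 x (\<lambda>h f c e. weyl g x h a c b * Omega g x f e C E)"

definition Omega_sharp_Omega where
  "Omega_sharp_Omega x a b C E = tr2 x (\<lambda>h f r s. Omega g x h a C (TZ r) * Omega g x f b (TZ s) E
    + Omega g x h a E (TZ r) * Omega g x f b C (TZ s))"

context
  fixes x assumes x: "x \<in> U"
begin

lemma schouten_Omega_alt:
  "(\<Sum>c\<in>UNIV. (\<Sum>h\<in>UNIV. schouten g x a h * ginv g x h c) * Omega g x c b C E) =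
      schouten_Omega x a b C E"
  unfolding schouten_Omega_def tr_def by (subst sum.swap) (simp add: sum_distrib_left sum_distrib_right mult_ac)

lemma riemann_contract:
  "(\<Sum>c\<in>UNIV. riemann g x h a c f * v c) = tr x (\<lambda>c e. riemann_low g x h a c f * v e)"
proof -
  have "tr x (\<lambda>c e. riemann_low g x h a c f * v e) =
      tr x (\<lambda>c e. \<Sum>k\<in>UNIV. riemann g x h a k f * (g x $ c $ k * v e))"
    by (simp add: riemann_low_def sum_distrib_left sum_distrib_right mult_ac)
  then show ?thesis by (simp add: tr_sum tr_cmult tr_g[OF x])
qed

lemma curv_contract:
  assumes "v TY = 0"
  shows "(\<Sum>D\<in>UNIV. curv (mconn g) a b x (Inr C) (Inr D) * v D) =
      tr x (\<lambda>r s. Omega g x a b C (TZ r) * v (TZ s))"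
proof -
  have 0: "Omega g x a b C TY = 0" by (cases C) simp_all
  have "(\<Sum>s\<in>UNIV. (\<Sum>r\<in>UNIV. Omega g x a b C (TZ r) * ginv g x r s) * v (TZ s)) =
     tr x (\<lambda>r s. Omega g x a b C (TZ r) * v (TZ s))"
    unfolding tr_def by (subst sum.swap) (simp add: sum_distrib_left sum_distrib_right mult_ac)
  then show ?thesis by (simp add: curv_tractor[OF x] sum_tix assms 0)
qed

lemma riemann_low_decomp:
  "riemann_low g x h a c f = weyl g x h a c f + g x $ c $ h * schouten g x a f
    - g x $ c $ a * schouten g x h f +
        g x $ f $ a * schouten g x h c - g x $ f $ h * schouten g x a c"
  by (simp add: weyl_def)

text \<open>The trace over h and f turns Riemann into minus Ricci on the index a, rewritten by
  \<open>(d - 2) P + J g\<close>.\<close>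

lemma ricci_term: "tr2 x (\<lambda>h f c e. riemann_low g x h a c f * Omega g x e b C E) =
    (2 - real CARD('n)) * schouten_Omega x a b C E - Jsc g x * Omega g x a b C E"
proof -
  let ?O = "\<lambda>a b. Omega g x a b C E" and ?P = "schouten g x"
  have 1: "tr2 x (\<lambda>h f c e. weyl g x h a c f * ?O e b) = 0"
  proof -
    have "tr x (\<lambda>h f. weyl g x h a c f) = tr x (\<lambda>h f. - weyl g x h a f c)" for c
      by (intro arg_cong[of _ _ "tr x"] ext weyl_skew2[OF x])
    then have "tr x (\<lambda>h f. weyl g x h a c f) = 0" for c
      by (simp add: tr_minus weyl_tr[OF x])
    then show ?thesis unfolding tr2_def by (subst tr_swap) (simp add: tr_linear)
  qed
  have 2: "tr2 x (\<lambda>h f c e. g x $ c $ h * (?P a f * ?O e b)) = schouten_Omega x a b C E"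
    unfolding tr2_def schouten_Omega_def tr_g1[OF x] by (rule tr_flip[OF x])
  have 3: "tr2 x (\<lambda>h f c e. g x $ c $ a * (?P h f * ?O e b)) = Jsc g x * ?O a b"
    unfolding tr2_def tr_g1[OF x] by (simp add: tr_linear Jsc_tr[OF x])
  have 4: "tr2 x (\<lambda>h f c e. g x $ f $ a * (?P h c * ?O e b)) = schouten_Omega x a b C E"
    unfolding tr2_def tr_cmult tr_g3[OF x] schouten_Omega_def ..
  have 5: "tr2 x (\<lambda>h f c e. g x $ f $ h * (?P a c * ?O e b)) =
      real CARD('n) * schouten_Omega x a b C E"
    unfolding tr2_def tr_cmult tr_multc tr_gg'[OF x] schouten_Omega_def ..
  show ?thesis
    unfolding riemann_low_decomp distrib_right left_diff_distrib mult.assoc tr2_linear 1 2 3 4 5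
    by (simp add: algebra_simps)
qed

text \<open>Here Riemann couples both form indices. Of its four Schouten terms, the two that pair
  the skew \<Omega> with a symmetric tensor vanish.\<close>

lemma riemann_term: "tr2 x (\<lambda>h f c e. riemann_low g x h a c b * Omega g x f e C E) =
    weyl_Omega x a b C E - schouten_Omega x b a C E + schouten_Omega x a b C E"
proof -
  let ?O = "\<lambda>a b. Omega g x a b C E" and ?P = "schouten g x"
  have sk: "?O a b = - ?O b a" for a b by (rule Omega_skew1[OF x])
  have 2: "tr2 x (\<lambda>h f c e. g x $ c $ h * (?P a b * ?O f e)) = 0"
    unfolding tr2_def tr_g1[OF x] tr_cmult using tr_skew[OF x, of "\<lambda>h f. ?O f h", OF sk] by simp
  have 3: "tr2 x (\<lambda>h f c e. g x $ c $ a * (?P h b * ?O f e)) = schouten_Omega x b a C E"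
    unfolding tr2_def tr_g1[OF x] schouten_Omega_def by (simp add: schouten_sym[OF x, of _ b])
  have 4: "tr2 x (\<lambda>h f c e. ?P h c * ?O f e) = 0"
  proof -
    have "tr2 x (\<lambda>h f c e. ?P h c * ?O f e) = tr2 x (\<lambda>h f c e. ?P c h * ?O e f)"
      by (rule tr2_swap)
    also have "\<dots> = tr2 x (\<lambda>h f c e. - (?P h c * ?O f e))"
      by (intro arg_cong[of _ _ "tr2 x"] ext) (metis schouten_sym[OF x] sk mult_minus_right)
    finally show ?thesis by (simp add: tr2_linear)
  qed
  have 5: "tr2 x (\<lambda>h f c e. g x $ b $ h * (?P a c * ?O f e)) = - schouten_Omega x a b C E"
    unfolding tr2_def tr_cmult tr_g2[OF x] schouten_Omega_def tr_minus[symmetric]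
    by (intro arg_cong[of _ _ "tr x"] ext) (simp add: sk[of b])
  show ?thesis
    unfolding riemann_low_decomp distrib_right left_diff_distrib mult.assoc tr2_linear 2 3 4 5
    by (simp add: weyl_Omega_def)
qed

text \<open>The coefficient d-3 arises because Ricci on the index a gives d-2 and
  \<open>riemann_term\<close> takes one away.\<close>

lemma nabla2_Omega_commute_tr:
  "tr x (\<lambda>h f. nabla2_Omega x h a f b C E - nabla2_Omega x a h f b C E) =
    (real CARD('n) - 3) * schouten_Omega x a b C E + schouten_Omega x b a C E + Jsc g x * Omega g x a b C E - weyl_Omega x a b C E + Omega_sharp_Omega x a b C E"
proof -
  have Y: "Omega g x a b TY E = 0" "Omega g x a b E TY = 0" for a b E by (cases E; simp)+
  have "tr x (\<lambda>h f. nabla2_Omega x h a f b C E - nabla2_Omega x a h f b C E) =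
      - tr2 x (\<lambda>h f c e. riemann_low g x h a c f * Omega g x e b C E)
      - tr2 x (\<lambda>h f c e. riemann_low g x h a c b * Omega g x f e C E) + Omega_sharp_Omega x a b C E"
    unfolding nabla2_Omega_commute[OF x] Omega_sharp_Omega_def tr2_def
    by (simp add: tr_linear riemann_contract curv_contract Y)
  then show ?thesis unfolding ricci_term riemann_term by (simp add: algebra_simps)
qed

lemma weyl_Omega_skew: "weyl_Omega x b a C E = - weyl_Omega x a b C E"
proof -
  have "weyl_Omega x b a C E = tr2 x (\<lambda>h f c e. weyl g x c b h a * Omega g x e f C E)"
    unfolding weyl_Omega_def by (rule tr2_swap)
  also have "\<dots> = tr2 x (\<lambda>h f c e. - (weyl g x h a c b * Omega g x f e C E))"
  proof (intro arg_cong[of _ _ "tr2 x"] ext)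
    fix h f c e
    show "weyl g x c b h a * Omega g x e f C E = - (weyl g x h a c b * Omega g x f e C E)"
      using weyl_pair[OF x, of c b h a] Omega_skew1[OF x, of e f C E] by simp
  qed
  finally show ?thesis by (simp add: weyl_Omega_def tr2_linear)
qed

end

lemma W_sharp_sharp_W:
  "W_sharp_sharp g (W_tractor g) x [A, B, C, E] = (\<Sum>Q\<in>UNIV. \<Sum>S\<in>UNIV.
      W_end g x A Q Q S * W_comp g x S B C E + W_end g x A Q B S * W_comp g x Q S C E
    + W_end g x A Q C S * W_comp g x Q B S E + W_end g x A Q E S * W_comp g x Q B C S
    + W_end g x B Q A S * W_comp g x S Q C E + W_end g x B Q Q S * W_comp g x A S C E
    + W_end g x B Q C S * W_comp g x A Q S E + W_end g x B Q E S * W_comp g x A Q C S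
    + W_end g x C Q A S * W_comp g x S B Q E + W_end g x C Q B S * W_comp g x A S Q E
    + W_end g x C Q Q S * W_comp g x A B S E + W_end g x C Q E S * W_comp g x A B Q S
    + W_end g x E Q A S * W_comp g x S B C Q + W_end g x E Q B S * W_comp g x A S C Q
    + W_end g x E Q C S * W_comp g x A B S Q + W_end g x E Q Q S * W_comp g x A B C S)"
  by (rule W_sharp_sharp_expand) (simp add: W_tractor_def)

lemma W_sharp_sharp_Y: "W_sharp_sharp g (W_tractor g) x [TY, B, C, E] = 0"
  by (simp add: W_sharp_sharp_W W_end_eq W_comp_simps W_comp_TY)

text \<open>Exchanging A and B permutes the sixteen terms, and the factor \<open>W_comp\<close>
  contributes one sign to each.\<close>

lemma W_sharp_sharp_skew:
  assumes x: "x \<in> U"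
  shows "W_sharp_sharp g (W_tractor g) x [B, A, C, E] =
      - W_sharp_sharp g (W_tractor g) x [A, B, C, E]"
  unfolding W_sharp_sharp_W sum_negf[symmetric]
proof (intro sum.cong refl)
  fix Q S
  have s: "W_comp g x P R C' E' = - W_comp g x R P C' E'" for P R C' E' by (rule W_skew[OF x])
  show "W_end g x B Q Q S * W_comp g x S A C E + W_end g x B Q A S * W_comp g x Q S C E
    + W_end g x B Q C S * W_comp g x Q A S E + W_end g x B Q E S * W_comp g x Q A C S
    + W_end g x A Q B S * W_comp g x S Q C E + W_end g x A Q Q S * W_comp g x B S C E
    + W_end g x A Q C S * W_comp g x B Q S E + W_end g x A Q E S * W_comp g x B Q C S
    + W_end g x C Q B S * W_comp g x S A Q E + W_end g x C Q A S * W_comp g x B S Q E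
    + W_end g x C Q Q S * W_comp g x B A S E + W_end g x C Q E S * W_comp g x B A Q S
    + W_end g x E Q B S * W_comp g x S A C Q + W_end g x E Q A S * W_comp g x B S C Q
    + W_end g x E Q C S * W_comp g x B A S Q + W_end g x E Q Q S * W_comp g x B A C S
    = - (W_end g x A Q Q S * W_comp g x S B C E + W_end g x A Q B S * W_comp g x Q S C E
    + W_end g x A Q C S * W_comp g x Q B S E + W_end g x A Q E S * W_comp g x Q B C S
    + W_end g x B Q A S * W_comp g x S Q C E + W_end g x B Q Q S * W_comp g x A S C E
    + W_end g x B Q C S * W_comp g x A Q S E + W_end g x B Q E S * W_comp g x A Q C S
    + W_end g x C Q A S * W_comp g x S B Q E + W_end g x C Q B S * W_comp g x A S Q E
    + W_end g x C Q Q S * W_comp g x A B S E + W_end g x C Q E S * W_comp g x A B Q S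
    + W_end g x E Q A S * W_comp g x S B C Q + W_end g x E Q B S * W_comp g x A S C Q
    + W_end g x E Q C S * W_comp g x A B S Q + W_end g x E Q Q S * W_comp g x A B C S)"
    unfolding s[of S A] s[of Q S] s[of Q A] s[of B S] s[of B Q] s[of B A]
    by (simp add: algebra_simps)
qed

end

context parallel_chart
begin

text \<open>Applying \<open>W_I_aux\<close> and \<open>Omega_I\<close> expresses \<sigma> squared
  times Bach as -(d-4) times Weyl contracted twice with \<mu>, which is symmetric by the symmetries
  of Weyl. No derivative of Cotton has to be computed.\<close>

lemma bach_sym: assumes x: "x \<in> U" shows "bach g x e b = bach g x b e"
proof -
  let ?s = "I x TY" and ?m = "real CARD('n) - 4"
  have A: "?s * cotton g x e a b = - (\<Sum>c\<in>UNIV. I_low x (TZ c) * weyl g x a b e c)" for a b e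
    using Omega_I[OF x, of a b "TZ e"] by (simp add: sum_tix I_low_simps)
  have B: "?s * ?s * bach g x e b =
      - (?m * (\<Sum>a\<in>UNIV. \<Sum>c\<in>UNIV. I_low x (TZ a) * I_low x (TZ c) * weyl g x a b e c))" for e b
  proof -
    have "?s * bach g x e b = ?m * (\<Sum>a\<in>UNIV. I_low x (TZ a) * cotton g x e a b)"
      using W_I_aux[OF x, of b TX "TZ e"] by (simp add: sum_negf)
    then have "?s * ?s * bach g x e b = ?m * (\<Sum>a\<in>UNIV. I_low x (TZ a) * (?s * cotton g x e a b))"
      by (simp add: sum_distrib_left mult_ac)
    then show ?thesis unfolding A by (simp add: sum_negf sum_distrib_left mult_ac)
  qed
  have "(\<Sum>a\<in>UNIV. \<Sum>c\<in>UNIV. I_low x (TZ a) * I_low x (TZ c) * weyl g x a b e c) =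
      (\<Sum>a\<in>UNIV. \<Sum>c\<in>UNIV. I_low x (TZ c) * I_low x (TZ a) * weyl g x c b e a)"
    by (rule sum.swap)
  also have "\<dots> = (\<Sum>a\<in>UNIV. \<Sum>c\<in>UNIV. I_low x (TZ a) * I_low x (TZ c) * weyl g x a e b c)"
  proof (intro sum.cong refl)
    fix a c
    have "weyl g x c b e a = weyl g x a e b c"
      using weyl_pair[OF x, of c b e a] weyl_skew1[OF x, of e a c b] weyl_skew2[OF x, of a e c b] by simp
    then show "I_low x (TZ c) * I_low x (TZ a) * weyl g x c b e a = I_low x (TZ a) * I_low x (TZ c) * weyl g x a e b c" by simp
  qed
  finally have "?s * ?s * bach g x e b = ?s * ?s * bach g x b e" by (simp only: B)
  then show ?thesis using sigma_nz[OF x] by simp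
qed

text \<open>The cyclic identities of Weyl and Cotton carry over to W; in the entry
  \<open>C = E = TX\<close> the claim is the symmetry of Bach.\<close>

lemma W_cyclic: assumes x: "x \<in> U"
  shows "W_comp g x C (TZ p) E (TZ r) - W_comp g x C (TZ r) E (TZ p) =
      (real CARD('n) - 4) * Omega g x p r C E"
proof (cases C; cases E)
  fix c e assume CE: "C = TZ c" "E = TZ e"
  have "weyl g x c p e r - weyl g x c r e p = weyl g x p r c e"
    using weyl_cyclic[OF x, of p e c r] weyl_pair[OF x] weyl_skew1[OF x] weyl_skew2[OF x] 
      weyl_cyclic[OF x, of p r c e] by (smt (verit))
  then show ?thesis unfolding CE by (simp add: W_comp_simps right_diff_distrib[symmetric])
next
  fix e assume CE: "C = TX" "E = TZ e"
  have "cotton g x p e r - cotton g x r e p = cotton g x e p r"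
    using cotton_cyclic[OF x, of p e r] cotton_skew[OF x, of r p e] cotton_skew[OF x, of e p r]
    by simp
  then show ?thesis unfolding CE
    by (simp add: W_comp_simps minus_diff_commute[symmetric] flip: right_diff_distrib) (simp add: algebra_simps)
next
  fix c assume CE: "C = TZ c" "E = TX"
  have "cotton g x p c r - cotton g x r c p = cotton g x c p r"
    using cotton_cyclic[OF x, of p c r] cotton_skew[OF x, of r p c] cotton_skew[OF x, of c p r]
    by simp
  then show ?thesis unfolding CE
    by (simp add: W_comp_simps flip: right_diff_distrib)
qed (auto simp: W_comp_simps W_comp_TY bach_sym[OF x, of r p])

lemma W_pair_X: assumes x: "x \<in> U"
  shows "W_comp g x E (TZ r) C (TZ p) = W_comp g x C (TZ p) E (TZ r)"
proof (cases "C = TX \<and> E = TX")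
  case True
  then show ?thesis by (simp add: W_comp_simps bach_sym[OF x, of p r])
next
  case False
  then show ?thesis
    using weyl_pair[OF x, of _ r _ p] by (cases C; cases E) (auto simp: W_comp_simps W_comp_TY left_diff_distrib)
qed

text \<open>Four of the sixteen terms are traces and vanish; the other twelve come in equal pairs.
  The pairs acting within ab (\<open>?F\<close>) and within CE (\<open>?Z\<close>) also agree up to
  a factor d-4 and make up \<open>weyl_Omega\<close>; the mixed ones \<open>?A\<close> to
  \<open>?D\<close> form \<open>Omega_sharp_Omega\<close>.\<close>

lemma W_sharp_sharp_ZZ: assumes x: "x \<in> U"
  shows "W_sharp_sharp g (W_tractor g) x [TZ a, TZ b, C, E] =
    (real CARD('n) - 4)\<^sup>2 * (4 * weyl_Omega x a b C E - 2 * Omega_sharp_Omega x a b C E + 2 * Omega_sharp_Omega x b a C E)"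
proof -
  let ?m = "real CARD('n) - 4"
  have pull: "?m * X * (?m * Y) = ?m\<^sup>2 * (X * Y)" for X Y by (simp add: power2_eq_square)
  note WS = W_comp_simps(1) W_pair'[OF x] pull tr2_cmult
  note Y = W_comp_simps W_comp_TY
  let ?V = "W_end g x" and ?W = "W_comp g x"
  let ?A = "tr2 x (\<lambda>p q r s. Omega g x a p C (TZ r) * Omega g x q b (TZ s) E)"
  let ?B = "tr2 x (\<lambda>p q r s. Omega g x a p E (TZ r) * Omega g x q b C (TZ s))"
  let ?C = "tr2 x (\<lambda>p q r s. Omega g x b p C (TZ r) * Omega g x a q (TZ s) E)"
  let ?D = "tr2 x (\<lambda>p q r s. Omega g x b p E (TZ r) * Omega g x a q C (TZ s))"
  let ?F = "tr2 x (\<lambda>p q r s. weyl g x a p b r * Omega g x q s C E)"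
  let ?Z = "tr2 x (\<lambda>p q r s. ?W C (TZ p) E (TZ r) * Omega g x a b (TZ q) (TZ s))"
  have t1: "(\<Sum>Q\<in>UNIV. \<Sum>S\<in>UNIV. ?V (TZ a) Q Q S * ?W S (TZ b) C E) = 0"
    by (rule W_end_trace[OF x]) (simp add: Y)
  have t6: "(\<Sum>Q\<in>UNIV. \<Sum>S\<in>UNIV. ?V (TZ b) Q Q S * ?W (TZ a) S C E) = 0"
    by (rule W_end_trace[OF x]) (simp add: Y)
  have t11: "(\<Sum>Q\<in>UNIV. \<Sum>S\<in>UNIV. ?V C Q Q S * ?W (TZ a) (TZ b) S E) = 0"
    by (rule W_end_trace[OF x]) (rule W_comp_TY)
  have t16: "(\<Sum>Q\<in>UNIV. \<Sum>S\<in>UNIV. ?V E Q Q S * ?W (TZ a) (TZ b) C S) = 0"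
    by (rule W_end_trace[OF x]) (rule W_comp_TY)
  have t2: "(\<Sum>Q\<in>UNIV. \<Sum>S\<in>UNIV. ?V (TZ a) Q (TZ b) S * ?W Q S C E) = ?m\<^sup>2 * ?F"
    by (subst W_end_contract) (simp_all add: Y(5,6) WS)
  have t5: "(\<Sum>Q\<in>UNIV. \<Sum>S\<in>UNIV. ?V (TZ b) Q (TZ a) S * ?W S Q C E) = ?m\<^sup>2 * ?F"
    by (subst W_end_contract, simp_all only: Y(5,6), subst tr2_swap)
      (simp add: WS weyl_pair[OF x, of b _ a])
  have t3: "(\<Sum>Q\<in>UNIV. \<Sum>S\<in>UNIV. ?V (TZ a) Q C S * ?W Q (TZ b) S E) = ?m\<^sup>2 * ?A"
    by (subst W_end_contract) (simp_all only: Y(5,6) W_comp_TY WS)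
  have t9: "(\<Sum>Q\<in>UNIV. \<Sum>S\<in>UNIV. ?V C Q (TZ a) S * ?W S (TZ b) Q E) = ?m\<^sup>2 * ?A"
    by (subst W_end_contract, simp_all only: Y(5,6) W_comp_TY, subst tr2_swap) (simp only: WS)
  have t4: "(\<Sum>Q\<in>UNIV. \<Sum>S\<in>UNIV. ?V (TZ a) Q E S * ?W Q (TZ b) C S) = ?m\<^sup>2 * ?B"
    by (subst W_end_contract) (simp_all only: Y(5,6) W_comp_TY WS)
  have t13: "(\<Sum>Q\<in>UNIV. \<Sum>S\<in>UNIV. ?V E Q (TZ a) S * ?W S (TZ b) C Q) = ?m\<^sup>2 * ?B"
    by (subst W_end_contract, simp_all only: Y(5,6) W_comp_TY, subst tr2_swap) (simp only: WS)
  have t7: "(\<Sum>Q\<in>UNIV. \<Sum>S\<in>UNIV. ?V (TZ b) Q C S * ?W (TZ a) Q S E) = ?m\<^sup>2 * ?C"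
    by (subst W_end_contract) (simp_all only: Y(5,6) W_comp_TY WS)
  have t10: "(\<Sum>Q\<in>UNIV. \<Sum>S\<in>UNIV. ?V C Q (TZ b) S * ?W (TZ a) S Q E) = ?m\<^sup>2 * ?C"
    by (subst W_end_contract, simp_all only: Y(5,6) W_comp_TY, subst tr2_swap) (simp only: WS)
  have t8: "(\<Sum>Q\<in>UNIV. \<Sum>S\<in>UNIV. ?V (TZ b) Q E S * ?W (TZ a) Q C S) = ?m\<^sup>2 * ?D"
    by (subst W_end_contract) (simp_all only: Y(5,6) W_comp_TY WS)
  have t14: "(\<Sum>Q\<in>UNIV. \<Sum>S\<in>UNIV. ?V E Q (TZ b) S * ?W (TZ a) S C Q) = ?m\<^sup>2 * ?D"
    by (subst W_end_contract, simp_all only: Y(5,6) W_comp_TY, subst tr2_swap) (simp only: WS)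
  have t12: "(\<Sum>Q\<in>UNIV. \<Sum>S\<in>UNIV. ?V C Q E S * ?W (TZ a) (TZ b) Q S) = ?m * ?Z"
    by (subst W_end_contract) (simp_all only: W_comp_TY W_comp_simps(1) mult.left_commute[of _ ?m] tr2_cmult)
  have t15: "(\<Sum>Q\<in>UNIV. \<Sum>S\<in>UNIV. ?V E Q C S * ?W (TZ a) (TZ b) S Q) = ?m * ?Z"
    by (subst W_end_contract, simp_all only: W_comp_TY, subst tr2_swap)
      (simp only: W_pair_X[OF x, of E _ C] W_comp_simps(1) mult.left_commute[of _ ?m] tr2_cmult)
  \<comment> \<open>As \<Omega> is skew in q and s, only the part of \<open>weyl g x a p b r\<close>
    skew in p and r counts, and that is half of \<open>weyl g x a b p r\<close>.\<close>
  have F: "2 * ?F = tr2 x (\<lambda>p q r s. Omega g x a b (TZ p) (TZ r) * Omega g x q s C E)"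
  proof -
    have "?F = tr2 x (\<lambda>p q r s. weyl g x a r b p * Omega g x s q C E)" by (rule tr2_swap)
    also have "\<dots> = tr2 x (\<lambda>p q r s. - (weyl g x a r b p * Omega g x q s C E))"
      by (intro arg_cong[of _ _ "tr2 x"] ext) (metis Omega_skew1[OF x] mult_minus_right)
    finally have "2 * ?F = tr2 x (\<lambda>p q r s. weyl g x a p b r * Omega g x q s C E + - (weyl g x a r b p * Omega g x q s C E))"
      by (simp only: tr2_add)
    also have "\<dots> = tr2 x (\<lambda>p q r s. Omega g x a b (TZ p) (TZ r) * Omega g x q s C E)"
    proof (intro arg_cong[of _ _ "tr2 x"] ext)
      fix p q r s
      have "weyl g x a p b r - weyl g x a r b p = weyl g x a b p r"
        using weyl_cyclic[OF x, of p b a r] weyl_cyclic[OF x, of p r a b] weyl_pair[OF x]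
          weyl_skew1[OF x] weyl_skew2[OF x] by (smt (verit))
      then show "weyl g x a p b r * Omega g x q s C E + - (weyl g x a r b p * Omega g x q s C E) =
          Omega g x a b (TZ p) (TZ r) * Omega g x q s C E"
        by (simp flip: left_diff_distrib)
    qed
    finally show ?thesis .
  qed
  \<comment> \<open>The same argument with the pairs ab and CE exchanged; \<open>W_cyclic\<close>
    replaces the cyclic identity of Weyl.\<close>
  have Z: "2 * ?Z = ?m * tr2 x (\<lambda>p q r s. Omega g x p r C E * Omega g x a b (TZ q) (TZ s))"
  proof -
    have "?Z = tr2 x (\<lambda>p q r s. ?W C (TZ r) E (TZ p) * Omega g x a b (TZ s) (TZ q))" by (rule tr2_swap)
    also have "\<dots> = tr2 x (\<lambda>p q r s. - (?W C (TZ r) E (TZ p) * Omega g x a b (TZ q) (TZ s)))"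
      by (intro arg_cong[of _ _ "tr2 x"] ext) (metis Omega_skew2[OF x] mult_minus_right)
    finally have "2 * ?Z = tr2 x (\<lambda>p q r s. ?W C (TZ p) E (TZ r) * Omega g x a b (TZ q) (TZ s)
        + - (?W C (TZ r) E (TZ p) * Omega g x a b (TZ q) (TZ s)))"
      by (simp only: tr2_add)
    also have "\<dots> = tr2 x (\<lambda>p q r s. ?m * (Omega g x p r C E * Omega g x a b (TZ q) (TZ s)))"
    proof (intro arg_cong[of _ _ "tr2 x"] ext)
      fix p q r s
      show "?W C (TZ p) E (TZ r) * Omega g x a b (TZ q) (TZ s) +
          - (?W C (TZ r) E (TZ p) * Omega g x a b (TZ q) (TZ s))
        = ?m * (Omega g x p r C E * Omega g x a b (TZ q) (TZ s))"
        unfolding mult.assoc[symmetric] W_cyclic[OF x, symmetric] by (simp add: left_diff_distrib)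
    qed
    finally show ?thesis by (simp only: tr2_cmult)
  qed
  have FZ: "?Z = ?m * ?F"
  proof -
    have "tr2 x (\<lambda>p q r s. Omega g x a b (TZ p) (TZ r) * Omega g x q s C E) =
        tr2 x (\<lambda>p q r s. Omega g x a b (TZ q) (TZ s) * Omega g x p r C E)"
      by (rule tr2_flip[OF x])
    then have "2 * ?Z = ?m * (2 * ?F)" unfolding F Z by (simp add: mult.commute)
    then show ?thesis by simp
  qed
  have F': "?F = weyl_Omega x a b C E"
    unfolding weyl_Omega_def
  proof (intro arg_cong[of _ _ "tr2 x"] ext)
    fix p q r s
    show "weyl g x a p b r * Omega g x q s C E = weyl g x p a r b * Omega g x q s C E"
      using weyl_skew1[OF x, of a p b r] weyl_skew2[OF x, of p a b r] by simp
  qed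
  have OSab: "Omega_sharp_Omega x a b C E = - ?A - ?B"
    unfolding Omega_sharp_Omega_def tr2_add tr2_minus[symmetric] diff_conv_add_uminus
    by (intro arg_cong2[of _ _ _ _ "(+)"] arg_cong[of _ _ "tr2 x"] ext)
      (metis Omega_skew1[OF x] mult_minus_left)+
  have OSba: "Omega_sharp_Omega x b a C E = ?C + ?D"
    unfolding Omega_sharp_Omega_def tr2_add
    by (intro arg_cong2[of _ _ _ _ "(+)"] arg_cong[of _ _ "tr2 x"] ext)
      (metis Omega_skew1[OF x] minus_mult_minus)+
  show ?thesis
    unfolding W_sharp_sharp_W sum.distrib t1 t2 t3 t4 t5 t6 t7 t8 t9 t10 t11 t12 t13 t14 t15 t16 OSab OSba FZ F'
    by (simp add: algebra_simps power2_eq_square)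
qed

end

section \<open>The operator \<open>I\<^sup>AD\<^sub>A\<close> on \<open>W\<close>\<close>

text \<open>The scalar core of \<open>I_D_W_ZZ\<close>, with m = d-4, s = \<sigma>, r = \<rho>. For
  the orders ab and ba, n stands for \<open>nabla_W_X\<close>, p for \<open>schouten_Omega\<close>,
  M for \<mu> contracted with \<nabla>\<Omega>, k for \<mu> times \<open>W_X\<close>, X for
  \<open>Omega_sharp_Omega\<close>; Psi is \<open>weyl_Omega\<close>. The terms in J, Psi, X1, X2
  cancel against those of \<kappa>1 - \<kappa>2, and the rest is m-2 times the difference of the
  first two assumptions.\<close>

lemma W_comp_I_cancel:
  fixes s m n :: real
  assumes "s * n1 = s * (m * p1) - m * M1 - k1 + m * r * Om0"
    and "s * n2 = s * (m * p2) - m * M2 - k2 - m * r * Om0"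
    and "\<kappa>1 = (m + 1) * p1 + p2 + J * Om0 - Psi + X1"
    and "\<kappa>2 = (m + 1) * p2 + p1 - J * Om0 + Psi + X2"
    and "m \<noteq> 0"
  shows "s * (- (m * (- n1 + n2 + (\<kappa>1 - \<kappa>2)) + n1 - n2 + (n1 - m * p1) - m * p1 - (n2 - m * p2) +
      m * p2)
      - - 2 * J * (m * Om0) - 1 / (2 * m) * (m\<^sup>2 * (4 * Psi - 2 * X1 + 2 * X2)))
    + (m - 2) * (m * (M1 - M2) + k1 - k2 - 2 * r * (m * Om0)) = 0"
proof -
  have q: "1 / (2 * m) * (m\<^sup>2 * (4 * Psi - 2 * X1 + 2 * X2)) = m * (2 * Psi - X1 + X2)"
    using assms(5) by (simp add: power2_eq_square field_simps)
  have "s * (- (m * (- n1 + n2 + (\<kappa>1 - \<kappa>2)) + n1 - n2 + (n1 - m * p1) - m * p1 - (n2 - m * p2) +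
      m * p2)
      - - 2 * J * (m * Om0) - 1 / (2 * m) * (m\<^sup>2 * (4 * Psi - 2 * X1 + 2 * X2)))
    + (m - 2) * (m * (M1 - M2) + k1 - k2 - 2 * r * (m * Om0))
    = (m - 2) * ((s * n1 - (s * (m * p1) - m * M1 - k1 + m * r * Om0))
        - (s * n2 - (s * (m * p2) - m * M2 - k2 - m * r * Om0)))"
    unfolding q assms(3,4) by (simp add: algebra_simps)
  then show ?thesis unfolding assms(1,2) by simp
qed

context chart_metric
begin

text \<open>This is \<open>I^A D_A W\<close> at weight w = -2: \<open>d - 6\<close> is
  \<open>d + 2w - 2\<close>, and \<open>- - 2\<close> is \<open>- w\<close>.\<close>

definition I_D_W :: "(real^'n \<Rightarrow> 'n tix \<Rightarrow> real) \<Rightarrow> real^'n \<Rightarrow> 'n tix \<Rightarrow> 'n tix \<Rightarrow> 'n tix \<Rightarrow> 'n tix \<Rightarrow> real" where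
  "I_D_W I x A B C E =
      I x TY * (- tr x (\<lambda>h f. nabla2_W x h f A B C E) - - 2 * Jsc g x * W_comp g x A B C E
      - 1 / (2 * (real CARD('n) - 4)) * W_sharp_sharp g (W_tractor g) x [A, B, C, E])
    + (real CARD('n) - 6) * ((\<Sum>a\<in>UNIV. (\<Sum>b\<in>UNIV. ginv g x a b * I x (TZ b)) * nabla_W x a A B C E)
      - 2 * I x TX * W_comp g x A B C E)"

lemma contract_tractor_D:
  assumes x: "x \<in> U"
  shows "(\<Sum>P\<in>UNIV. \<Sum>Q\<in>UNIV. tractor_metric g x P Q * I x P *
      tractor_D g (-2) (W_tractor g) x Q [A, B, C, E]) = I_D_W I x A B C E"
proof -
  have Z: "(\<Sum>a\<in>UNIV. Ztr (TZ b) a * tractor_nabla g a (W_tractor g) x [A, B, C, E]) =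
      nabla_W x b A B C E" for b
    by (simp add: Ztr_def tractor_nabla_W sum_delta_simps)
  have "(\<Sum>a\<in>UNIV. \<Sum>b\<in>UNIV. ginv g x a b * I x (TZ a) * nabla_W x b A B C E) =
      (\<Sum>a\<in>UNIV. (\<Sum>b\<in>UNIV. ginv g x a b * I x (TZ b)) * nabla_W x a A B C E)"
    by (subst sum.swap) (simp add: sum_distrib_right ginv_sym[OF x, of _ _])
  moreover have "W_tractor g x [A, B, C, E] = W_comp g x A B C E" by (simp add: W_tractor_def)
  moreover have "tractor_D g (-2) (W_tractor g) x TX [A, B, C, E] =
      - tr x (\<lambda>h f. nabla2_W x h f A B C E)
      - - 2 * Jsc g x * W_comp g x A B C E
      - 1 / (2 * (real CARD('n) - 4)) * W_sharp_sharp g (W_tractor g) x [A, B, C, E]"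
    by (simp add: tractor_D_def Ytr_def Ztr_def Xtr_def tractor_box_def tractor_laplacian_W W_tractor_def)
  moreover have "tractor_D g (-2) (W_tractor g) x TY [A, B, C, E] =
      (real CARD('n) - 6) * - 2 * W_comp g x A B C E"
    by (simp add: tractor_D_def Ytr_def Ztr_def Xtr_def W_tractor_def)
  moreover have "tractor_D g (-2) (W_tractor g) x (TZ b) [A, B, C, E] =
      (real CARD('n) - 6) * nabla_W x b A B C E" for b
    by (simp add: tractor_D_def Ytr_def Xtr_def Z)
  ultimately show ?thesis
    by (simp add: sum_tix I_D_W_def mult.left_commute[of _ "real CARD('n) - 6"] flip: sum_distrib_left)
      (simp add: algebra_simps)
qed

lemma smooth_I_D_W:
  assumes "\<And>A. smooth_on U (\<lambda>x. I x A)"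
  shows "smooth_on U (\<lambda>x. I_D_W I x A B C E)"
  unfolding I_D_W_def tr_def W_sharp_sharp_W W_end_eq
  by (intro smooth_intros smooth_geometry smooth_tractor_metric smooth_W_comp smooth_nabla_W smooth_nabla2_W assms)

end

context parallel_chart
begin

lemma nabla_W_I: assumes x: "x \<in> U" shows "(\<Sum>A\<in>UNIV. I_low x A * nabla_W x f A B C E) = 0"
proof -
  have "(\<Sum>A\<in>UNIV. I_low x A * nabla_W x f A B C E) =
      cov (mconn g) f (\<lambda>y As. \<Sum>C\<in>UNIV. I_low y C * W_tensor y (Inr C # As)) x [Inr B, Inr C, Inr E]"
    unfolding nabla_W_def by (rule cov_contract_I[OF x smooth_W_tensor])
  also have "\<dots> = cov (mconn g) f (\<lambda>_ _. 0) x [Inr B, Inr C, Inr E]"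
  proof (rule cov_cong_kind[OF x])
    fix y and Bs :: "('n + 'n tix) list"
    assume y: "y \<in> U" and k: "map isl Bs = map isl [Inr B :: 'n + 'n tix, Inr C, Inr E]"
    then show "(\<Sum>C\<in>UNIV. I_low y C * W_tensor y (Inr C # Bs)) = 0"
      using W_I[OF y] by (simp add: W_tensor_def)
  qed
  also have "\<dots> = 0" by (simp add: cov_def)
  finally show ?thesis .
qed

lemma nabla2_W_I: assumes x: "x \<in> U" shows "(\<Sum>A\<in>UNIV. I_low x A * nabla2_W x h f A B C E) = 0"
proof -
  define T :: "real^'n \<Rightarrow> ('n + 'n tix) list \<Rightarrow> real" where
    \<comment> \<open>The slot A is moved in front of the derivative slot f, as
      \<open>cov_contract_I\<close> requires.\<close>
    "T = (\<lambda>y As. if map isl As = [False, True, False, False, False]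
      then nabla_W y (projl (As ! 1)) (projr (As ! 0)) (projr (As ! 2)) (projr (As ! 3)) (projr (As ! 4)) else 0)"
  have T: "mc.smooth_tensor T"
    unfolding T_def by (intro allI smooth_on_if[OF U] smooth_nabla_W smooth_on_const[OF U])
  have "nabla2_W x h f A B C E = cov (mconn g) h T x [Inr A, Inl f, Inr B, Inr C, Inr E]" for A
    by (simp add: cov_def nabla2_W_expand T_def sum_Plus sum_negf)
  then have "(\<Sum>A\<in>UNIV. I_low x A * nabla2_W x h f A B C E) =
      cov (mconn g) h (\<lambda>y As. \<Sum>C\<in>UNIV. I_low y C * T y (Inr C # As)) x [Inl f, Inr B, Inr C, Inr E]"
    using cov_contract_I[OF x T, of h "[Inl f, Inr B, Inr C, Inr E]"] by simp
  also have "\<dots> = cov (mconn g) h (\<lambda>_ _. 0) x [Inl f, Inr B, Inr C, Inr E]"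
  proof (rule cov_cong_kind[OF x])
    fix y and Bs :: "('n + 'n tix) list"
    assume y: "y \<in> U" and k: "map isl Bs = map isl [Inl f, Inr B, Inr C, Inr E]"
    then show "(\<Sum>C\<in>UNIV. I_low y C * T y (Inr C # Bs)) = 0"
      using nabla_W_I[OF y] by (simp add: T_def)
  qed
  also have "\<dots> = 0" by (simp add: cov_def)
  finally show ?thesis .
qed

text \<open>The contraction is in the second pair; for every first pair the remaining tensor is a
  multiple of \<Omega> or \<open>W_X\<close>, and I annihilates both.\<close>

lemma W_I3: assumes x: "x \<in> U" shows "(\<Sum>A\<in>UNIV. I_low x A * W_comp g x P B A E) = 0"
proof -
  have "(\<Sum>A\<in>UNIV. I_low x A * (c * f A)) =
      c * (\<Sum>A\<in>UNIV. I_low x A * f A)" for c and f :: "'n tix \<Rightarrow> real"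
    by (simp add: sum_distrib_left mult_ac)
  then show ?thesis
    by (cases P; cases B) (simp_all add: W_comp_simps Omega_I'[OF x] W_X_I[OF x] sum_negf)
qed

lemma W_end_I: assumes x: "x \<in> U"
  shows "(\<Sum>A\<in>UNIV. I_low x A * W_end g x A Q R S) = 0" "(\<Sum>A\<in>UNIV. I_low x A * W_end g x P Q A S) =
      0"
proof -
  have "(\<Sum>A\<in>UNIV. I_low x A * (\<Sum>B\<in>UNIV. \<Sum>E\<in>UNIV. f A B E * h B E)) =
      (\<Sum>B\<in>UNIV. \<Sum>E\<in>UNIV. (\<Sum>A\<in>UNIV. I_low x A * f A B E) * h B E)" for f :: "'n tix \<Rightarrow> 'n tix \<Rightarrow> 'n tix \<Rightarrow> real" and h
  proof -
    have "(\<Sum>A\<in>UNIV. I_low x A * (\<Sum>B\<in>UNIV. \<Sum>E\<in>UNIV. f A B E * h B E)) =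
        (\<Sum>A\<in>UNIV. \<Sum>B\<in>UNIV. \<Sum>E\<in>UNIV. I_low x A * f A B E * h B E)"
      by (simp add: sum_distrib_left mult.assoc)
    also have "\<dots> = (\<Sum>B\<in>UNIV. \<Sum>A\<in>UNIV. \<Sum>E\<in>UNIV. I_low x A * f A B E * h B E)" by (rule sum.swap)
    also have "\<dots> = (\<Sum>B\<in>UNIV. \<Sum>E\<in>UNIV. \<Sum>A\<in>UNIV. I_low x A * f A B E * h B E)"
      by (intro sum.cong refl sum.swap)
    finally show ?thesis by (simp add: sum_distrib_right)
  qed
  note this[of "\<lambda>A B E. W_comp g x A B R E" "\<lambda>B E. tractor_metric g x B Q * tractor_metric g x E S"]
    this[of "\<lambda>A B E. W_comp g x P B A E" "\<lambda>B E. tractor_metric g x B Q * tractor_metric g x E S"]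
  then show "(\<Sum>A\<in>UNIV. I_low x A * W_end g x A Q R S) = 0" "(\<Sum>A\<in>UNIV. I_low x A * W_end g x P Q A S) = 0"
    by (simp_all add: W_end_eq W_I[OF x] W_I3[OF x] mult.assoc)
qed

text \<open>In each of the sixteen terms the index A is the first or third index of
  \<open>W_end\<close> or the first of \<open>W_comp\<close>, where I contracts to zero.\<close>

lemma W_sharp_sharp_I: assumes x: "x \<in> U"
  shows "(\<Sum>A\<in>UNIV. I_low x A * W_sharp_sharp g (W_tractor g) x [A, B, C, E]) = 0"
proof -
  have z: "(\<Sum>A\<in>UNIV. I_low x A * (f A * w)) = 0" "(\<Sum>A\<in>UNIV. I_low x A * (w * f A)) = 0"
    if "(\<Sum>A\<in>UNIV. I_low x A * f A) = 0" for f :: "'n tix \<Rightarrow> real" and w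
  proof -
    have "(\<Sum>A\<in>UNIV. I_low x A * (f A * w)) = (\<Sum>A\<in>UNIV. I_low x A * f A) * w"
      "(\<Sum>A\<in>UNIV. I_low x A * (w * f A)) = w * (\<Sum>A\<in>UNIV. I_low x A * f A)"
      by (simp_all add: sum_distrib_left sum_distrib_right mult_ac)
    with that show "(\<Sum>A\<in>UNIV. I_low x A * (f A * w)) = 0" "(\<Sum>A\<in>UNIV. I_low x A * (w * f A)) = 0" by simp_all
  qed
  have sw: "(\<Sum>A\<in>UNIV. I_low x A * (\<Sum>Q\<in>UNIV. \<Sum>S\<in>UNIV. F A Q S)) =
      (\<Sum>Q\<in>UNIV. \<Sum>S\<in>UNIV. \<Sum>A\<in>UNIV. I_low x A * F A Q S)"
    for F :: "'n tix \<Rightarrow> 'n tix \<Rightarrow> 'n tix \<Rightarrow> real"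
  proof -
    have "(\<Sum>A\<in>UNIV. I_low x A * (\<Sum>Q\<in>UNIV. \<Sum>S\<in>UNIV. F A Q S)) =
        (\<Sum>Q\<in>UNIV. \<Sum>A\<in>UNIV. \<Sum>S\<in>UNIV. I_low x A * F A Q S)"
      by (simp only: sum_distrib_left) (rule sum.swap)
    also have "\<dots> = (\<Sum>Q\<in>UNIV. \<Sum>S\<in>UNIV. \<Sum>A\<in>UNIV. I_low x A * F A Q S)"
      by (intro sum.cong refl sum.swap)
    finally show ?thesis .
  qed
  show ?thesis
    unfolding W_sharp_sharp_W sw
    by (simp only: distrib_left sum.distrib z[OF W_I[OF x]] z[OF W_end_I(1)[OF x]] z[OF W_end_I(2)[OF x]]
      add_0 sum.neutral_const)
qed

lemma I_D_W_eq:
  "I_D_W I x A B C E =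
      I x TY * (- tr x (\<lambda>h f. nabla2_W x h f A B C E) - - 2 * Jsc g x * W_comp g x A B C E
      - 1 / (2 * (real CARD('n) - 4)) * W_sharp_sharp g (W_tractor g) x [A, B, C, E])
    + (real CARD('n) - 6) * ((\<Sum>a\<in>UNIV. I_low x (TZ a) * nabla_W x a A B C E) -
        2 * I x TX * W_comp g x A B C E)"
  by (simp add: I_D_W_def I_low_simps)

context
  fixes x assumes x: "x \<in> U"
begin

lemma I_low_g: "(\<Sum>a\<in>UNIV. I_low x (TZ a) * g x $ f $ a) = I x (TZ f)"
  using lower_ginv[OF x, of f "\<lambda>e. I x (TZ e)"] by (simp add: I_low_simps g_sym[OF x, of f] mult.commute)

text \<open>The Bianchi identity trades the derivative in direction \<mu> for derivatives in
  directions p and q, the form in which \<nabla>\<Omega> appears in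
  \<open>sigma_nabla_W_X\<close>.\<close>

lemma mu_nabla_W_ZZ: "(\<Sum>a\<in>UNIV. I_low x (TZ a) * nabla_W x a (TZ p) (TZ q) C E) =
    (real CARD('n) - 4) * ((\<Sum>a\<in>UNIV. I_low x (TZ a) * nabla_Omega x p a q C E) - (\<Sum>a\<in>UNIV. I_low x (TZ a) * nabla_Omega x q a p C E))
    + I x (TZ p) * W_X g x q C E - I x (TZ q) * W_X g x p C E"
proof -
  have B: "nabla_Omega x a p q C E = nabla_Omega x p a q C E - nabla_Omega x q a p C E" for a
    using nabla_Omega_bianchi[OF x, of a p q C E] nabla_Omega_skew1[OF x, of p a q C E] by simp
  have g: "(\<Sum>a\<in>UNIV. I_low x (TZ a) * (g x $ a $ p * w)) = I x (TZ p) * w" for p w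
    using I_low_g[of p] by (simp add: mult.assoc[symmetric] sum_distrib_right[symmetric] g_sym[OF x, of _ p])
  show ?thesis
    unfolding nabla_W_ZZ[OF x] B
    by (simp add: distrib_left right_diff_distrib sum.distrib sum_subtractf g sum_distrib_left
        mult.left_commute[of _ "real CARD('n) - 4"])
qed

text \<open>The entry \<open>B = TZ b\<close> of \<open>nabla_W_I\<close>, solved for its
  \<open>TX\<close> term: \<sigma> times the derivative of \<open>W_X\<close>, hence of Bach, needs
  only first derivatives of \<Omega>.\<close>

lemma sigma_nabla_W_X:
  "I x TY * nabla_W_X x f b C E = I x TY * ((real CARD('n) - 4) * schouten_Omega x f b C E)
    - (real CARD('n) - 4) * (\<Sum>a\<in>UNIV. I_low x (TZ a) * nabla_Omega x f a b C E) -
        I x (TZ f) * W_X g x b C E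
    + (real CARD('n) - 4) * I x TX * Omega g x f b C E"
proof -
  have "(\<Sum>a\<in>UNIV. I_low x (TZ a) * nabla_W x f (TZ a) (TZ b) C E) =
      (real CARD('n) - 4) * (\<Sum>a\<in>UNIV. I_low x (TZ a) * nabla_Omega x f a b C E)
      + (\<Sum>a\<in>UNIV. I_low x (TZ a) * g x $ f $ a) * W_X g x b C E
      - g x $ f $ b * (\<Sum>a\<in>UNIV. I_low x (TZ a) * W_X g x a C E)"
    unfolding nabla_W_ZZ[OF x]
    by (simp add: distrib_left right_diff_distrib sum.distrib sum_subtractf sum_distrib_left
        sum_distrib_right mult_ac)
  then have Z: "(\<Sum>a\<in>UNIV. I_low x (TZ a) * nabla_W x f (TZ a) (TZ b) C E) =
      (real CARD('n) - 4) * (\<Sum>a\<in>UNIV. I_low x (TZ a) * nabla_Omega x f a b C E) + I x (TZ f) * W_X g x b C E"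
    by (simp add: I_low_g mu_W_X[OF x])
  have "I x TX * nabla_W x f TY (TZ b) C E +
      (\<Sum>a\<in>UNIV. I_low x (TZ a) * nabla_W x f (TZ a) (TZ b) C E)
      + I x TY * nabla_W x f TX (TZ b) C E = 0"
    using nabla_W_I[OF x, of f "TZ b" C E] by (simp only: sum_tix I_low_simps(1,2))
  then show ?thesis
    unfolding Z nabla_W_YZ[OF x] nabla_W_XZ[OF x] schouten_Omega_alt[OF x] by (simp add: algebra_simps)
qed

text \<open>The derivative of \<open>W_X\<close> enters through the wave equation with coefficient
  -(d-4), and once each from the two derivatives passing through the connection: in total
  -(d-6).\<close>

lemma nabla2_W_tr_ZZ: "tr x (\<lambda>h f. nabla2_W x h f (TZ a) (TZ b) C E) =
    (real CARD('n) - 4) * (- nabla_W_X x a b C E + nabla_W_X x b a C E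
      + (tr x (\<lambda>h f. nabla2_Omega x h a f b C E - nabla2_Omega x a h f b C E) -
          tr x (\<lambda>h f. nabla2_Omega x h b f a C E - nabla2_Omega x b h f a C E)))
    + nabla_W_X x a b C E - nabla_W_X x b a C E
    + (nabla_W_X x a b C E - (real CARD('n) - 4) * schouten_Omega x a b C E) - (real CARD('n) -
        4) * schouten_Omega x a b C E
    - (nabla_W_X x b a C E - (real CARD('n) - 4) * schouten_Omega x b a C E) +
        (real CARD('n) - 4) * schouten_Omega x b a C E"
proof -
  have s: "nabla_W x f (TZ a) B C E =
      - nabla_W x f B (TZ a) C E" for f B by (rule nabla_W_skew[OF x])
  have P: "tr x (\<lambda>h f. schouten g x h a * (c * Omega g x f b C E)) =
      c * schouten_Omega x a b C E" for a b c
    by (simp add: schouten_Omega_def schouten_sym[OF x, of _ a] mult.left_commute[of _ c] tr_cmult)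
  have "tr x (\<lambda>h f. nabla2_W x h f (TZ a) (TZ b) C E) =
    (real CARD('n) - 4) * tr x (\<lambda>h f. nabla2_Omega x h f a b C E) + nabla_W_X x a b C E - nabla_W_X x b a C E
    + nabla_W x a TX (TZ b) C E - (real CARD('n) - 4) * schouten_Omega x a b C E
    - nabla_W x b TX (TZ a) C E + (real CARD('n) - 4) * schouten_Omega x b a C E"
    unfolding nabla2_W_ZZ[OF x] s[of _ TX] s[of _ TY] nabla_W_YZ[OF x]
    by (simp only: tr_linear tr_g[OF x] mult_minus_right P minus_minus)
  then show ?thesis
    unfolding nabla_W_XZ[OF x] schouten_Omega_alt[OF x] nabla2_Omega_laplace[OF x] tr_diff by simp
qed

lemma I_D_W_ZZ: "I_D_W I x (TZ a) (TZ b) C E = 0"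
proof -
  have Om0: "Omega g x b a C E = - Omega g x a b C E" by (rule Omega_skew1[OF x])
  have m: "real CARD('n) - 6 = (real CARD('n) - 4) - 2" "real CARD('n) - 3 =
      (real CARD('n) - 4) + 1" by simp_all
  have e2: "I x TY * nabla_W_X x b a C E = I x TY * ((real CARD('n) - 4) * schouten_Omega x b a C E)
    - (real CARD('n) - 4) * (\<Sum>c\<in>UNIV. I_low x (TZ c) * nabla_Omega x b c a C E) -
        I x (TZ b) * W_X g x a C E
    - (real CARD('n) - 4) * I x TX * Omega g x a b C E"
    using sigma_nabla_W_X[of b a C E] by (simp add: Om0)
  have k2: "tr x (\<lambda>h f. nabla2_Omega x h b f a C E - nabla2_Omega x b h f a C E) =
      ((real CARD('n) - 4) + 1) * schouten_Omega x b a C E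
    + schouten_Omega x a b C E - Jsc g x * Omega g x a b C E + weyl_Omega x a b C E +
        Omega_sharp_Omega x b a C E"
    using nabla2_Omega_commute_tr[OF x, of b a C E] by (simp add: Om0 weyl_Omega_skew[OF x, of b a])
  show ?thesis
    unfolding I_D_W_eq mu_nabla_W_ZZ nabla2_W_tr_ZZ W_sharp_sharp_ZZ[OF x] W_comp_simps m(1)
    by (rule W_comp_I_cancel[OF sigma_nabla_W_X e2 nabla2_Omega_commute_tr[OF x, unfolded m(2)] k2]) (use dim_neq_4 in simp)
qed

lemma I_D_W_skew: "I_D_W I x B A C E = - I_D_W I x A B C E"
proof -
  have "nabla2_W x h f B A C E = - nabla2_W x h f A B C E" "nabla_W x a B A C E =
      - nabla_W x a A B C E"
    "W_comp g x B A C E = - W_comp g x A B C E"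
    "W_sharp_sharp g (W_tractor g) x [B, A, C, E] =
        - W_sharp_sharp g (W_tractor g) x [A, B, C, E]" for h f a
    by (rule nabla2_W_skew[OF x] nabla_W_skew[OF x] W_skew[OF x] W_sharp_sharp_skew[OF x])+
  then show ?thesis by (simp add: I_D_W_eq tr_minus sum_negf algebra_simps)
qed

text \<open>The Laplacian contributes -(d-6) \<sigma> \<open>W_X\<close>, and the gradient term
  contributes the opposite by \<open>W_I_aux\<close>. The 3 in fact 1 is -(d-4) + d - 1.\<close>

lemma I_D_W_YZ: "I_D_W I x TY (TZ b) C E = 0"
proof -
  let ?K = "W_X g x b C E" and ?d = "real CARD('n)"
  have 1: "tr x (\<lambda>h f. nabla_W x f (TZ h) (TZ b) C E) = 3 * ?K"
  proof -
    have "tr x (\<lambda>h f. nabla_Omega x f h b C E) = - ?K"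
      by (subst tr_flip[OF x]) (rule nabla_Omega_div[OF x])
    then show ?thesis
      unfolding nabla_W_ZZ[OF x] by (simp add: tr_linear tr_g[OF x]) (simp add: algebra_simps)
  qed
  have 2: "tr x (\<lambda>h f. nabla2_W x h f TY (TZ b) C E) = (?d - 6) * ?K"
    unfolding nabla2_W_YZ[OF x] tr_linear 1 nabla_Omega_div[OF x] tr_g[OF x] by (simp add: algebra_simps)
  have 3: "(\<Sum>a\<in>UNIV. I_low x (TZ a) * nabla_W x a TY (TZ b) C E) = I x TY * ?K"
  proof -
    have "(\<Sum>a\<in>UNIV. I_low x (TZ a) * nabla_W x a TY (TZ b) C E) =
        - (?d - 4) * (\<Sum>a\<in>UNIV. I_low x (TZ a) * Omega g x a b C E)"
      by (simp only: nabla_W_YZ[OF x] sum_distrib_left mult.left_commute)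
    then show ?thesis using W_I_aux[OF x, of b C E] by (simp add: algebra_simps)
  qed
  show ?thesis
    unfolding I_D_W_eq 2 3 W_sharp_sharp_Y W_comp_simps by (simp add: algebra_simps)
qed

lemma I_D_W_I: "(\<Sum>A\<in>UNIV. I_low x A * I_D_W I x A B C E) = 0"
proof -
  have c: "(\<Sum>A\<in>UNIV. I_low x A * (c * f A)) =
      c * (\<Sum>A\<in>UNIV. I_low x A * f A)" for c and f :: "'n tix \<Rightarrow> real"
    by (simp add: sum_distrib_left mult_ac)
  have 1: "(\<Sum>A\<in>UNIV. I_low x A * tr x (\<lambda>h f. nabla2_W x h f A B C E)) = 0"
    unfolding tr_cmult[symmetric] tr_sum[symmetric] nabla2_W_I[OF x] by (rule tr_zero)
  have 2: "(\<Sum>A\<in>UNIV. I_low x A * (\<Sum>a\<in>UNIV. I_low x (TZ a) * nabla_W x a A B C E)) = 0"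
  proof -
    have "(\<Sum>A\<in>UNIV. I_low x A * (\<Sum>a\<in>UNIV. I_low x (TZ a) * nabla_W x a A B C E)) =
       (\<Sum>a\<in>UNIV. \<Sum>A\<in>UNIV. I_low x A * (I_low x (TZ a) * nabla_W x a A B C E))"
      by (simp only: sum_distrib_left) (rule sum.swap)
    then show ?thesis by (simp add: c nabla_W_I[OF x])
  qed
  define k1 k2 k3 k4 where "k1 = - I x TY" and "k2 = 2 * I x TY * Jsc g x - (real CARD('n) - 6) * 2 * I x TX"
    and "k3 = - I x TY * (1 / (2 * (real CARD('n) - 4)))" and "k4 = real CARD('n) - 6"
  have "I_D_W I x A B C E = k1 * tr x (\<lambda>h f. nabla2_W x h f A B C E) + k2 * W_comp g x A B C E
      + k3 * W_sharp_sharp g (W_tractor g) x [A, B, C, E]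
      + k4 * (\<Sum>a\<in>UNIV. I_low x (TZ a) * nabla_W x a A B C E)" for A
    unfolding I_D_W_eq k1_def k2_def k3_def k4_def by (simp only: algebra_simps)
  then show ?thesis
    by (simp only: distrib_left sum.distrib c 1 2 W_I[OF x] W_sharp_sharp_I[OF x] mult_zero_right add_0)
qed

lemma I_D_W_zero: "I_D_W I x A B C E = 0"
proof -
  have AA: "I_D_W I x A A C E = 0" for A using I_D_W_skew[of A A] by simp
  have YZ: "I_D_W I x (TZ b) TY C E = 0" for b using I_D_W_skew[of "TZ b" TY] I_D_W_YZ by simp
  \<comment> \<open>The contraction \<open>I_D_W_I\<close> has \<sigma> times this entry as its only
    term left.\<close>
  have XY: "I_D_W I x TX TY C E = 0"
    using I_D_W_I[of TY C E] sigma_nz[OF x] by (simp add: sum_tix AA YZ I_low_simps)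
  have XZ: "I_D_W I x TX (TZ b) C E = 0" for b
    using I_D_W_I[of "TZ b" C E] sigma_nz[OF x] by (simp add: sum_tix I_D_W_YZ I_D_W_ZZ I_low_simps)
  show ?thesis
    using AA YZ XY XZ I_D_W_YZ I_D_W_ZZ I_D_W_skew[of TY TX] I_D_W_skew[of "TZ _" TX]
    by (cases A; cases B) simp_all
qed

end

end

section \<open>Almost Einstein manifolds\<close>

text \<open>The Y component of the parallel equation says that \<mu> is the gradient of \<sigma>,
  hence zero; the Z component then reads g\<rho> = 0.\<close>

lemma parallel_tractor_zero:
  assumes "chart_metric U g" "\<And>x. x \<in> U \<Longrightarrow> I x TY = 0"
    and par: "\<And>x a A. x \<in> U \<Longrightarrow> pd a (\<lambda>y. I y A) x + tractor_conn g x a (I x) A = 0"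
    and x: "x \<in> U"
  shows "I x A = (0 :: real)"
proof -
  interpret chart_metric U g by fact
  have Z: "I y (TZ a) = 0" if "y \<in> U" for y a
    using par[OF that, of a TY] pd_eq_0_on[OF U that assms(2)] by simp
  have gX: "g x $ a $ b * I x TX = 0" for a b
    using par[OF x, of a "TZ b"] pd_eq_0_on[OF U x Z] by (simp add: Z[OF x] assms(2)[OF x])
  fix a
  have "(\<Sum>b\<in>UNIV. ginv g x a b * g x $ b $ a) * I x TX = 0"
    by (simp only: sum_distrib_right mult.assoc gX mult_zero_right sum.neutral_const)
  then have "I x TX = 0" using ginv_g[OF x, of a a] by simp
  then show ?thesis using Z[OF x] assms(2)[OF x] by (cases A) auto
qed

lemma contract_tractor_D_zero:
  fixes g :: "'n::finite local_metric"
  assumes cm: "chart_metric U g" and d4: "CARD('n) \<noteq> 4"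
    and smooth_I: "\<And>A. smooth_on U (\<lambda>x. I x A)"
    and par: "\<And>x a A. x \<in> U \<Longrightarrow> pd a (\<lambda>y. I y A) x + tractor_conn g x a (I x) A = 0"
    and x: "x \<in> U"
  shows "(\<Sum>P\<in>UNIV. \<Sum>Q\<in>UNIV. tractor_metric g x P Q * I x P *
      tractor_D g (-2) (W_tractor g) x Q [A, B, C, E]) = 0"
proof (cases "\<forall>P. I x P = 0")
  case False
  interpret chart_metric U g by fact
  have restrict: "chart_metric V g" if "open V" "V \<subseteq> U" for V
    using that smooth_on_subset[OF smooth_g that(2)] g_sym g_invertible dim
    by unfold_locales auto
  obtain P where P: "I x P \<noteq> 0" using False by blast
  have "I_D_W I x A B C E = 0"
  proof (rule ccontr)
    assume nz: "I_D_W I x A B C E \<noteq> 0"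
    have c: "continuous_on U (\<lambda>x. I_D_W I x A B C E)" "continuous_on U (\<lambda>x. I x P)" "continuous_on U (\<lambda>x. I x TY)"
      by (intro smooth_on_continuous smooth_I_D_W smooth_I)+
    \<comment> \<open>On V both the claimed zero and the component P of I are non-zero. A point of V
      with \<sigma> \<noteq> 0 contradicts \<open>I_D_W_zero\<close>; if there is none,
      \<open>parallel_tractor_zero\<close> makes I vanish on V.\<close>
    define V where "V = {y \<in> U. I_D_W I y A B C E \<noteq> 0} \<inter> {y \<in> U. I y P \<noteq> 0}"
    have op: "open {y \<in> U. f y \<noteq> 0}" if "continuous_on U f" for f :: "real^'n \<Rightarrow> real"
      using continuous_open_preimage[OF that U, of "- {0}"] by (simp add: vimage_def Int_def open_Compl)
    have V: "open V" "V \<subseteq> U" "x \<in> V"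
      using op[OF c(1)] op[OF c(2)] nz P x by (auto simp: V_def)
    define V' where "V' = V \<inter> {y \<in> U. I y TY \<noteq> 0}"
    have V': "open V'" "V' \<subseteq> U" using V op[OF c(3)] by (auto simp: V'_def)
    have "V' = {}"
    proof (rule ccontr)
      assume "V' \<noteq> {}"
      then obtain y where y: "y \<in> V'" by blast
      interpret p: parallel_chart V' g I
        using restrict[OF V'] smooth_on_subset[OF smooth_I V'(2)] par V'(2) d4
        by (intro parallel_chart.intro parallel_chart_axioms.intro) (auto simp: V'_def)
      have "I_D_W I y A B C E = 0" by (rule p.I_D_W_zero[OF y])
      with y show False by (auto simp: V'_def V_def)
    qed
    then have "I y TY = 0" if "y \<in> V" for y using that V(2) by (auto simp: V'_def)
    then have "I x P = 0"
      by (rule parallel_tractor_zero[OF restrict[OF V(1,2)]]) (use par V in auto)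
    with P show False by simp
  qed
  then show ?thesis using contract_tractor_D[OF x, of I A B C E] by simp
qed simp

theorem theorem1p4:
  fixes M :: "'a topology" and \<A> :: "('a, 'n::finite) chart set"
    and G :: "('a, 'n) metric set"
    and I :: "('a, 'n) metric \<Rightarrow> ('a, 'n) chart \<Rightarrow> real^'n \<Rightarrow> 'n tix \<Rightarrow> real"
  assumes "CARD('n) \<ge> 3" and "CARD('n) \<noteq> 4"
    and "almost_einstein M \<A> G I"
  shows "\<forall>g\<in>G. \<forall>c\<in>\<A>. \<forall>x\<in>cimage c. \<forall>As. length As = 4 \<longrightarrow>
    (\<Sum>A\<in>UNIV. \<Sum>B\<in>UNIV. tractor_metric (g c) x A B * I g c x A *
       tractor_D (g c) (-2) (W_tractor (g c)) x B As) = 0"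
proof (intro ballI allI impI)
  fix g c x and As :: "'n tix list"
  assume g: "g \<in> G" and c: "c \<in> \<A>" and x: "x \<in> cimage c" and len: "length As = 4"
  obtain A B C E where As: "As = [A, B, C, E]"
    using len by (auto simp: eval_nat_numeral length_Suc_conv)
  have ae: "smooth_manifold M \<A>" "conformal_structure \<A> G" "tractor_section \<A> G I" "parallel_tractor \<A> G I"
    using assms(3) by (auto simp: almost_einstein_def)
  have "riemannian_metric \<A> g" using ae(2) g by (auto simp: conformal_structure_def)
  then have rm: "smooth_on (cimage c) (\<lambda>y. g c y $ i $ j)"
    "\<And>y. y \<in> cimage c \<Longrightarrow> g c y $ i $ j = g c y $ j $ i"
    "\<And>y v. y \<in> cimage c \<Longrightarrow> v \<noteq> 0 \<Longrightarrow> v \<bullet> (g c y *v v) > 0" for i j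
    using c unfolding riemannian_metric_def by blast+
  have "invertible (g c y)" if "y \<in> cimage c" for y
  proof -
    have "v = 0" if "g c y *v v = 0" for v
      using rm(3)[OF \<open>y \<in> cimage c\<close>, of v] that by fastforce
    then show ?thesis
      using matrix_left_invertible_ker[of "g c y"] invertible_left_inverse by blast
  qed
  then have cm: "chart_metric (cimage c) (g c)"
    using rm ae(1) c assms(1) by unfold_locales (auto simp: smooth_manifold_def is_chart_def)
  show "(\<Sum>A\<in>UNIV. \<Sum>B\<in>UNIV. tractor_metric (g c) x A B * I g c x A *
       tractor_D (g c) (-2) (W_tractor (g c)) x B As) = 0"
    unfolding As
  proof (rule contract_tractor_D_zero[OF cm assms(2) _ _ x])
    show "smooth_on (cimage c) (\<lambda>x. I g c x A)" for A
      using ae(3) g c by (simp add: tractor_section_def)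
    show "pd a (\<lambda>y. I g c y A) x + tractor_conn (g c) x a (I g c x) A =
        0" if "x \<in> cimage c" for x a A
      using ae(4) g c that by (simp add: parallel_tractor_def)
  qed
qed

end
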